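(* (RN-AdS control fields, cusp normal form and uniform crossover.) 1. Let $\mathcal I(z;\tau,q)=\frac{1}{2\tau}\left(z+z^3+q^2/z-2\pi\tau z^2\right)$, $z_c=1/\sqrt6$, $q_c=1/6$, $\tau_c=\sqrt6/(3\pi)$, $\Delta\tau=\tau-\tau_c$, $\Delta q=q-q_c$, and let $\Delta$ denote the common order of $\Delta\tau,\Delta q$. Expanding about $z_c$ and translating the local coordinate by a shift of order $\Delta$ (new coordinate $y$) to remove the cubic term gives $$\mathcal I=\mathcal I_0(\tau,q)-wy+uy^2+\frac{3\pi}{2}y^4+\mathcal O(y^5,\Delta y^3,\Delta^2y),$$ where $\mathcal I_0(\tau,q)$ is the control-dependent constant term and $$u=3\pi\Delta q-\frac{\sqrt6\,\pi^2}{2}\Delta\tau,\qquad w=\pi^2\Delta\tau+\frac{\sqrt6\,\pi}{2}\Delta q .$$ The Jacobian $\partial(u,w)/\partial(\tau,q)=-9\pi^3/2$ is nonzero, so $u,w$ are independent local fields. The zero-field direction $w=0$ is $\Delta\tau=-\frac{\sqrt6}{2\pi}\Delta q$, and on it $u=\frac{9\pi}{2}\Delta q$; its side $\Delta q\ge0$ has $u\ge0$ and a single local minimum. 2. Write the normal form with explicit positive coefficients $c_1,c_2,c_4$, $$I_E-\frac{\mathcal I_0(\tau,q)}{g}=\frac1g\left(c_4y^4+c_2uy^2-c_1wy\right)+\cdots,$$ with critical point $u=w=0$, and introduce $$x=\left(\frac{c_4}{g}\right)^{1/4}y,\qquad \lambda=\frac{c_2u}{\sqrt{c_4g}},\qquad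 h=\frac{c_1w}{c_4^{1/4}g^{3/4}},$$ $$\mathcal V(x)=x^4+\lambda x^2-hx,\qquad \mathcal Z(\lambda,h)=\int_{-\infty}^{\infty}dx\,e^{-\mathcal V(x)} .$$ Let the measure be $\mathcal N(g)\rho_z\,dz$ with $\mathcal N(g)$ independent of $z$, and let $\mu_0(\tau,q)=\lim_{g\to0}\rho_y(0;\tau,q,g)$ with $\rho_y=\rho_z|dz/dy|$. Then, as $g\to0$ with $\lambda$ and $h$ held fixed, the local partition function is $$Z_{\mathrm{loc}}=\exp\left[-\frac{\mathcal I_0(\tau,q)}{g}\right]\mathcal N(g)\,\mu_0(\tau,q)\left(\frac{g}{c_4}\right)^{1/4}\mathcal Z(\lambda,h)\left[1+\mathcal O(g^{1/4})\right].$$ Equivalently, for $\Gamma_{\mathrm{eff}}=-\ln Z_{\mathrm{loc}}$, $$\Gamma_{\mathrm{eff}}-\frac{\mathcal I_0(\tau,q)}{g}=\frac14\ln\frac{c_4}{g}-\ln\mathcal Z(\lambda,h)-\ln\left[\mathcal N(g)\mu_0(\tau,q)\right]+\mathcal O(g^{1/4}).$$ If $x_*$ is the unique global minimum of $\mathcal V$, the normalized generalized free energy contribution is $$\frac{\bar F-F_{\mathrm{cl}}}{T_E}=\langle\mathcal V\rangle-\mathcal V(x_* )+\mathcal O(g^{1/4}),$$ where $\langle\mathcal V\rangle=\mathcal Z(\lambda,h)^{-1}\int_{-\infty}^{\infty}\mathcal V e^{-\mathcal V}dx$. For RN-AdS, $c_4=3\pi/2$ and $c_1=c_2=1$, with $u,w$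 as in part 1; for the RN-AdS energy measure $\rho_z=\rho_E$ one has $\mu_0(\tau_c,q_c)=2/3$.
   Context: This concerns the four-dimensional Reissner–Nordström–AdS reduced ensemble in dimensionless variables: AdS radius $L$, semiclassical parameter $g=G_N/L^2$, $z=r/L$ (horizon radius), $q=Q/L$ (charge), $\tau=LT_E$ (ensemble temperature). The reduced Euclidean action is $I_E=\mathcal I/g$ and the generalized free energy is $F_{\mathrm{gen}}=T_EI_E$. At $(\tau_c,q_c)$ the point $z_c$ is a quartic minimum of $\mathcal I$ (first three derivatives vanish). The collective coordinate ranges over the nonextremal branch $z>z_e(q)>0$, $z_e(q)^2=\frac{-1+\sqrt{1+12q^2}}{6}$; the critical saddle lies strictly inside it and the endpoint stays outside the scaling region. The density $\rho_z$ is smooth and nonzero near the saddle. The energy measure has density $\rho_E(z,q)=\frac12(1+3z^2-q^2/z^2)$. $\bar F$ is the average of $F_{\mathrm{gen}}$ over the branch with normalized weight proportional to $\rho_z e^{-I_E}dz$ (so $\mathcal N(g)$ cancels). $F_{\mathrm{cl}}$ is the value of $F_{\mathrm{gen}}$ at its global minimum at the same $(\tau,q)$. $Z_{\mathrm{loc}}$ is the contribution of the saddle region near $z_c$ to $\int\mathcal N(g)\rho_z e^{-I_E}dz$. The notation $\mathcal O(y^5,\Delta y^3,\Delta^2y)$ denotes a remainder made of terms of those orders. In part 2 the dots denote the corresponding omitted terms of the normal form, i.e. $g^{-1}$ times terms $\mathcal O(y^5,\Delta y^3,\Delta^2y)$.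
   Formalization: The density is assumed smooth in (z,τ,q,g) up to g=0; for the free energy its weight over the branch must have a bounded integral at some fixed coupling near criticality, and for general models the critical saddle is assumed a separated global minimum (for RN-AdS this is proved). *)

theory Defs
  imports "HOL-Analysis.Analysis" "HOL-Library.Landau_Symbols"
begin

section \<open>Smooth functions and local minima\<close>

primrec Ck_on :: "nat \<Rightarrow> ('a::euclidean_space \<Rightarrow> real) \<Rightarrow> 'a set \<Rightarrow> bool" where
  "Ck_on 0 f S \<longleftrightarrow> continuous_on S f"
| "Ck_on (Suc k) f S \<longleftrightarrow> (\<forall>x\<in>S. f differentiable (at x)) \<and>
     (\<forall>b\<in>Basis. Ck_on k (\<lambda>x. frechet_derivative f (at x) b) S)"

definition smooth_near :: "('a::euclidean_space \<Rightarrow> real) \<Rightarrow> 'a \<Rightarrow> bool" where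
  "smooth_near f x \<longleftrightarrow> (\<exists>U. open U \<and> x \<in> U \<and> (\<forall>k. Ck_on k f U))"

definition local_min :: "(real \<Rightarrow> real) \<Rightarrow> real \<Rightarrow> bool" where
  "local_min f x \<longleftrightarrow> (\<forall>\<^sub>F x' in nhds x. f x \<le> f x')"

definition jacobian2 :: "(real \<Rightarrow> real \<Rightarrow> real) \<Rightarrow> (real \<Rightarrow> real \<Rightarrow> real) \<Rightarrow> real \<Rightarrow> real \<Rightarrow> real" where
  "jacobian2 u w \<tau> q =
     deriv (\<lambda>t. u t q) \<tau> * deriv (\<lambda>s. w \<tau> s) q - deriv (\<lambda>s. u \<tau> s) q * deriv (\<lambda>t. w t q) \<tau>"

section \<open>The quartic scaling potential\<close>

definition cusp_V :: "real \<Rightarrow> real \<Rightarrow> real \<Rightarrow> real" where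
  "cusp_V l h x = x ^ 4 + l * x\<^sup>2 - h * x"

definition cusp_Z :: "real \<Rightarrow> real \<Rightarrow> real" where
  "cusp_Z l h = (\<integral>x. exp (- cusp_V l h x) \<partial>lborel)"

definition cusp_mean_V :: "real \<Rightarrow> real \<Rightarrow> real" where
  "cusp_mean_V l h = (\<integral>x. cusp_V l h x * exp (- cusp_V l h x) \<partial>lborel) / cusp_Z l h"

section \<open>Ensembles with a cusp normal form\<close>

text \<open>
  \<open>control_size\<close> is the common order \<open>\<Delta>\<close> of the two control displacements, and
  \<open>cusp_order\<close> generates the remainder class \<open>O(y^5, \<Delta> y^3, \<Delta>^2 y)\<close>: a sum of three terms of
  these orders is the same as a single term dominated by the sum of their absolute values.
\<close>

definition control_size :: "real \<Rightarrow> real \<Rightarrow> real \<Rightarrow> real \<Rightarrow> real" where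
  "control_size \<tau>0 q0 \<tau> q = norm (\<tau> - \<tau>0, q - q0)"

definition cusp_order :: "real \<Rightarrow> real \<Rightarrow> real \<times> real \<times> real \<Rightarrow> real" where
  "cusp_order \<tau>0 q0 = (\<lambda>(y, \<tau>, q).
     \<bar>y\<bar> ^ 5 + control_size \<tau>0 q0 \<tau> q * \<bar>y\<bar> ^ 3 + (control_size \<tau>0 q0 \<tau> q)\<^sup>2 * \<bar>y\<bar>)"

text \<open>
  \<open>action M z \<tau> q\<close> is the reduced action \<open>\<I>\<close>, so that \<open>I_E = action M z \<tau> q / g\<close>;
  \<open>branch M \<tau> q\<close> is the range of the collective coordinate \<open>z\<close>;
  \<open>chart M y \<tau> q\<close> is the value of \<open>z\<close> at the normal-form coordinate \<open>y\<close>;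
  \<open>coef1\<close>, \<open>coef2\<close>, \<open>coef4\<close> are \<open>c\<^sub>1\<close>, \<open>c\<^sub>2\<close>, \<open>c\<^sub>4\<close>.
\<close>

record cusp_model =
  action :: "real \<Rightarrow> real \<Rightarrow> real \<Rightarrow> real"
  branch :: "real \<Rightarrow> real \<Rightarrow> real set"
  zcrit :: real
  taucrit :: real
  qcrit :: real
  chart :: "real \<Rightarrow> real \<Rightarrow> real \<Rightarrow> real"
  ufield :: "real \<Rightarrow> real \<Rightarrow> real"
  wfield :: "real \<Rightarrow> real \<Rightarrow> real"
  coef1 :: real
  coef2 :: real
  coef4 :: real

abbreviation crit :: "cusp_model \<Rightarrow> real \<times> real" where
  "crit M \<equiv> (taucrit M, qcrit M)"

definition action0 :: "cusp_model \<Rightarrow> real \<Rightarrow> real \<Rightarrow> real" where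
  "action0 M \<tau> q = action M (chart M 0 \<tau> q) \<tau> q"

definition has_normal_form :: "cusp_model \<Rightarrow> bool" where
  "has_normal_form M \<longleftrightarrow>
     (\<lambda>(y, \<tau>, q). action M (chart M y \<tau> q) \<tau> q - action0 M \<tau> q
        - (coef4 M * y ^ 4 + coef2 M * ufield M \<tau> q * y\<^sup>2 - coef1 M * wfield M \<tau> q * y))
     \<in> O[nhds (0, taucrit M, qcrit M)](cusp_order (taucrit M) (qcrit M))"

definition cusp_local :: "cusp_model \<Rightarrow> bool" where
  "cusp_local M \<longleftrightarrow>
     coef1 M > 0 \<and> coef2 M > 0 \<and> coef4 M > 0 \<and>
     ufield M (taucrit M) (qcrit M) = 0 \<and> wfield M (taucrit M) (qcrit M) = 0 \<and>
     smooth_near (\<lambda>(\<tau>, q). ufield M \<tau> q) (crit M) \<and>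
     smooth_near (\<lambda>(\<tau>, q). wfield M \<tau> q) (crit M) \<and>
     jacobian2 (ufield M) (wfield M) (taucrit M) (qcrit M) \<noteq> 0 \<and>
     smooth_near (\<lambda>(z, \<tau>, q). action M z \<tau> q) (zcrit M, taucrit M, qcrit M) \<and>
     smooth_near (\<lambda>(y, \<tau>, q). chart M y \<tau> q) (0, taucrit M, qcrit M) \<and>
     chart M 0 (taucrit M) (qcrit M) = zcrit M \<and>
     deriv (\<lambda>y. chart M y (taucrit M) (qcrit M)) 0 \<noteq> 0 \<and>
     (\<exists>r>0. \<forall>\<^sub>F (\<tau>, q) in nhds (crit M). ball (zcrit M) r \<subseteq> branch M \<tau> q) \<and>
     has_normal_form M"

text \<open>
  The action on the whole branch: the critical saddle is the global minimum and, near the critical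
  controls, the action stays uniformly above it away from the saddle.  Only averages over the
  full branch use this.
\<close>

definition cusp_global :: "cusp_model \<Rightarrow> bool" where
  "cusp_global M \<longleftrightarrow>
     taucrit M > 0 \<and>
     (\<forall>\<^sub>F (\<tau>, q) in nhds (crit M).
        open (branch M \<tau> q) \<and> continuous_on (branch M \<tau> q) (\<lambda>z. action M z \<tau> q)) \<and>
     (\<forall>r>0. \<exists>\<delta>>0. \<forall>\<^sub>F (\<tau>, q) in nhds (crit M). \<forall>z\<in>branch M \<tau> q.
        \<bar>z - zcrit M\<bar> \<ge> r \<longrightarrow>
        action M z \<tau> q \<ge> action M (zcrit M) (taucrit M) (qcrit M) + \<delta>)"

section \<open>Measure densities\<close>

text \<open>
  A density \<open>\<rho> z \<tau> q g\<close> is only meaningful for \<open>g > 0\<close>.  Smoothness near the saddle includes the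
  semiclassical end \<open>g = 0\<close>: there is a smooth extension across it, nonzero at the critical saddle.
\<close>

definition density_near_saddle ::
    "cusp_model \<Rightarrow> (real \<Rightarrow> real \<Rightarrow> real \<Rightarrow> real \<Rightarrow> real) \<Rightarrow> bool" where
  "density_near_saddle M \<rho> \<longleftrightarrow>
     (\<forall>z \<tau> q g. z \<in> branch M \<tau> q \<and> g > 0 \<longrightarrow> \<rho> z \<tau> q g \<ge> 0) \<and>
     (\<exists>\<rho>'. smooth_near \<rho>' (zcrit M, taucrit M, qcrit M, 0) \<and>
           \<rho>' (zcrit M, taucrit M, qcrit M, 0) \<noteq> 0 \<and>
           (\<forall>\<^sub>F (z, \<tau>, q, g) in nhds (zcrit M, taucrit M, qcrit M, 0).
              g > 0 \<longrightarrow> \<rho> z \<tau> q g = \<rho>' (z, \<tau>, q, g)))"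

text \<open>
  Convergence of the ensemble over the full branch: at some reference coupling \<open>g1\<close> the
  integral of the weight is bounded uniformly near the critical controls and small \<open>g\<close>.
\<close>

definition density_tail ::
    "cusp_model \<Rightarrow> (real \<Rightarrow> real \<Rightarrow> real \<Rightarrow> real \<Rightarrow> real) \<Rightarrow> bool" where
  "density_tail M \<rho> \<longleftrightarrow>
     (\<exists>g1>0. \<exists>C. \<forall>\<^sub>F ((\<tau>, q), g) in nhds (crit M) \<times>\<^sub>F at_right 0.
        set_integrable lborel (branch M \<tau> q) (\<lambda>z. \<rho> z \<tau> q g * exp (- action M z \<tau> q / g1)) \<and>
        (LINT z:branch M \<tau> q|lborel. \<rho> z \<tau> q g * exp (- action M z \<tau> q / g1)) \<le> C)"

definition rho_y :: "cusp_model \<Rightarrow> (real \<Rightarrow> real \<Rightarrow> real \<Rightarrow> real \<Rightarrow> real) \<Rightarrow>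
    real \<Rightarrow> real \<Rightarrow> real \<Rightarrow> real \<Rightarrow> real" where
  "rho_y M \<rho> y \<tau> q g = \<rho> (chart M y \<tau> q) \<tau> q g * \<bar>deriv (\<lambda>y. chart M y \<tau> q) y\<bar>"

definition mu0 :: "cusp_model \<Rightarrow> (real \<Rightarrow> real \<Rightarrow> real \<Rightarrow> real \<Rightarrow> real) \<Rightarrow> real \<Rightarrow> real \<Rightarrow> real" where
  "mu0 M \<rho> \<tau> q = Lim (at_right 0) (\<lambda>g. rho_y M \<rho> 0 \<tau> q g)"

section \<open>Scaling limit and partition function\<close>

definition scal_lambda :: "cusp_model \<Rightarrow> real \<Rightarrow> real \<Rightarrow> real \<Rightarrow> real" where
  "scal_lambda M \<tau> q g = coef2 M * ufield M \<tau> q / sqrt (coef4 M * g)"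

definition scal_h :: "cusp_model \<Rightarrow> real \<Rightarrow> real \<Rightarrow> real \<Rightarrow> real" where
  "scal_h M \<tau> q g = coef1 M * wfield M \<tau> q / (coef4 M powr (1/4) * g powr (3/4))"

text \<open>
  The limit \<open>g \<rightarrow> 0\<close> with both scaling variables held fixed, as a curve \<open>g \<mapsto> (T g, Q g)\<close> of controls
  running into the critical point.
\<close>

definition scaling_curve ::
    "cusp_model \<Rightarrow> real \<Rightarrow> real \<Rightarrow> (real \<Rightarrow> real) \<Rightarrow> (real \<Rightarrow> real) \<Rightarrow> bool" where
  "scaling_curve M l h T Q \<longleftrightarrow>
     ((\<lambda>g. (T g, Q g)) \<longlongrightarrow> crit M) (at_right 0) \<and>
     (\<forall>\<^sub>F g in at_right 0. scal_lambda M (T g) (Q g) g = l \<and> scal_h M (T g) (Q g) g = h)"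

definition Z_loc :: "cusp_model \<Rightarrow> (real \<Rightarrow> real \<Rightarrow> real \<Rightarrow> real \<Rightarrow> real) \<Rightarrow> (real \<Rightarrow> real) \<Rightarrow>
    real \<Rightarrow> real \<Rightarrow> real \<Rightarrow> real \<Rightarrow> real \<Rightarrow> real" where
  "Z_loc M \<rho> N a b \<tau> q g =
     (LINT z:{a<..<b}|lborel. N g * \<rho> z \<tau> q g * exp (- action M z \<tau> q / g))"

definition Gamma_eff :: "cusp_model \<Rightarrow> (real \<Rightarrow> real \<Rightarrow> real \<Rightarrow> real \<Rightarrow> real) \<Rightarrow> (real \<Rightarrow> real) \<Rightarrow>
    real \<Rightarrow> real \<Rightarrow> real \<Rightarrow> real \<Rightarrow> real \<Rightarrow> real" where
  "Gamma_eff M \<rho> N a b \<tau> q g = - ln (Z_loc M \<rho> N a b \<tau> q g)"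

text \<open>
  The saddle region is any sufficiently small fixed interval \<open>(a, b)\<close> around the critical saddle.
\<close>

definition partition_crossover ::
    "cusp_model \<Rightarrow> (real \<Rightarrow> real \<Rightarrow> real \<Rightarrow> real \<Rightarrow> real) \<Rightarrow> (real \<Rightarrow> real) \<Rightarrow> bool" where
  "partition_crossover M \<rho> N \<longleftrightarrow>
     (\<exists>r>0. \<forall>a b. zcrit M - r < a \<and> a < zcrit M \<and> zcrit M < b \<and> b < zcrit M + r \<longrightarrow>
       (\<forall>l h T Q. scaling_curve M l h T Q \<longrightarrow>
         (\<lambda>g. Z_loc M \<rho> N a b (T g) (Q g) g
               / (exp (- action0 M (T g) (Q g) / g) * N g * mu0 M \<rho> (T g) (Q g)
                  * (g / coef4 M) powr (1/4) * cusp_Z l h) - 1)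
           \<in> O[at_right 0](\<lambda>g. g powr (1/4)) \<and>
         (\<lambda>g. Gamma_eff M \<rho> N a b (T g) (Q g) g - action0 M (T g) (Q g) / g
               - (1/4 * ln (coef4 M / g) - ln (cusp_Z l h) - ln (N g * mu0 M \<rho> (T g) (Q g))))
           \<in> O[at_right 0](\<lambda>g. g powr (1/4))))"

section \<open>Generalized free energy\<close>

definition T_E :: "real \<Rightarrow> real \<Rightarrow> real" where
  "T_E L \<tau> = \<tau> / L"

definition F_gen :: "cusp_model \<Rightarrow> real \<Rightarrow> real \<Rightarrow> real \<Rightarrow> real \<Rightarrow> real \<Rightarrow> real" where
  "F_gen M L \<tau> q g z = T_E L \<tau> * (action M z \<tau> q / g)"

definition F_bar :: "cusp_model \<Rightarrow> (real \<Rightarrow> real \<Rightarrow> real \<Rightarrow> real \<Rightarrow> real) \<Rightarrow>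
    real \<Rightarrow> real \<Rightarrow> real \<Rightarrow> real \<Rightarrow> real" where
  "F_bar M \<rho> L \<tau> q g =
     (LINT z:branch M \<tau> q|lborel. F_gen M L \<tau> q g z * (\<rho> z \<tau> q g * exp (- action M z \<tau> q / g)))
     / (LINT z:branch M \<tau> q|lborel. \<rho> z \<tau> q g * exp (- action M z \<tau> q / g))"

definition F_cl :: "cusp_model \<Rightarrow> real \<Rightarrow> real \<Rightarrow> real \<Rightarrow> real \<Rightarrow> real" where
  "F_cl M L \<tau> q g = F_gen M L \<tau> q g (arg_min_on (F_gen M L \<tau> q g) (branch M \<tau> q))"

text \<open>
  The first clause says that \<open>F_cl\<close> and \<open>F_bar\<close> are well defined (the minimum is attained, the
  integrals converge), so that no default value of \<open>arg_min_on\<close> or of the integral is involved.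
\<close>

definition free_energy_crossover ::
    "cusp_model \<Rightarrow> (real \<Rightarrow> real \<Rightarrow> real \<Rightarrow> real \<Rightarrow> real) \<Rightarrow> bool" where
  "free_energy_crossover M \<rho> \<longleftrightarrow>
     (\<forall>L>0. \<forall>l h T Q xs. scaling_curve M l h T Q \<and> (\<forall>x. x \<noteq> xs \<longrightarrow> cusp_V l h xs < cusp_V l h x) \<longrightarrow>
       (\<forall>\<^sub>F g in at_right 0.
          (\<exists>z. is_arg_min (F_gen M L (T g) (Q g) g) (\<lambda>z. z \<in> branch M (T g) (Q g)) z) \<and>
          set_integrable lborel (branch M (T g) (Q g))
            (\<lambda>z. \<rho> z (T g) (Q g) g * exp (- action M z (T g) (Q g) / g)) \<and>
          set_integrable lborel (branch M (T g) (Q g))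
            (\<lambda>z. F_gen M L (T g) (Q g) g z
                 * (\<rho> z (T g) (Q g) g * exp (- action M z (T g) (Q g) / g)))) \<and>
       (\<lambda>g. (F_bar M \<rho> L (T g) (Q g) g - F_cl M L (T g) (Q g) g) / T_E L (T g)
             - (cusp_mean_V l h - cusp_V l h xs))
         \<in> O[at_right 0](\<lambda>g. g powr (1/4)))"

section \<open>The RN-AdS ensemble\<close>

definition rn_action :: "real \<Rightarrow> real \<Rightarrow> real \<Rightarrow> real" where
  "rn_action z \<tau> q = 1 / (2 * \<tau>) * (z + z ^ 3 + q\<^sup>2 / z - 2 * pi * \<tau> * z\<^sup>2)"

definition rn_zc :: real where "rn_zc = 1 / sqrt 6"
definition rn_qc :: real where "rn_qc = 1 / 6"
definition rn_tauc :: real where "rn_tauc = sqrt 6 / (3 * pi)"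

definition rn_u :: "real \<Rightarrow> real \<Rightarrow> real" where
  "rn_u \<tau> q = 3 * pi * (q - rn_qc) - sqrt 6 * pi\<^sup>2 / 2 * (\<tau> - rn_tauc)"

definition rn_w :: "real \<Rightarrow> real \<Rightarrow> real" where
  "rn_w \<tau> q = pi\<^sup>2 * (\<tau> - rn_tauc) + sqrt 6 * pi / 2 * (q - rn_qc)"

definition rn_ze :: "real \<Rightarrow> real" where
  "rn_ze q = sqrt ((- 1 + sqrt (1 + 12 * q\<^sup>2)) / 6)"

definition rn_branch :: "real \<Rightarrow> real \<Rightarrow> real set" where
  "rn_branch \<tau> q = {z. z > rn_ze q}"

text \<open>
  The third \<open>z\<close>-derivative of the action is \<open>3 (1 - q^2 / z^4) / \<tau>\<close>; it vanishes at \<open>z = sqrt q\<close>,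
  which is therefore the translated origin that removes the cubic term.
\<close>

definition rn_shift :: "real \<Rightarrow> real \<Rightarrow> real" where
  "rn_shift \<tau> q = sqrt q - rn_zc"

definition rn_chart :: "real \<Rightarrow> real \<Rightarrow> real \<Rightarrow> real" where
  "rn_chart y \<tau> q = rn_zc + rn_shift \<tau> q + y"

definition rn_rho_E :: "real \<Rightarrow> real \<Rightarrow> real \<Rightarrow> real \<Rightarrow> real" where
  "rn_rho_E z \<tau> q g = 1 / 2 * (1 + 3 * z\<^sup>2 - q\<^sup>2 / z\<^sup>2)"

definition rn_model :: cusp_model where
  "rn_model = \<lparr> action = rn_action, branch = rn_branch,
     zcrit = rn_zc, taucrit = rn_tauc, qcrit = rn_qc,
     chart = rn_chart, ufield = rn_u, wfield = rn_w,
     coef1 = 1, coef2 = 1, coef4 = 3 * pi / 2 \<rparr>"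

end

(* Near the cusp the controls on a scaling curve are of order sqrt g, so with k = (g / c4)^(1/4) and
   y = k x the normal form divided by g is the quartic potential up to an error k times a polynomial
   in x, and the density times the chart Jacobian is its value at the saddle up to a relative error
   k (1 + |x|).  Both integrands stay below exp (- x^4 / 8) times a polynomial, which turns these
   pointwise errors into errors of order k = O(g^(1/4)) for the integrals of exp (- V) and
   V exp (- V); the part of the branch away from the saddle is exponentially small in 1 / g.
   For RN-AdS the expansion of q^2 / z about z = sqrt q is an explicit geometric sum, and at the
   critical controls the action exceeds its saddle value by exactly (z - z_c)^4 / (2 tau_c z). *)
theory Submission
  imports Defs
begin

section \<open>Smooth functions\<close>

text \<open>The three remainder orders are those that survive division by
  \<open>g = c4 * k ^ 4\<close>: with \<open>y = k * x\<close> and \<Delta> of order k^2, each of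
  y^5, \<Delta> y^3 and \<Delta>^2 y has order k^5. The bound on \<Delta> has to be derived: fixed
  \<lambda> and h give u of order k^2 and w of order k^3, and the nonzero Jacobian turns this into a
  bound on the controls. The quintic remainder would beat the quartic term at large x, so the
  comparison is confined to a fixed window in y; in x its half-width is of order 1/k, and beyond it
  1 is at most a multiple of k |x|, so truncation costs no more than the other errors. Both
  integrals are treated by one estimate for a class of functions G with decay and a Lipschitz bound.
  The divergent term \<open>action0 / g\<close> sits in both \<open>F_bar\<close> and
  \<open>F_cl\<close> and drops out of the difference, where only the minimal value of the action,
  not its location, is compared. On the rest of the branch the weight at coupling g is compared with
  the weight at a fixed coupling g1, and the gap of the action yields the small factor.\<close>

lemma Ck_on_cong:
  assumes "open U" "\<And>x. x \<in> U \<Longrightarrow> f x = g x" "Ck_on k f U"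
  shows "Ck_on k g U"
  using assms
proof (induction k arbitrary: f g)
  case 0
  then show ?case by (simp add: continuous_on_cong[of U U f g])
next
  case (Suc k)
  have eq: "frechet_derivative g (at x) = frechet_derivative f (at x)"
    and d: "g differentiable (at x)" if "x \<in> U" for x
  proof -
    have fd: "f differentiable (at x)" using Suc.prems(3) that by simp
    show "frechet_derivative g (at x) = frechet_derivative f (at x)"
      using frechet_derivative_transform_within_open[OF fd \<open>open U\<close> that] Suc.prems(2) by metis
    from fd obtain f' where "(f has_derivative f') (at x)" by (auto simp: differentiable_def)
    then have "(g has_derivative f') (at x)"
      using has_derivative_transform_within_open[OF _ \<open>open U\<close> that] Suc.prems(2) by metis
    then show "g differentiable (at x)" by (auto simp: differentiable_def)
  qed
  show ?case
    using Suc.IH[OF \<open>open U\<close>, of "\<lambda>x. frechet_derivative f (at x) b" "\<lambda>x. frechet_derivative g (at x) b" for b]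
      Suc.prems(3) eq d by simp
qed

lemma Ck_on_Suc_imp: "Ck_on (Suc k) f U \<Longrightarrow> Ck_on k f U"
proof (induction k arbitrary: f)
  case 0
  then show ?case
    by (auto intro!: continuous_at_imp_continuous_on differentiable_imp_continuous_within)
next
  case (Suc k)
  then show ?case by (metis Ck_on.simps(2))
qed

text \<open>Lets a closure proof exhibit the derivative by a formula instead of the choice-based
  \<open>frechet_derivative\<close>. On the open set \<open>U\<close> the two coincide pointwise,
  and \<open>Ck_on_cong\<close> carries order \<open>k\<close> across.\<close>

lemma Ck_on_SucI:
  assumes "open U" "\<And>x. x \<in> U \<Longrightarrow> (f has_derivative f' x) (at x)"
    "\<And>b. b \<in> Basis \<Longrightarrow> Ck_on k (\<lambda>x. f' x b) U"
  shows "Ck_on (Suc k) f U"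
proof -
  have eq: "f' x = frechet_derivative f (at x)" if "x \<in> U" for x
    using frechet_derivative_at assms(2) that by blast
  have "Ck_on k (\<lambda>x. frechet_derivative f (at x) b) U" if "b \<in> Basis" for b
    by (rule Ck_on_cong[OF assms(1) _ assms(3)[OF that]]) (simp add: eq)
  then show ?thesis using assms(2) by (auto simp: differentiable_def)
qed

lemma Ck_on_has_derivative:
  assumes "Ck_on (Suc k) f U" "x \<in> U"
  shows "(f has_derivative frechet_derivative f (at x)) (at x)"
  using assms by (simp add: frechet_derivative_works)

lemma Ck_on_const: "Ck_on k (\<lambda>x. c) U"
  by (induction k arbitrary: c) (auto simp: frechet_derivative_const)

lemma Ck_on_linear: 
  assumes "bounded_linear f" "open U" shows "Ck_on k f U"
proof (cases k)
  case 0
  then show ?thesis using assms linear_continuous_on by auto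
next
  case (Suc j)
  show ?thesis unfolding Suc
    by (rule Ck_on_SucI[OF assms(2) bounded_linear_imp_has_derivative[OF assms(1)]])
      (rule Ck_on_const)
qed

lemma Ck_on_add:
  assumes "open U" "Ck_on k f U" "Ck_on k g U"
  shows "Ck_on k (\<lambda>x. f x + g x) U"
  using assms(2,3)
proof (induction k arbitrary: f g)
  case 0
  then show ?case by (simp add: continuous_on_add)
next
  case (Suc k)
  show ?case
    by (rule Ck_on_SucI[OF assms(1) has_derivative_add[OF Ck_on_has_derivative Ck_on_has_derivative]])
      (use Suc in auto)
qed

lemma Ck_on_mult:
  assumes "open U" "Ck_on k f U" "Ck_on k g U"
  shows "Ck_on k (\<lambda>x. f x * g x) U"
  using assms(2,3)
proof (induction k arbitrary: f g)
  case 0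
  then show ?case by (simp add: continuous_on_mult)
next
  case (Suc k)
  show ?case
    \<comment> \<open>The product rule keeps each factor undifferentiated in one term, so besides
      the derivatives the factors themselves are needed at order \<open>k\<close>, one below their
      hypothesis.\<close>
    by (rule Ck_on_SucI[OF assms(1) has_derivative_mult[OF Ck_on_has_derivative Ck_on_has_derivative]])
      (use Suc.prems Suc.prems[THEN Ck_on_Suc_imp] in \<open>auto intro!: Ck_on_add assms(1) Suc.IH\<close>)
qed

text \<open>A bootstrap: the derivative of 1/f is a product of two copies of 1/f with the derivative
  of f, so order \<open>k\<close> for 1/f, which is the induction hypothesis, gives order
  \<open>k\<close> for its derivative. \<open>Ck_on_sqrt\<close> climbs in the same way.\<close>

lemma Ck_on_inverse:
  assumes "open U" "\<And>x. x \<in> U \<Longrightarrow> f x \<noteq> 0" "Ck_on k f U"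
  shows "Ck_on k (\<lambda>x. inverse (f x)) U"
  using assms(3)
proof (induction k)
  case 0
  then show ?case using assms(2) by (simp add: continuous_on_inverse)
next
  case (Suc k)
  have I: "Ck_on k (\<lambda>x. inverse (f x)) U" using Suc Ck_on_Suc_imp by blast
  have D: "((\<lambda>x. inverse (f x)) has_derivative
      (\<lambda>b. (-1) * (inverse (f x) * frechet_derivative f (at x) b * inverse (f x)))) (at x)" if "x \<in> U" for x
    using Deriv.has_derivative_inverse[OF assms(2)[OF that] Ck_on_has_derivative[OF Suc.prems that]]
    by simp
  show ?case
    by (rule Ck_on_SucI[OF assms(1) D], assumption, intro Ck_on_mult[OF assms(1)] Ck_on_const I)
      (use Suc.prems in auto)
qed

lemma Ck_on_sqrt:
  assumes "open U" "\<And>x. x \<in> U \<Longrightarrow> f x > 0" "Ck_on k f U"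
  shows "Ck_on k (\<lambda>x. sqrt (f x)) U"
  using assms(3)
proof (induction k)
  case 0
  then show ?case by (simp add: continuous_on_real_sqrt)
next
  case (Suc k)
  have I: "Ck_on k (\<lambda>x. sqrt (f x)) U" using Suc Ck_on_Suc_imp by blast
  have D: "((\<lambda>x. sqrt (f x)) has_derivative
      (\<lambda>b. frechet_derivative f (at x) b * (inverse (sqrt (f x)) * (1/2)))) (at x)" if "x \<in> U" for x
    using has_derivative_real_sqrt[OF assms(2)[OF that] Ck_on_has_derivative[OF Suc.prems that]]
    by (simp add: field_simps)
  have nz: "sqrt (f x) \<noteq> 0" if "x \<in> U" for x using assms(2)[OF that] by simp
  show ?case
    by (rule Ck_on_SucI[OF assms(1) D], assumption,
        intro Ck_on_mult[OF assms(1)] Ck_on_const Ck_on_inverse[OF assms(1)] I nz)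
      (use Suc.prems in auto)
qed

lemma Ck_on_subset: "Ck_on k f U \<Longrightarrow> V \<subseteq> U \<Longrightarrow> Ck_on k f V"
  by (induction k arbitrary: f) (auto intro: continuous_on_subset)

section \<open>Smooth germs: arithmetic, Lipschitz bounds and the Jacobian estimate\<close>

lemma smooth_near_const: "smooth_near (\<lambda>x. c) x0"
  unfolding smooth_near_def by (intro exI[of _ UNIV]) (simp add: Ck_on_const)

lemma smooth_near_linear: "bounded_linear f \<Longrightarrow> smooth_near f x0"
  unfolding smooth_near_def by (intro exI[of _ UNIV]) (simp add: Ck_on_linear)

lemma smooth_near_add:
  assumes "smooth_near f x0" "smooth_near g x0"
  shows "smooth_near (\<lambda>x. f x + g x) x0"
proof -
  from assms obtain U V where "open U" "x0 \<in> U" "open V" "x0 \<in> V"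
    and fg: "\<forall>k. Ck_on k f U" "\<forall>k. Ck_on k g V" unfolding smooth_near_def by auto
  then show ?thesis unfolding smooth_near_def
    by (intro exI[of _ "U \<inter> V"])
      (auto intro!: Ck_on_add intro: Ck_on_subset[OF fg(1)[rule_format]] Ck_on_subset[OF fg(2)[rule_format]])
qed

lemma smooth_near_mult:
  assumes "smooth_near f x0" "smooth_near g x0"
  shows "smooth_near (\<lambda>x. f x * g x) x0"
proof -
  from assms obtain U V where "open U" "x0 \<in> U" "open V" "x0 \<in> V"
    and fg: "\<forall>k. Ck_on k f U" "\<forall>k. Ck_on k g V" unfolding smooth_near_def by auto
  then show ?thesis unfolding smooth_near_def
    by (intro exI[of _ "U \<inter> V"])
      (auto intro!: Ck_on_mult intro: Ck_on_subset[OF fg(1)[rule_format]] Ck_on_subset[OF fg(2)[rule_format]])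
qed

lemma smooth_near_minus: "smooth_near f x0 \<Longrightarrow> smooth_near (\<lambda>x. - f x) x0"
  using smooth_near_mult[OF smooth_near_const[of "-1"]] by fastforce

lemma smooth_near_diff:
  "smooth_near f x0 \<Longrightarrow> smooth_near g x0 \<Longrightarrow> smooth_near (\<lambda>x. f x - g x) x0"
  using smooth_near_add[OF _ smooth_near_minus] by fastforce

lemma smooth_near_power: "smooth_near f x0 \<Longrightarrow> smooth_near (\<lambda>x. f x ^ n) x0"
  by (induction n) (auto intro: smooth_near_const smooth_near_mult)

text \<open>Shrinks the neighbourhood until an open condition on the value at the centre holds
  throughout, the form in which \<open>Ck_on_inverse\<close> and \<open>Ck_on_sqrt\<close> ask for
  nonvanishing or positivity.\<close>

lemma smooth_near_restrict:
  assumes "smooth_near f x0" "open P" "f x0 \<in> P"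
  obtains U where "open U" "x0 \<in> U" "\<And>k. Ck_on k f U" "\<And>x. x \<in> U \<Longrightarrow> f x \<in> P"
proof -
  from assms obtain U where U: "open U" "x0 \<in> U" "\<forall>k. Ck_on k f U" unfolding smooth_near_def by auto
  have "continuous_on U f" using U(3)[rule_format, of 0] by simp
  then have "open (U \<inter> f -` P)" using U(1) assms(2) continuous_on_open_vimage by (metis Int_commute)
  then show ?thesis using U assms(3) by (intro that[of "U \<inter> f -` P"]) (auto intro: Ck_on_subset)
qed

lemma smooth_near_inverse:
  assumes "smooth_near f x0" "f x0 \<noteq> 0"
  shows "smooth_near (\<lambda>x. inverse (f x)) x0"
  by (rule smooth_near_restrict[OF assms(1), of "- {0}"])
    (use assms(2) in \<open>auto simp: smooth_near_def intro!: Ck_on_inverse\<close>)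

lemma smooth_near_divide:
  "smooth_near f x0 \<Longrightarrow> smooth_near g x0 \<Longrightarrow> g x0 \<noteq> 0 \<Longrightarrow> smooth_near (\<lambda>x. f x / g x) x0"
  unfolding divide_inverse by (intro smooth_near_mult smooth_near_inverse)

lemma smooth_near_sqrt:
  assumes "smooth_near f x0" "f x0 > 0"
  shows "smooth_near (\<lambda>x. sqrt (f x)) x0"
  by (rule smooth_near_restrict[OF assms(1), of "{0<..}"])
    (use assms(2) in \<open>auto simp: smooth_near_def intro!: Ck_on_sqrt\<close>)

lemma smooth_near_frechet:
  assumes "smooth_near f x0" "b \<in> Basis"
  shows "smooth_near (\<lambda>x. frechet_derivative f (at x) b) x0"
proof -
  from assms(1) obtain U where "open U" "x0 \<in> U" and U: "\<And>k. Ck_on k f U"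
    unfolding smooth_near_def by auto
  then show ?thesis using assms(2) Ck_on.simps(2)[THEN iffD1, OF U]
    unfolding smooth_near_def by (intro exI[of _ U]) auto
qed

lemma smooth_near_eventually_differentiable:
  assumes "smooth_near f x0"
  shows "\<forall>\<^sub>F x in nhds x0. (f has_derivative frechet_derivative f (at x)) (at x)"
proof -
  from assms(1) obtain U where "open U" "x0 \<in> U" and U: "\<And>k. Ck_on k f U"
    unfolding smooth_near_def by auto
  then show ?thesis using Ck_on_has_derivative[OF U] eventually_nhds by blast
qed

lemma smooth_near_continuous:
  assumes "smooth_near f x0" shows "(f \<longlongrightarrow> f x0) (nhds x0)"
proof -
  from assms(1) obtain U where "open U" "x0 \<in> U" and U: "\<And>k. Ck_on k f U"
    unfolding smooth_near_def by auto
  moreover have "continuous_on U f" using Ck_on.simps(1)[THEN iffD1, OF U] .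
  ultimately have "isCont f x0" by (simp add: continuous_on_eq_continuous_at)
  then show ?thesis by (simp add: isCont_def tendsto_at_iff_tendsto_nhds)
qed

text \<open>The partial derivatives are continuous, hence bounded on a compact ball; the sum of
  their bounds over the basis dominates the operator norm, and the mean value inequality on the
  convex ball gives the Lipschitz constant.\<close>

lemma smooth_near_lipschitz:
  assumes "smooth_near f x0"
  obtains r L where "r > 0" "L \<ge> 0"
    "\<And>x y. x \<in> ball x0 r \<Longrightarrow> y \<in> ball x0 r \<Longrightarrow> \<bar>f x - f y\<bar> \<le> L * norm (x - y)"
proof -
  from assms(1) obtain U where "open U" "x0 \<in> U" and U: "\<And>k. Ck_on k f U"
    unfolding smooth_near_def by auto
  then obtain r where r: "r > 0" "cball x0 r \<subseteq> U" using open_contains_cball by meson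
  let ?D = "\<lambda>x. frechet_derivative f (at x)"
  have "\<exists>B. \<forall>x\<in>cball x0 r. \<bar>?D x b\<bar> \<le> B" if "b \<in> Basis" for b
  proof -
    have "continuous_on U (\<lambda>x. ?D x b)" using Ck_on.simps(2)[THEN iffD1, OF U[of "Suc 0"]] that by simp
    then have "continuous_on (cball x0 r) (\<lambda>x. ?D x b)" using r(2) continuous_on_subset by blast
    then have "compact ((\<lambda>x. ?D x b) ` cball x0 r)" by (intro compact_continuous_image compact_cball)
    then obtain B where "\<forall>y\<in>(\<lambda>x. ?D x b) ` cball x0 r. norm y \<le> B"
      using compact_imp_bounded[THEN bounded_iff[THEN iffD1]] by blast
    then show ?thesis by (intro exI[of _ B]) auto
  qed
  then have "\<exists>B. \<forall>b\<in>Basis. \<forall>x\<in>cball x0 r. \<bar>?D x b\<bar> \<le> B b" by (intro bchoice) blast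
  then obtain B where B: "\<And>b x. b \<in> Basis \<Longrightarrow> x \<in> cball x0 r \<Longrightarrow> \<bar>?D x b\<bar> \<le> B b" by blast
  define L where "L = (\<Sum>b\<in>Basis. \<bar>B b\<bar>)"
  have der: "(f has_derivative ?D x) (at x)" if "x \<in> cball x0 r" for x
    using Ck_on_has_derivative[OF U] r that by blast
  have on: "onorm (?D x) \<le> L" if "x \<in> cball x0 r" for x
  proof (rule onorm_le)
    fix v :: 'a
    have lin: "linear (?D x)" using der[OF that] has_derivative_linear by blast
    have "?D x v = ?D x (\<Sum>b\<in>Basis. (v \<bullet> b) *\<^sub>R b)" by (simp add: euclidean_representation)
    also have "\<dots> = (\<Sum>b\<in>Basis. (v \<bullet> b) * ?D x b)" by (simp add: linear_sum[OF lin] linear_scale[OF lin])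
    also have "norm \<dots> \<le> (\<Sum>b\<in>Basis. norm v * \<bar>B b\<bar>)"
    proof (rule sum_norm_le)
      fix b :: 'a assume b: "b \<in> Basis"
      have "\<bar>v \<bullet> b\<bar> \<le> norm v" using Basis_le_norm[OF b] by simp
      moreover have "\<bar>?D x b\<bar> \<le> \<bar>B b\<bar>" using B[OF b that] by linarith
      ultimately show "norm ((v \<bullet> b) * ?D x b) \<le> norm v * \<bar>B b\<bar>"
        by (simp add: abs_mult mult_mono)
    qed
    finally show "norm (?D x v) \<le> L * norm v" by (simp add: L_def sum_distrib_left mult.commute)
  qed
  show ?thesis
  proof (rule that[OF r(1)])
    show "L \<ge> 0" unfolding L_def by (simp add: sum_nonneg)
    fix x y assume "x \<in> ball x0 r" "y \<in> ball x0 r"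
    then have "norm (f x - f y) \<le> L * norm (x - y)"
      by (intro differentiable_bound[OF convex_cball[of x0 r], of f ?D])
        (auto intro!: on has_derivative_at_withinI[OF der])
    then show "\<bar>f x - f y\<bar> \<le> L * norm (x - y)" by simp
  qed
qed

text \<open>A nonsingular derivative is bounded below by some \<open>m\<close> times the norm of the
  displacement. Near the point the nonlinear remainder takes at most half of this, so the
  displacement of the controls is bounded by the change of the two fields.\<close>

lemma jacobian2_controls_distance:
  fixes u w :: "real \<Rightarrow> real \<Rightarrow> real"
  assumes "smooth_near (\<lambda>(t, q). u t q) (t0, q0)" "smooth_near (\<lambda>(t, q). w t q) (t0, q0)"
    and jac: "jacobian2 u w t0 q0 \<noteq> 0"
  obtains C where "C > 0"
    "\<forall>\<^sub>F (t, q) in nhds (t0, q0). norm (t - t0, q - q0) \<le> C * (\<bar>u t q - u t0 q0\<bar> + \<bar>w t q - w t0 q0\<bar>)"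
proof -
  \<comment> \<open>The total derivative supplied by smoothness is expressed by its two matrix
    entries, which are the one-variable derivatives that enter \<open>jacobian2\<close>.\<close>
  have der: "\<exists>A B. ((\<lambda>(t, q). f t q) has_derivative (\<lambda>v. A * fst v + B * snd v)) (at (t0, q0)) \<and>
      deriv (\<lambda>t. f t q0) t0 = A \<and> deriv (\<lambda>q. f t0 q) q0 = B"
    if f: "smooth_near (\<lambda>(t, q). f t q) (t0, q0)" for f :: "real \<Rightarrow> real \<Rightarrow> real"
  proof -
    obtain F where F: "((\<lambda>(t, q). f t q) has_derivative F) (at (t0, q0))"
      using eventually_nhds_x_imp_x[OF smooth_near_eventually_differentiable[OF f]] by blast
    have lin: "linear F" using F has_derivative_linear by blast
    have Feq: "F = (\<lambda>v. F (1, 0) * fst v + F (0, 1) * snd v)"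
    proof
      fix v :: "real \<times> real"
      have "v = fst v *\<^sub>R (1, 0) + snd v *\<^sub>R (0, 1)" by (cases v) simp
      then have "F v = fst v *\<^sub>R F (1, 0) + snd v *\<^sub>R F (0, 1)"
        using linear_add[OF lin] linear_scale[OF lin] by metis
      then show "F v = F (1, 0) * fst v + F (0, 1) * snd v" by simp
    qed
    define A B where "A = F (1, 0)" and "B = F (0, 1)"
    have F': "((\<lambda>(t, q). f t q) has_derivative (\<lambda>v. A * fst v + B * snd v)) (at (t0, q0))"
      using F Feq unfolding A_def B_def by simp
    have "((\<lambda>(t, q). f t q) \<circ> (\<lambda>t. (t, q0)) has_derivative (\<lambda>v. A * fst v + B * snd v) \<circ> (\<lambda>h. (h, 0))) (at t0)"
      by (rule diff_chain_at) (use F' in \<open>auto intro!: derivative_eq_intros\<close>)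
    then have "((\<lambda>t. f t q0) has_derivative (\<lambda>h. A * h)) (at t0)" by (simp add: o_def)
    then have 1: "deriv (\<lambda>t. f t q0) t0 = A"
      by (simp add: DERIV_imp_deriv has_field_derivative_def)
    have "((\<lambda>(t, q). f t q) \<circ> (\<lambda>q. (t0, q)) has_derivative (\<lambda>v. A * fst v + B * snd v) \<circ> (\<lambda>h. (0, h))) (at q0)"
      by (rule diff_chain_at) (use F' in \<open>auto intro!: derivative_eq_intros\<close>)
    then have "((\<lambda>q. f t0 q) has_derivative (\<lambda>h. B * h)) (at q0)" by (simp add: o_def)
    then have 2: "deriv (\<lambda>q. f t0 q) q0 = B"
      by (simp add: DERIV_imp_deriv has_field_derivative_def)
    show ?thesis using F' 1 2 by blast
  qed
  from der[OF assms(1)] obtain A B where u: "((\<lambda>(t, q). u t q) has_derivative (\<lambda>v. A * fst v + B * snd v)) (at (t0, q0))"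
      "deriv (\<lambda>t. u t q0) t0 = A" "deriv (\<lambda>q. u t0 q) q0 = B" by blast
  from der[OF assms(2)] obtain A' B' where w: "((\<lambda>(t, q). w t q) has_derivative (\<lambda>v. A' * fst v + B' * snd v)) (at (t0, q0))"
      "deriv (\<lambda>t. w t q0) t0 = A'" "deriv (\<lambda>q. w t0 q) q0 = B'" by blast
  have det: "A * B' - B * A' \<noteq> 0" using jac u w by (simp add: jacobian2_def)
  let ?f = "\<lambda>(t, q). (u t q, w t q)"
  let ?L = "\<lambda>v. (A * fst v + B * snd v, A' * fst v + B' * snd v)"
  have f: "(?f has_derivative ?L) (at (t0, q0))"
    using has_derivative_Pair[OF u(1) w(1)] by (simp add: case_prod_unfold)
  have lin: "linear ?L" using f has_derivative_linear by blast
  have "inj ?L"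
  proof (subst linear_injective_0[OF lin], clarify)
    fix a b assume "?L (a, b) = 0"
    then have e: "A * a + B * b = 0" "A' * a + B' * b = 0" by (auto simp: zero_prod_def)
    \<comment> \<open>Cramer's rule: each coordinate of a kernel vector, times the determinant, is a
      combination of the two vanishing rows.\<close>
    have *: "(A * B' - B * A') * a = B' * (A * a + B * b) - B * (A' * a + B' * b)"
      "(A * B' - B * A') * b = A * (A' * a + B' * b) - A' * (A * a + B * b)" by algebra+
    show "(a, b) = 0" using * det unfolding e by (simp add: zero_prod_def)
  qed
  with lin obtain m where m: "m > 0" "\<And>v. m * norm v \<le> norm (?L v)"
    using linear_inj_bounded_below_pos by blast
  from f[unfolded has_derivative_at_alt] m(1) obtain d where d: "d > 0"
    "\<And>y. norm (y - (t0, q0)) < d \<Longrightarrow> norm (?f y - ?f (t0, q0) - ?L (y - (t0, q0))) \<le> m / 2 * norm (y - (t0, q0))"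
    by (meson half_gt_zero)
  have key: "norm (t - t0, q - q0) \<le> 2 / m * (\<bar>u t q - u t0 q0\<bar> + \<bar>w t q - w t0 q0\<bar>)"
    if "dist (t, q) (t0, q0) < d" for t q
  proof -
    let ?v = "(t - t0, q - q0)"
    let ?F = "(u t q - u t0 q0, w t q - w t0 q0)"
    have "norm (?F - ?L ?v) \<le> m / 2 * norm ?v"
      using d(2)[of "(t, q)"] that by (simp add: dist_norm)
    moreover have "norm (?L ?v) \<le> norm ?F + norm (?F - ?L ?v)"
      by (metis norm_minus_commute norm_triangle_sub)
    ultimately have "m / 2 * norm ?v \<le> norm ?F" using m(2)[of ?v] by linarith
    also have "\<dots> \<le> \<bar>u t q - u t0 q0\<bar> + \<bar>w t q - w t0 q0\<bar>"
      using norm_Pair_le[of "u t q - u t0 q0" "w t q - w t0 q0"] by simp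
    finally show ?thesis using m(1) by (simp add: field_simps)
  qed
  show ?thesis
  proof (rule that[of "2 / m"])
    show "\<forall>\<^sub>F (t, q) in nhds (t0, q0).
      norm (t - t0, q - q0) \<le> 2 / m * (\<bar>u t q - u t0 q0\<bar> + \<bar>w t q - w t0 q0\<bar>)"
      unfolding eventually_nhds_metric using d(1) key by (intro exI[of _ d]) auto
  qed (use m in simp)
qed

section \<open>Laplace asymptotics of the quartic potential\<close>

text \<open>The range is split at max 1 (8 A): beyond it A \<le> t / 8, so even the cubic power
  costs only t^4 / 8; below it everything is at most a constant.\<close>

lemma cubic_le_quartic:
  fixes A t :: real
  assumes "A \<ge> 0" "t \<ge> 0" "j \<in> {1, 2, 3}"
  shows "A * t ^ j \<le> t ^ 4 / 8 + A * (max 1 (8 * A)) ^ 3"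
proof -
  define b where "b = max 1 (8 * A)"
  have b: "b \<ge> 1" "b \<ge> 8 * A" by (auto simp: b_def)
  show ?thesis unfolding b_def[symmetric]
  proof (cases "t \<ge> b")
    case True
    have "t ^ j \<le> t ^ 3" using assms(3) True b by (intro power_increasing) auto
    then have "A * t ^ j \<le> A * t ^ 3" using assms(1) by (rule mult_left_mono)
    also have "\<dots> \<le> (t / 8) * t ^ 3" using True b assms by (intro mult_right_mono) auto
    also have "\<dots> = t ^ 4 / 8" by (simp add: power4_eq_xxxx power3_eq_cube)
    also have "\<dots> \<le> t ^ 4 / 8 + A * b ^ 3" using assms b by simp
    finally show "A * t ^ j \<le> t ^ 4 / 8 + A * b ^ 3" .
  next
    case False
    have "t ^ j \<le> b ^ j" using False assms by (intro power_mono) auto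
    also have "\<dots> \<le> b ^ 3" using assms(3) b by (intro power_increasing) auto
    finally have "A * t ^ j \<le> A * b ^ 3" using assms(1) by (rule mult_left_mono)
    then show "A * t ^ j \<le> t ^ 4 / 8 + A * b ^ 3" using assms(2) by (simp add: add_increasing)
  qed
qed

text \<open>The four lower-order terms l x^2, h x, D |x| and D |x|^3 cost at most x^4 / 8 each,
  together exactly the x^4 / 2 that is available. The \<open>D\<close> terms leave room for the
  scaled remainder of the normal form.\<close>

lemma cusp_V_coercive:
  obtains K where "K \<ge> 0" "\<And>x::real. x ^ 4 / 2 + l * x\<^sup>2 - h * x - D * (\<bar>x\<bar> ^ 3 + \<bar>x\<bar>) \<ge> - K"
proof -
  have "\<exists>b\<ge>0. \<forall>x. \<bar>A\<bar> * \<bar>x\<bar> ^ j \<le> x ^ 4 / 8 + b" if "j \<in> {1,2,3}" for A :: real and j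
    using cubic_le_quartic[of "\<bar>A\<bar>" "\<bar>_\<bar>" j] that
    by (intro exI[of _ "\<bar>A\<bar> * (max 1 (8 * \<bar>A\<bar>)) ^ 3"]) auto
  from this[of 2 l] this[of 1 h] this[of 1 D] this[of 3 D] obtain b1 b2 b3 b4 where
    b: "b1 \<ge> 0" "b2 \<ge> 0" "b3 \<ge> 0" "b4 \<ge> 0" "\<And>x. \<bar>l\<bar> * \<bar>x\<bar> ^ 2 \<le> x ^ 4 / 8 + b1"
      "\<And>x. \<bar>h\<bar> * \<bar>x\<bar> ^ 1 \<le> x ^ 4 / 8 + b2" "\<And>x. \<bar>D\<bar> * \<bar>x\<bar> ^ 1 \<le> x ^ 4 / 8 + b3"
      "\<And>x. \<bar>D\<bar> * \<bar>x\<bar> ^ 3 \<le> x ^ 4 / 8 + b4" by auto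
  show ?thesis
  proof (rule that[of "b1 + b2 + b3 + b4"])
    show "b1 + b2 + b3 + b4 \<ge> 0" using b by simp
    fix x :: real
    have "- (l * x\<^sup>2) \<le> \<bar>l\<bar> * \<bar>x\<bar> ^ 2" using abs_ge_minus_self[of "l * x\<^sup>2"] by (simp add: abs_mult)
    moreover have "h * x \<le> \<bar>h\<bar> * \<bar>x\<bar> ^ 1" using abs_ge_self[of "h * x"] by (simp add: abs_mult)
    moreover have "D * (\<bar>x\<bar> ^ 3 + \<bar>x\<bar>) \<le> \<bar>D\<bar> * \<bar>x\<bar> ^ 3 + \<bar>D\<bar> * \<bar>x\<bar> ^ 1"
      unfolding power_one_right distrib_left[symmetric] by (intro mult_right_mono) auto
    ultimately show "x ^ 4 / 2 + l * x\<^sup>2 - h * x - D * (\<bar>x\<bar> ^ 3 + \<bar>x\<bar>) \<ge> - (b1 + b2 + b3 + b4)"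
      using b(5-8)[of x] by linarith
  qed
qed

text \<open>The shape of an integrand \<open>G (I / g)\<close> that the scaling limit tolerates; both \<open>e^{-s}\<close> and
  \<open>s e^{-s}\<close> qualify.  The halved exponent absorbs the factor \<open>s\<close>.\<close>

definition exp_tame :: "(real \<Rightarrow> real) \<Rightarrow> bool" where
  "exp_tame G \<longleftrightarrow> continuous_on UNIV G \<and>
     (\<forall>K. \<exists>B. \<forall>m\<ge>-K. \<forall>s\<ge>m. \<forall>t\<ge>m.
        \<bar>G s\<bar> \<le> B * exp (- m / 2) \<and> \<bar>G s - G t\<bar> \<le> B * exp (- m / 2) * \<bar>s - t\<bar>)"

text \<open>A derivative that decays like exp(- s / 2) is bounded on the half-line from
  \<open>m\<close> by its bound at the left end, so the mean value inequality there gives the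
  Lipschitz estimate.\<close>

lemma exp_tameI:
  assumes D: "\<And>s. (G has_real_derivative G' s) (at s)"
    and B: "\<And>K. \<exists>B. \<forall>s\<ge>-K. \<bar>G s\<bar> \<le> B * exp (- s / 2) \<and> \<bar>G' s\<bar> \<le> B * exp (- s / 2)"
  shows "exp_tame G"
  unfolding exp_tame_def
proof (intro conjI allI)
  show "continuous_on UNIV G" using D by (auto intro!: continuous_at_imp_continuous_on DERIV_isCont)
  fix K :: real
  obtain B where B: "\<And>s. s \<ge> -K \<Longrightarrow> \<bar>G s\<bar> \<le> B * exp (- s / 2)" "\<And>s. s \<ge> -K \<Longrightarrow> \<bar>G' s\<bar> \<le> B * exp (- s / 2)"
    using B by meson
  have "0 \<le> B * exp (K / 2)" using B(1)[of "-K"] by simp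
  then have B0: "B \<ge> 0" by (simp add: zero_le_mult_iff)
  show "\<exists>B. \<forall>m\<ge>-K. \<forall>s\<ge>m. \<forall>t\<ge>m.
        \<bar>G s\<bar> \<le> B * exp (- m / 2) \<and> \<bar>G s - G t\<bar> \<le> B * exp (- m / 2) * \<bar>s - t\<bar>"
  proof (intro exI[of _ B] allI impI)
    fix m s t assume m: "m \<ge> - K" "s \<ge> m" "t \<ge> m"
    have mono: "B * exp (- r / 2) \<le> B * exp (- m / 2)" if "r \<ge> m" for r
      using that B0 by (intro mult_left_mono) auto
    have 1: "\<bar>G s\<bar> \<le> B * exp (- m / 2)" using B(1)[of s] mono[of s] m by linarith
    have "norm (G s - G t) \<le> B * exp (- m / 2) * norm (s - t)"
    proof (rule field_differentiable_bound[of "{m..}" G G'])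
      fix r assume "r \<in> {m..}"
      then show "norm (G' r) \<le> B * exp (- m / 2)" using B(2)[of r] mono[of r] m by auto
    qed (use D m in \<open>auto intro: has_field_derivative_at_within\<close>)
    with 1 show "\<bar>G s\<bar> \<le> B * exp (- m / 2) \<and> \<bar>G s - G t\<bar> \<le> B * exp (- m / 2) * \<bar>s - t\<bar>" by simp
  qed
qed

text \<open>A linear factor is absorbed by half of the exponential: s / 2 is below exp(s / 2), and
  the product \<open>exp (\<bar>K\<bar> / 2) * exp (s / 2)\<close> is at least 1, so the constants 1
  and 2 |K| are absorbed too.\<close>

lemma abs_le_exp_half:
  fixes s K :: real
  assumes "s \<ge> - K"
  shows "1 + \<bar>s\<bar> \<le> (3 + 2 * \<bar>K\<bar>) * exp (\<bar>K\<bar> / 2) * exp (s / 2)"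
proof -
  have 1: "1 \<le> exp (\<bar>K\<bar> / 2) * exp (s / 2)" using assms by (simp flip: exp_add)
  have "s / 2 \<le> exp (s / 2)" using exp_ge_add_one_self[of "s / 2"] by linarith
  also have "\<dots> \<le> exp (\<bar>K\<bar> / 2) * exp (s / 2)" by simp
  finally have 2: "\<bar>s\<bar> \<le> 2 * (exp (\<bar>K\<bar> / 2) * exp (s / 2)) + 2 * \<bar>K\<bar>" using assms by linarith
  have 3: "2 * \<bar>K\<bar> * 1 \<le> 2 * \<bar>K\<bar> * (exp (\<bar>K\<bar> / 2) * exp (s / 2))" using 1 by (intro mult_left_mono) auto
  have "1 + \<bar>s\<bar> \<le> (3 + 2 * \<bar>K\<bar>) * (exp (\<bar>K\<bar> / 2) * exp (s / 2))"
    unfolding distrib_right using 1 2 3 by linarith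
  then show ?thesis by (simp only: mult.assoc)
qed

lemma exp_tame_exp: "exp_tame (\<lambda>s. exp (- s))"
proof (rule exp_tameI[where G' = "\<lambda>s. - exp (- s)"])
  fix K :: real
  have "exp (- s) \<le> exp (\<bar>K\<bar> / 2) * exp (- s / 2)" if "s \<ge> -K" for s
    using that by (simp flip: exp_add)
  then show "\<exists>B. \<forall>s\<ge>-K. \<bar>exp (- s)\<bar> \<le> B * exp (- s / 2) \<and> \<bar>- exp (- s)\<bar> \<le> B * exp (- s / 2)"
    by (intro exI[of _ "exp (\<bar>K\<bar> / 2)"]) auto
qed (auto intro!: derivative_eq_intros)

lemma exp_tame_mult_exp: "exp_tame (\<lambda>s. s * exp (- s))"
proof (rule exp_tameI[where G' = "\<lambda>s. (1 - s) * exp (- s)"])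
  fix K :: real
  let ?B = "(3 + 2 * \<bar>K\<bar>) * exp (\<bar>K\<bar> / 2)"
  have *: "(1 + \<bar>s\<bar>) * exp (- s) \<le> ?B * exp (- s / 2)" if "s \<ge> -K" for s
  proof -
    have "(1 + \<bar>s\<bar>) * exp (- s) \<le> (?B * exp (s / 2)) * exp (- s)"
      using abs_le_exp_half[OF that] by (intro mult_right_mono) auto
    also have "\<dots> = ?B * exp (s / 2 + - s)" by (simp only: mult.assoc exp_add)
    also have "s / 2 + - s = - s / 2" by simp
    finally show ?thesis .
  qed
  have **: "\<bar>s\<bar> * exp (- s) \<le> (1 + \<bar>s\<bar>) * exp (- s)" "\<bar>1 - s\<bar> * exp (- s) \<le> (1 + \<bar>s\<bar>) * exp (- s)" for s :: real
    by (auto intro!: mult_right_mono)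
  show "\<exists>B. \<forall>s\<ge>-K. \<bar>s * exp (- s)\<bar> \<le> B * exp (- s / 2) \<and> \<bar>(1 - s) * exp (- s)\<bar> \<le> B * exp (- s / 2)"
    unfolding abs_mult abs_exp_cancel
    by (intro exI[of _ ?B] allI impI conjI order_trans[OF **(1) *] order_trans[OF **(2) *])
qed (auto intro!: derivative_eq_intros simp: algebra_simps)

section \<open>Integrable majorants and the scaled Laplace estimate\<close>

lemma integrable_exp_minus_abs: "integrable lborel (\<lambda>x::real. exp (- \<bar>x\<bar>))"
proof -
  have "(\<lambda>x::real. exp (- 1 * x)) integrable_on {0..}"
    by (rule integrable_on_exp_minus_to_infinity) simp
  then have "(\<lambda>x::real. exp (- x)) absolutely_integrable_on {0..}"
    by (intro nonnegative_absolutely_integrable_1) auto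
  then have "set_integrable lborel {0..} (\<lambda>x::real. exp (- x))"
    \<comment> \<open>Absolute integrability refers to the completed measure; a Borel measurable
      integrand brings it back to \<open>lborel\<close>.\<close>
    unfolding set_integrable_def by (subst (asm) integrable_completion) auto
  then have 1: "integrable lborel (\<lambda>x::real. indicat_real {0..} x * exp (- x))"
    by (simp add: set_integrable_def)
  have "integrable lborel (\<lambda>x::real. indicat_real {0..} (0 + (-1) * x) * exp (- (0 + (-1) * x)))"
    by (rule lborel_integrable_real_affine[OF 1]) simp
  \<comment> \<open>The two half-line pieces overlap only at 0, so their sum dominates
    \<open>exp (- \<bar>x\<bar>)\<close> everywhere.\<close>
  with 1 have "integrable lborel (\<lambda>x::real. indicat_real {0..} x * exp (- x) + indicat_real {0..} (- x) * exp x)"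
    by (intro Bochner_Integration.integrable_add) simp_all
  then show ?thesis
    by (rule Bochner_Integration.integrable_bound) (auto simp: indicator_def)
qed

text \<open>The powers 0 and 1 come from the error of the density, the powers 1, 3 and 5 from the
  error of the action; the exponent is half of the lower bound x^4 / 4 of the scaled action.\<close>

definition quartic_majorant :: "real \<Rightarrow> real" where
  "quartic_majorant x = (1 + \<bar>x\<bar> + \<bar>x\<bar> ^ 3 + \<bar>x\<bar> ^ 5) * exp (- (x ^ 4 / 8))"

lemma power_le_one_plus_power:
  fixes t :: real assumes "t \<ge> 0" "i \<le> n" shows "t ^ i \<le> 1 + t ^ n"
proof (cases "t \<ge> 1")
  case True then show ?thesis using power_increasing[OF assms(2) True] by simp
next
  case False
  then have "t ^ i \<le> 1" using assms by (simp add: power_le_one)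
  then show ?thesis using assms by (simp add: add_increasing2)
qed

text \<open>The four powers are each at most 1 + t^8. With T = t^4 the quadratic Taylor bound of
  exp(T / 16) ends in T^2 / 512, which explains 512 and uses up half of the exponent; the other half
  dominates t - 3, since t^3 \<ge> 27 > 16 for t > 3.\<close>

lemma integrable_quartic_majorant: "integrable lborel quartic_majorant"
proof -
  have bound: "quartic_majorant x \<le> 4 * 512 * exp 3 * exp (- \<bar>x\<bar>)" for x
  proof -
    define t where "t = \<bar>x\<bar>"
    have t: "t \<ge> 0" "x ^ 4 = t ^ 4" by (auto simp: t_def)
    have "t ^ 0 + t ^ 1 + t ^ 3 + t ^ 5 \<le> (1 + t ^ 8) + (1 + t ^ 8) + (1 + t ^ 8) + (1 + t ^ 8)"
      by (intro add_mono power_le_one_plus_power t) simp_all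
    then have p: "1 + t + t ^ 3 + t ^ 5 \<le> 4 * (1 + t ^ 8)" by simp
    have "1 + T\<^sup>2 \<le> 512 * exp (T / 16)" if "T \<ge> 0" for T :: real
    proof -
      have "1 + T / 16 + (T / 16)\<^sup>2 / 2 \<le> exp (T / 16)"
        using exp_lower_Taylor_quadratic[of "T / 16"] that by simp
      moreover have "(T / 16)\<^sup>2 = T\<^sup>2 / 256" by (simp add: power_divide)
      ultimately show ?thesis using that by linarith
    qed
    from this[of "t ^ 4"] have "1 + t ^ 8 \<le> 512 * exp (t ^ 4 / 16)"
      using t(1) by (simp flip: power_mult)
    then have "4 * (1 + t ^ 8) \<le> 4 * (512 * exp (t ^ 4 / 16))" by simp
    with p have p: "1 + t + t ^ 3 + t ^ 5 \<le> 4 * 512 * exp (t ^ 4 / 16)"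
      unfolding mult.assoc by (rule order_trans)
    have "t \<le> 3 + t ^ 4 / 16"
    proof (cases "t \<le> 3")
      case False
      then have "3 ^ 3 \<le> t ^ 3" by (intro power_mono) auto
      then have "16 * t \<le> t ^ 3 * t" using False by (intro mult_right_mono) auto
      also have "t ^ 3 * t = t ^ 4" by (simp add: power4_eq_xxxx power3_eq_cube)
      finally show ?thesis by simp
    qed (use t in \<open>simp add: add_increasing2\<close>)
    then have e: "exp (- (t ^ 4 / 16)) \<le> exp 3 * exp (- t)" by (simp flip: exp_add)
    have "quartic_majorant x = (1 + t + t ^ 3 + t ^ 5) * exp (- (t ^ 4 / 8))"
      by (simp add: quartic_majorant_def t_def)
    also have "\<dots> \<le> (4 * 512 * exp (t ^ 4 / 16)) * exp (- (t ^ 4 / 8))"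
      by (rule mult_right_mono[OF p]) simp
    also have "\<dots> = 4 * 512 * exp (t ^ 4 / 16 + - (t ^ 4 / 8))" by (simp only: mult.assoc exp_add)
    also have "t ^ 4 / 16 + - (t ^ 4 / 8) = - (t ^ 4 / 16)" by simp
    also have "4 * 512 * exp (- (t ^ 4 / 16)) \<le> 4 * 512 * (exp 3 * exp (- t))" using e by simp
    finally show ?thesis by (simp add: t_def)
  qed
  have meas: "quartic_majorant \<in> borel_measurable borel"
    unfolding quartic_majorant_def[abs_def] by measurable
  have nn: "quartic_majorant x \<ge> 0" for x by (simp add: quartic_majorant_def)
  show ?thesis
    by (rule Bochner_Integration.integrable_bound[of _ "\<lambda>x. 4 * 512 * exp 3 * exp (- \<bar>x\<bar>)"])
      (use bound nn meas in \<open>auto intro!: integrable_exp_minus_abs AE_I2 simp: abs_of_nonneg\<close>)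
qed

lemma cusp_V_continuous: "continuous_on UNIV (cusp_V l h)"
  unfolding cusp_V_def by (intro continuous_intros)

text \<open>Coercivity with \<open>D = 0\<close> gives
  \<open>cusp_V l h x \<ge> x ^ 4 / 4 - K\<close>, and the halved exponent in
  \<open>exp_tame\<close> turns this into decay like exp(- x^4 / 8).\<close>

lemma exp_tame_cusp_integrable:
  assumes "exp_tame G" shows "integrable lborel (\<lambda>x. G (cusp_V l h x))"
proof -
  obtain K where K: "K \<ge> 0" "\<And>x::real. x ^ 4 / 2 + l * x\<^sup>2 - h * x - 0 * (\<bar>x\<bar> ^ 3 + \<bar>x\<bar>) \<ge> - K"
    using cusp_V_coercive[of l h 0] by blast
  obtain B where B: "\<And>m s t. m \<ge> - K \<Longrightarrow> s \<ge> m \<Longrightarrow> t \<ge> m \<Longrightarrow> \<bar>G s\<bar> \<le> B * exp (- m / 2)"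
    using assms unfolding exp_tame_def by meson
  have "0 \<le> B * exp (- 0 / 2)" using B[of 0 0 0] K(1) by force
  then have B0: "B \<ge> 0" by simp
  have le: "\<bar>G (cusp_V l h x)\<bar> \<le> B * exp (K / 2) * quartic_majorant x" for x
  proof -
    let ?m = "x ^ 4 / 4 - K"
    have "X + a \<ge> X / 4 - K" if "X / 2 + a \<ge> - K" "X \<ge> 0" for X a :: real using that by linarith
    from this[of "x ^ 4" "l * x\<^sup>2 - h * x"] have V: "cusp_V l h x \<ge> ?m"
      using K(2)[of x] by (simp add: cusp_V_def algebra_simps)
    have "\<bar>G (cusp_V l h x)\<bar> \<le> B * exp (- ?m / 2)" by (rule B[OF _ V V]) simp
    also have "- ?m / 2 = K / 2 + - (x ^ 4 / 8)" by simp
    also have "B * exp (K / 2 + - (x ^ 4 / 8)) = B * exp (K / 2) * (1 * exp (- (x ^ 4 / 8)))"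
      by (simp only: exp_add mult.assoc mult_1)
    also have "\<dots> \<le> B * exp (K / 2) * quartic_majorant x"
      unfolding quartic_majorant_def using B0 by (intro mult_left_mono mult_right_mono) auto
    finally show ?thesis .
  qed
  have G: "continuous_on UNIV (\<lambda>x. G (cusp_V l h x))"
    using continuous_on_compose2[OF conjunct1[OF assms[unfolded exp_tame_def]] cusp_V_continuous] by simp
  show ?thesis
  proof (rule Bochner_Integration.integrable_bound)
    show "integrable lborel (\<lambda>x. B * exp (K / 2) * quartic_majorant x)"
      using integrable_quartic_majorant by simp
    show "(\<lambda>x. G (cusp_V l h x)) \<in> borel_measurable lborel"
      using borel_measurable_continuous_onI[OF G] by simp
    show "AE x in lborel. norm (G (cusp_V l h x)) \<le> norm (B * exp (K / 2) * quartic_majorant x)"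
      using le by (auto intro: order_trans[OF _ abs_ge_self])
  qed
qed

text \<open>The first bound is the approximation error of order k, its powers of x being the three
  remainder orders after scaling. The second is a lower bound uniform in k, which provides the
  domination.\<close>

definition cusp_close :: "real \<Rightarrow> real \<Rightarrow> real \<Rightarrow> real \<Rightarrow> real \<Rightarrow> real \<Rightarrow> real \<Rightarrow> bool" where
  "cusp_close l h C K k x p \<longleftrightarrow>
     \<bar>p - cusp_V l h x\<bar> \<le> C * k * (\<bar>x\<bar> ^ 5 + \<bar>x\<bar> ^ 3 + \<bar>x\<bar>) \<and> p \<ge> x ^ 4 / 4 - K"

text \<open>\<open>S\<close> stands for the saddle region in the scaled variable, \<open>P\<close>
  for the scaled action and \<open>W\<close> for the density times chart slope divided by its saddle
  value. The condition outside \<open>S\<close> says that \<open>S\<close> contains every x with k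
  |x| < \<eta>.\<close>

definition laplace_data :: "real \<Rightarrow> real \<Rightarrow> real \<Rightarrow> real \<Rightarrow> real \<Rightarrow> real \<Rightarrow>
    real set \<Rightarrow> (real \<Rightarrow> real) \<Rightarrow> (real \<Rightarrow> real) \<Rightarrow> bool" where
  "laplace_data l h C K \<eta> k S P W \<longleftrightarrow>
     open S \<and> continuous_on S P \<and> continuous_on S W \<and> (\<forall>x. x \<notin> S \<longrightarrow> \<eta> \<le> k * \<bar>x\<bar>) \<and>
     (\<forall>x\<in>S. cusp_close l h C K k x (P x) \<and> \<bar>W x - 1\<bar> \<le> C * k * (1 + \<bar>x\<bar>))"

text \<open>All errors are bounded pointwise by \<open>k\<close> times one integrable majorant, so
  the constant \<open>B\<close> is fixed before \<open>k\<close>, \<open>S\<close>, \<open>P\<close>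
  and \<open>W\<close>; this uniformity is what later permits controls that vary with g.\<close>

lemma scaled_laplace:
  assumes G: "exp_tame G" and "\<eta> > 0" and V: "\<And>x. cusp_V l h x \<ge> x ^ 4 / 4 - K" and "C \<ge> 0"
  obtains B where "B \<ge> 0"
    "\<And>k S P W. 0 < k \<Longrightarrow> k \<le> 1 \<Longrightarrow> laplace_data l h C K \<eta> k S P W \<Longrightarrow>
      set_integrable lborel S (\<lambda>x. W x * G (P x)) \<and>
      \<bar>(LINT x:S|lborel. W x * G (P x)) - (LINT x|lborel. G (cusp_V l h x))\<bar> \<le> B * k"
proof -
  obtain b where b_all: "\<forall>m\<ge>-K. \<forall>s\<ge>m. \<forall>t\<ge>m.
      \<bar>G s\<bar> \<le> b * exp (- m / 2) \<and> \<bar>G s - G t\<bar> \<le> b * exp (- m / 2) * \<bar>s - t\<bar>"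
    using conjunct2[OF G[unfolded exp_tame_def], THEN spec, of K] by (rule exE)
  have b: "\<bar>G s\<bar> \<le> b * exp (- m / 2)" "\<bar>G s - G t\<bar> \<le> b * exp (- m / 2) * \<bar>s - t\<bar>"
    if "m \<ge> - K" "s \<ge> m" "t \<ge> m" for m s t
    using b_all[rule_format, OF that] by simp_all
  have "0 \<le> b * exp (- (-K) / 2)" using b(1)[of "-K" "-K" "-K"] by force
  then have b0: "b \<ge> 0" by (simp add: zero_le_mult_iff)
  define a where "a = b * exp (K / 2)"
  have a0: "a \<ge> 0" using b0 by (simp add: a_def)
  have a: "b * exp (- (x ^ 4 / 4 - K) / 2) = a * exp (- (x ^ 4 / 8))" for x
    by (simp add: a_def field_simps flip: exp_add)
  have GV: "\<bar>G s\<bar> \<le> a * exp (- (x ^ 4 / 8))" if "s \<ge> x ^ 4 / 4 - K" for s x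
    using b(1)[of "x ^ 4 / 4 - K" s s] that a[of x] by simp
  have GL: "\<bar>G s - G t\<bar> \<le> a * exp (- (x ^ 4 / 8)) * \<bar>s - t\<bar>" if "s \<ge> x ^ 4 / 4 - K" "t \<ge> x ^ 4 / 4 - K" for s t x
    using b(2)[of "x ^ 4 / 4 - K" s t] that a[of x] by simp
  \<comment> \<open>One \<open>C\<close> comes from the weight \<open>W\<close>, one from the action
    \<open>P\<close>, and 1 / \<eta> from the points outside \<open>S\<close>.\<close>
  define A where "A = a * (2 * C + 1 / \<eta>)"
  have A0: "A \<ge> 0" using a0 assms by (simp add: A_def)
  have iG: "integrable lborel (\<lambda>x. G (cusp_V l h x))" by (rule exp_tame_cusp_integrable[OF G])
  have Gc: "continuous_on UNIV G" by (rule conjunct1[OF G[unfolded exp_tame_def]])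
  have main: "set_integrable lborel S (\<lambda>x. W x * G (P x)) \<and>
      \<bar>(LINT x:S|lborel. W x * G (P x)) - (LINT x|lborel. G (cusp_V l h x))\<bar> \<le> A * (LINT x|lborel. quartic_majorant x) * k"
    if k: "0 < k" "k \<le> 1" and data: "laplace_data l h C K \<eta> k S P W" for k S P W
  proof -
    have S: "open S" "continuous_on S P" "continuous_on S W"
      and out: "\<And>x. x \<notin> S \<Longrightarrow> \<eta> \<le> k * \<bar>x\<bar>"
      and P: "\<And>x. x \<in> S \<Longrightarrow> \<bar>P x - cusp_V l h x\<bar> \<le> C * k * (\<bar>x\<bar> ^ 5 + \<bar>x\<bar> ^ 3 + \<bar>x\<bar>)"
        "\<And>x. x \<in> S \<Longrightarrow> P x \<ge> x ^ 4 / 4 - K"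
      and W: "\<And>x. x \<in> S \<Longrightarrow> \<bar>W x - 1\<bar> \<le> C * k * (1 + \<bar>x\<bar>)"
      using data by (auto simp: laplace_data_def cusp_close_def)
    define F where "F x = indicat_real S x * (W x * G (P x))" for x
    have pt: "\<bar>F x - G (cusp_V l h x)\<bar> \<le> A * k * quartic_majorant x" for x
    proof -
      let ?e = "exp (- (x ^ 4 / 8))"
      let ?p = "1 + \<bar>x\<bar> + \<bar>x\<bar> ^ 3 + \<bar>x\<bar> ^ 5"
      show ?thesis
      proof (cases "x \<in> S")
        case True
        \<comment> \<open>Splits the error into that of the weight, multiplied by the decay of
          \<open>G\<close>, and that of the action, passed through the Lipschitz bound of
          \<open>G\<close> at level \<open>x ^ 4 / 4 - K\<close>.\<close>
        have "F x - G (cusp_V l h x) = (W x - 1) * G (P x) + (G (P x) - G (cusp_V l h x))"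
          using True by (simp add: F_def algebra_simps)
        also have "\<bar>\<dots>\<bar> \<le> \<bar>W x - 1\<bar> * \<bar>G (P x)\<bar> + \<bar>G (P x) - G (cusp_V l h x)\<bar>"
          using abs_triangle_ineq by (simp flip: abs_mult)
        also have "\<dots> \<le> (C * k * ?p) * (a * ?e) + a * ?e * (C * k * ?p)"
        proof (intro add_mono mult_mono)
          have "C * k * (1 + \<bar>x\<bar>) \<le> C * k * ?p" "C * k * (\<bar>x\<bar> ^ 5 + \<bar>x\<bar> ^ 3 + \<bar>x\<bar>) \<le> C * k * ?p"
            using assms k by (auto intro!: mult_left_mono)
          then show "\<bar>W x - 1\<bar> \<le> C * k * ?p"
            using W[OF True] by linarith
          have l: "\<bar>P x - cusp_V l h x\<bar> \<le> C * k * ?p"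
            using P(1)[OF True] \<open>C * k * (\<bar>x\<bar> ^ 5 + \<bar>x\<bar> ^ 3 + \<bar>x\<bar>) \<le> C * k * ?p\<close> by linarith
          show "\<bar>G (P x)\<bar> \<le> a * ?e" by (rule GV[OF P(2)[OF True]])
          have "\<bar>G (P x) - G (cusp_V l h x)\<bar> \<le> a * ?e * \<bar>P x - cusp_V l h x\<bar>"
            by (rule GL[OF P(2)[OF True] V])
          also have "\<dots> \<le> a * ?e * (C * k * ?p)" by (rule mult_left_mono[OF l]) (use a0 in simp)
          finally show "\<bar>G (P x) - G (cusp_V l h x)\<bar> \<le> a * ?e * (C * k * ?p)" .
        qed (use assms k in auto)
        also have "\<dots> = (a * (2 * C)) * k * quartic_majorant x" by (simp add: quartic_majorant_def)
        also have "\<dots> \<le> A * k * quartic_majorant x"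
          unfolding A_def using a0 k assms
          by (intro mult_right_mono mult_left_mono) (auto simp: quartic_majorant_def)
        finally show ?thesis .
      next
        case False
        \<comment> \<open>Outside \<open>S\<close> the integrand is missing altogether; the factor k
          |x| / \<eta>, at least 1 there, converts its full size into an error of order
          \<open>k\<close>.\<close>
        have "1 \<le> (1 / \<eta>) * k * \<bar>x\<bar>" using out[OF False] \<open>\<eta> > 0\<close> by (simp add: field_simps)
        also have "\<dots> \<le> (1 / \<eta>) * k * ?p" using \<open>\<eta> > 0\<close> k by (intro mult_left_mono) auto
        finally have 1: "1 \<le> (1 / \<eta>) * k * ?p" .
        have "\<bar>F x - G (cusp_V l h x)\<bar> \<le> a * ?e * 1" using False GV[OF V] by (simp add: F_def)
        also have "\<dots> \<le> a * ?e * ((1 / \<eta>) * k * ?p)" by (rule mult_left_mono[OF 1]) (use a0 in simp)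
        also have "\<dots> = (a * (1 / \<eta>)) * k * quartic_majorant x" by (simp add: quartic_majorant_def)
        also have "\<dots> \<le> A * k * quartic_majorant x"
          unfolding A_def using a0 k assms
          by (intro mult_right_mono mult_left_mono) (auto simp: quartic_majorant_def)
        finally show ?thesis .
      qed
    qed
    have cF: "continuous_on S (\<lambda>x. W x * G (P x))"
      by (intro continuous_on_mult S continuous_on_compose2[OF Gc S(2)]) auto
    have F_meas: "F \<in> borel_measurable lborel"
      using borel_measurable_continuous_on_indicator[OF _ cF] S(1) unfolding F_def by simp
    have V_meas: "(\<lambda>x. G (cusp_V l h x)) \<in> borel_measurable lborel" using iG by simp
    have iM: "integrable lborel (\<lambda>x. A * k * quartic_majorant x)"
      using integrable_quartic_majorant by simp
    have iD: "integrable lborel (\<lambda>x. F x - G (cusp_V l h x))"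
      by (rule Bochner_Integration.integrable_bound[OF iM])
        (use pt F_meas V_meas in \<open>auto intro: order_trans[OF _ abs_ge_self]\<close>)
    have "integrable lborel (\<lambda>x. (F x - G (cusp_V l h x)) + G (cusp_V l h x))"
      by (rule Bochner_Integration.integrable_add[OF iD iG])
    then have iF: "integrable lborel F" by simp
    have "\<bar>(LINT x|lborel. F x) - (LINT x|lborel. G (cusp_V l h x))\<bar> = \<bar>LINT x|lborel. F x - G (cusp_V l h x)\<bar>"
      using iF iG by simp
    also have "\<dots> \<le> (LINT x|lborel. \<bar>F x - G (cusp_V l h x)\<bar>)" by (rule integral_abs_bound)
    also have "\<dots> \<le> (LINT x|lborel. A * k * quartic_majorant x)"
      by (rule integral_mono) (use iD iM pt in auto)
    also have "\<dots> = A * (LINT x|lborel. quartic_majorant x) * k" by simp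
    finally show ?thesis using iF by (simp add: F_def[abs_def] set_integrable_def set_lebesgue_integral_def)
  qed
  show ?thesis
  proof (rule that[OF _ main])
    show "A * (LINT x|lborel. quartic_majorant x) \<ge> 0"
      using A0 by (intro mult_nonneg_nonneg integral_nonneg_AE) (auto simp: quartic_majorant_def)
  qed assumption+
qed

text \<open>The substitution itself is carried out for absolute integrability with respect to the
  completed measure. Continuity of \<open>f\<close> on the open set \<open>T\<close> gives the Borel
  measurability needed to return to \<open>lborel\<close>.\<close>

lemma lborel_change_of_variables:
  fixes \<phi> \<phi>' f :: "real \<Rightarrow> real"
  assumes S: "open S" and d: "\<And>x. x \<in> S \<Longrightarrow> (\<phi> has_real_derivative \<phi>' x) (at x)"
    and inj: "inj_on \<phi> S" and im: "\<phi> ` S = T" and T: "open T" and f: "continuous_on T f"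
    and int: "set_integrable lborel S (\<lambda>x. \<bar>\<phi>' x\<bar> * f (\<phi> x))"
  shows "set_integrable lborel T f" "(LINT z:T|lborel. f z) = (LINT x:S|lborel. \<bar>\<phi>' x\<bar> * f (\<phi> x))"
proof -
  have abs: "(\<lambda>x. \<bar>\<phi>' x\<bar> * f (\<phi> x)) absolutely_integrable_on S"
    using int unfolding set_integrable_def by (subst integrable_completion) auto
  have "f absolutely_integrable_on T \<and> integral T f = integral S (\<lambda>x. \<bar>\<phi>' x\<bar> * f (\<phi> x))"
    using has_absolute_integral_change_of_variables_1'[of S \<phi> \<phi>' f "integral S (\<lambda>x. \<bar>\<phi>' x\<bar> * f (\<phi> x))"]
      S d inj abs im by (auto intro: has_field_derivative_at_within)
  then have *: "f absolutely_integrable_on T" "integral T f = integral S (\<lambda>x. \<bar>\<phi>' x\<bar> * f (\<phi> x))" by auto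
  have "(\<lambda>x. indicat_real T x *\<^sub>R f x) \<in> borel_measurable lborel"
    using borel_measurable_continuous_on_indicator[OF _ f] T by simp
  then show 1: "set_integrable lborel T f"
    using *(1) unfolding set_integrable_def by (subst (asm) integrable_completion) auto
  show "(LINT z:T|lborel. f z) = (LINT x:S|lborel. \<bar>\<phi>' x\<bar> * f (\<phi> x))"
    using set_borel_integral_eq_integral(2)[OF 1] set_borel_integral_eq_integral(2)[OF int] *(2) by simp
qed

section \<open>The saddle region\<close>

lemma dist_triple_le: "dist (y, t, q) (y0, t0, q0) \<le> \<bar>y - y0\<bar> + control_size t0 q0 t q"
  using norm_Pair_le[of "y - y0" "(t - t0, q - q0)"] by (simp add: dist_norm control_size_def)

lemma eventually_nhds_controls:
  "(\<forall>\<^sub>F (t, q) in nhds (t0, q0). P t q) \<longleftrightarrow> (\<exists>e>0. \<forall>t q. control_size t0 q0 t q < e \<longrightarrow> P t q)"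
  by (simp add: eventually_nhds_metric dist_norm control_size_def case_prod_unfold)

text \<open>The radius is halved so that the local coordinate and the controls can be displaced
  independently inside one ball. The two bounds separate motion at fixed controls from total
  deviation from the critical point.\<close>

lemma smooth_near_lipschitz3:
  fixes f :: "real \<Rightarrow> real \<Rightarrow> real \<Rightarrow> real"
  assumes "smooth_near (\<lambda>(y, t, q). f y t q) (y0, t0, q0)"
  obtains e L where "e > 0" "L \<ge> 0"
    "\<And>y y' t q. \<bar>y - y0\<bar> < e \<Longrightarrow> \<bar>y' - y0\<bar> < e \<Longrightarrow> control_size t0 q0 t q < e \<Longrightarrow>
       \<bar>f y t q - f y' t q\<bar> \<le> L * \<bar>y - y'\<bar>"
    "\<And>y t q. \<bar>y - y0\<bar> < e \<Longrightarrow> control_size t0 q0 t q < e \<Longrightarrow>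
       \<bar>f y t q - f y0 t0 q0\<bar> \<le> L * (\<bar>y - y0\<bar> + control_size t0 q0 t q)"
proof -
  obtain r L where r: "r > 0" "L \<ge> 0" and lip: "\<And>p p'. p \<in> ball (y0, t0, q0) r \<Longrightarrow> p' \<in> ball (y0, t0, q0) r \<Longrightarrow>
      \<bar>(\<lambda>(y, t, q). f y t q) p - (\<lambda>(y, t, q). f y t q) p'\<bar> \<le> L * norm (p - p')"
    using smooth_near_lipschitz[OF assms] by blast
  have ball: "(y, t, q) \<in> ball (y0, t0, q0) r" if "\<bar>y - y0\<bar> < r / 2" "control_size t0 q0 t q < r / 2" for y t q
    using dist_triple_le[of y t q y0 t0 q0] that by (simp add: dist_commute)
  show ?thesis
  proof (rule that[of "r / 2" L])
    fix y y' t q assume *: "\<bar>y - y0\<bar> < r / 2" "\<bar>y' - y0\<bar> < r / 2" "control_size t0 q0 t q < r / 2"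
    show "\<bar>f y t q - f y' t q\<bar> \<le> L * \<bar>y - y'\<bar>"
      using lip[OF ball[OF *(1,3)] ball[OF *(2,3)]] by (simp add: norm_Pair)
  next
    fix y t q assume *: "\<bar>y - y0\<bar> < r / 2" "control_size t0 q0 t q < r / 2"
    have "\<bar>f y t q - f y0 t0 q0\<bar> \<le> L * dist (y, t, q) (y0, t0, q0)"
      using lip[OF ball[OF *], of "(y0, t0, q0)"] r(1) by (simp add: dist_norm)
    also have "\<dots> \<le> L * (\<bar>y - y0\<bar> + control_size t0 q0 t q)"
      by (intro mult_left_mono dist_triple_le r)
    finally show "\<bar>f y t q - f y0 t0 q0\<bar> \<le> L * (\<bar>y - y0\<bar> + control_size t0 q0 t q)" .
  qed (use r in auto)
qed

lemma lipschitz_continuous_on: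
  fixes f :: "real \<Rightarrow> real"
  assumes "\<And>x y. x \<in> S \<Longrightarrow> y \<in> S \<Longrightarrow> \<bar>f x - f y\<bar> \<le> L * \<bar>x - y\<bar>" "L \<ge> 0"
  shows "continuous_on S f"
  by (rule lipschitz_on_continuous_on[of L], rule lipschitz_onI) (use assms in \<open>auto simp: dist_real_def\<close>)

locale cusp_saddle =
  fixes M :: cusp_model and \<rho> :: "real \<Rightarrow> real \<Rightarrow> real \<Rightarrow> real \<Rightarrow> real"
  assumes loc: "cusp_local M" and dens: "density_near_saddle M \<rho>"
begin

abbreviation "\<Delta> \<equiv> control_size (taucrit M) (qcrit M)"

abbreviation slope :: "real \<Rightarrow> real \<Rightarrow> real \<Rightarrow> real" where
  "slope y t q \<equiv> deriv (\<lambda>y. chart M y t q) y"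

lemma chart_crit: "chart M 0 (taucrit M) (qcrit M) = zcrit M"
  using loc by (simp add: cusp_local_def)

lemma Delta_nonneg [simp]: "\<Delta> t q \<ge> 0"
  by (simp add: control_size_def)

lemma Delta_crit [simp]: "\<Delta> (taucrit M) (qcrit M) = 0"
  by (simp add: control_size_def)

text \<open>The slope is a smooth function of all three variables and nonzero at the critical point,
  so nearby it keeps its sign \<open>\<sigma>\<close> and at least half of its size. The chart may
  reverse orientation, hence the explicit sign.\<close>

lemma chart_slope:
  obtains e m L \<sigma> where "e > 0" "m > 0" "L \<ge> 0" "\<bar>\<sigma>\<bar> = (1::real)"
    "\<And>y t q. \<bar>y\<bar> < e \<Longrightarrow> \<Delta> t q < e \<Longrightarrow> ((\<lambda>y. chart M y t q) has_real_derivative slope y t q) (at y)"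
    "\<And>y t q. \<bar>y\<bar> < e \<Longrightarrow> \<Delta> t q < e \<Longrightarrow> m \<le> \<sigma> * slope y t q \<and> \<bar>slope y t q\<bar> \<le> L"
    "\<And>y y' t q. \<bar>y\<bar> < e \<Longrightarrow> \<bar>y'\<bar> < e \<Longrightarrow> \<Delta> t q < e \<Longrightarrow> \<bar>slope y t q - slope y' t q\<bar> \<le> L * \<bar>y - y'\<bar>"
proof -
  let ?F = "\<lambda>(y, t, q). chart M y t q" and ?x0 = "(0, taucrit M, qcrit M)"
  define s where "s y t q = frechet_derivative ?F (at (y, t, q)) (1, 0, 0)" for y t q
  have F: "smooth_near ?F ?x0" using loc by (simp add: cusp_local_def)
  have "(1, 0, 0) \<in> (Basis :: (real \<times> real \<times> real) set)" by (simp add: Basis_prod_def zero_prod_def)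
  then have s: "smooth_near (\<lambda>(y, t, q). s y t q) ?x0"
    using smooth_near_frechet[OF F] by (simp add: s_def case_prod_unfold)
  obtain e1 L1 where e1: "e1 > 0" "L1 \<ge> 0"
    "\<And>y y' t q. \<bar>y - 0\<bar> < e1 \<Longrightarrow> \<bar>y' - 0\<bar> < e1 \<Longrightarrow> \<Delta> t q < e1 \<Longrightarrow> \<bar>s y t q - s y' t q\<bar> \<le> L1 * \<bar>y - y'\<bar>"
    "\<And>y t q. \<bar>y - 0\<bar> < e1 \<Longrightarrow> \<Delta> t q < e1 \<Longrightarrow>
       \<bar>s y t q - s 0 (taucrit M) (qcrit M)\<bar> \<le> L1 * (\<bar>y - 0\<bar> + \<Delta> t q)"
    using smooth_near_lipschitz3[OF s] by blast
  obtain e2 where e2: "e2 > 0" "\<And>p. dist p ?x0 < e2 \<Longrightarrow> (?F has_derivative frechet_derivative ?F (at p)) (at p)"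
    using smooth_near_eventually_differentiable[OF F] unfolding eventually_nhds_metric by blast
  have der: "((\<lambda>y. chart M y t q) has_real_derivative s y t q) (at y)"
    if "\<bar>y\<bar> < e2 / 2" "\<Delta> t q < e2 / 2" for y t q
  proof -
    let ?D = "frechet_derivative ?F (at (y, t, q))"
    have "dist (y, t, q) ?x0 < e2" using dist_triple_le[of y t q 0 "taucrit M" "qcrit M"] that by simp
    then have D: "(?F has_derivative ?D) (at (y, t, q))" by (rule e2(2))
    have lin: "linear ?D" using D has_derivative_linear by blast
    have "(?F \<circ> (\<lambda>y. (y, t, q)) has_derivative ?D \<circ> (\<lambda>h. (h, 0, 0))) (at y)"
      by (rule diff_chain_at) (use D in \<open>auto intro!: derivative_eq_intros simp: zero_prod_def\<close>)
    moreover have "?D \<circ> (\<lambda>h. (h, 0, 0)) = (\<lambda>h. s y t q * h)"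
    proof
      fix h :: real
      have "(h, 0, 0) = h *\<^sub>R (1 :: real, 0 :: real, 0 :: real)" by simp
      then show "(?D \<circ> (\<lambda>h. (h, 0, 0))) h = s y t q * h"
        unfolding s_def o_def using linear_scale[OF lin, of h "(1, 0, 0)"] by (simp only: real_scaleR_def mult.commute)
    qed
    ultimately show ?thesis by (simp add: o_def has_field_derivative_def)
  qed
  define d where "d = s 0 (taucrit M) (qcrit M)"
  have slope_s: "slope y t q = s y t q" if "\<bar>y\<bar> < e2 / 2" "\<Delta> t q < e2 / 2" for y t q
    using DERIV_imp_deriv[OF der[OF that]] .
  have "slope 0 (taucrit M) (qcrit M) \<noteq> 0" using loc by (simp add: cusp_local_def)
  then have d0: "d \<noteq> 0" using slope_s[of 0 "taucrit M" "qcrit M"] e2(1) by (simp add: d_def)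
  \<comment> \<open>The last radius keeps the Lipschitz variation of the slope, at most L1 * 2 e,
    below half of the critical value |d|.\<close>
  define e where "e = min (min e1 (e2 / 2)) (\<bar>d\<bar> / (4 * (L1 + 1)))"
  have "\<bar>d\<bar> / (4 * (L1 + 1)) > 0" using e1(2) d0 by simp
  then have e: "e > 0" "e \<le> e1" "e \<le> e2 / 2" "e \<le> \<bar>d\<bar> / (4 * (L1 + 1))"
    using e1(1) e2(1) unfolding e_def by linarith+
  show ?thesis
  proof (rule that[of e "\<bar>d\<bar> / 2" "L1 + 2 * \<bar>d\<bar>" "sgn d"])
    fix y t q assume y: "\<bar>y\<bar> < e" "\<Delta> t q < e"
    then show "((\<lambda>y. chart M y t q) has_real_derivative slope y t q) (at y)"
      using der[of y t q] slope_s[of y t q] e by simp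
    have "\<bar>s y t q - d\<bar> \<le> L1 * (\<bar>y\<bar> + \<Delta> t q)" using e1(4)[of y t q] y e unfolding d_def by simp
    also have "\<dots> \<le> (L1 + 1) * (2 * e)" using y e1(2) by (intro mult_mono) auto
    also have "\<dots> \<le> \<bar>d\<bar> / 2" using e(4) e1(2) by (simp add: field_simps)
    finally show "\<bar>d\<bar> / 2 \<le> sgn d * slope y t q \<and> \<bar>slope y t q\<bar> \<le> L1 + 2 * \<bar>d\<bar>"
      using slope_s[of y t q] y e e1(2) d0 by (auto simp: sgn_if abs_if split: if_splits)
    fix y' assume y': "\<bar>y'\<bar> < e"
    have "\<bar>s y t q - s y' t q\<bar> \<le> L1 * \<bar>y - y'\<bar>" using e1(3)[of y y' t q] y y' e by simp
    also have "\<dots> \<le> (L1 + 2 * \<bar>d\<bar>) * \<bar>y - y'\<bar>" by (intro mult_right_mono) auto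
    finally show "\<bar>slope y t q - slope y' t q\<bar> \<le> (L1 + 2 * \<bar>d\<bar>) * \<bar>y - y'\<bar>"
      using slope_s[of y t q] slope_s[of y' t q] y y' e by simp
  qed (use e d0 e1 in \<open>auto simp: abs_sgn_eq\<close>)
qed

text \<open>Multiplication by the sign \<open>\<sigma>\<close> makes the chart increasing with slope
  at least \<open>m\<close>, so one argument covers both orientations.\<close>

lemma chart_mvt:
  assumes "\<And>y. \<bar>y\<bar> < e \<Longrightarrow> ((\<lambda>y. chart M y t q) has_real_derivative slope y t q) (at y)"
    and "\<And>y. \<bar>y\<bar> < e \<Longrightarrow> m \<le> \<sigma> * slope y t q \<and> \<bar>slope y t q\<bar> \<le> L"
    and "y < y'" "\<bar>y\<bar> < e" "\<bar>y'\<bar> < e" "\<bar>\<sigma>\<bar> = 1"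
  shows "m * (y' - y) \<le> \<sigma> * (chart M y' t q - chart M y t q)"
    "\<bar>chart M y' t q - chart M y t q\<bar> \<le> L * (y' - y)"
proof -
  have in_e: "\<bar>x\<bar> < e" if "y \<le> x" "x \<le> y'" for x using that assms(3-5) by linarith
  obtain z where z: "y < z" "z < y'" "chart M y' t q - chart M y t q = (y' - y) * slope z t q"
    using MVT2[OF assms(3), of "\<lambda>y. chart M y t q" "\<lambda>y. slope y t q"] assms(1) in_e by blast
  have sl: "m \<le> \<sigma> * slope z t q" "\<bar>slope z t q\<bar> \<le> L" using assms(2)[OF in_e] z by auto
  have "m * (y' - y) \<le> (\<sigma> * slope z t q) * (y' - y)" using sl z by (intro mult_right_mono) auto
  then show "m * (y' - y) \<le> \<sigma> * (chart M y' t q - chart M y t q)" by (simp add: z(3) mult.commute mult.left_commute)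
  have "\<bar>chart M y' t q - chart M y t q\<bar> = (y' - y) * \<bar>slope z t q\<bar>" using z assms(3) by (simp add: abs_mult)
  also have "\<dots> \<le> (y' - y) * L" using sl assms(3) by (intro mult_left_mono) auto
  finally show "\<bar>chart M y' t q - chart M y t q\<bar> \<le> L * (y' - y)" by (simp add: mult.commute)
qed

text \<open>Nonvanishing becomes positivity at the saddle, because the density is nonnegative for
  \<open>g > 0\<close> and the extension is continuous down to \<open>g = 0\<close>. The bounds on
  \<open>R\<close> include the endpoint \<open>g = 0\<close>, where the limit defining
  \<open>mu0\<close> is taken.\<close>

lemma density_extension:
  obtains e m L R where "e > 0" "m > 0" "L \<ge> 0"
    "\<And>z t q g. \<bar>z - zcrit M\<bar> < e \<Longrightarrow> \<Delta> t q < e \<Longrightarrow> 0 < g \<Longrightarrow> g < e \<Longrightarrow> \<rho> z t q g = R z t q g"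
    "\<And>z t q g. \<bar>z - zcrit M\<bar> < e \<Longrightarrow> \<Delta> t q < e \<Longrightarrow> 0 \<le> g \<Longrightarrow> g < e \<Longrightarrow> m \<le> R z t q g \<and> R z t q g \<le> L"
    "\<And>z z' t q g g'. \<bar>z - zcrit M\<bar> < e \<Longrightarrow> \<bar>z' - zcrit M\<bar> < e \<Longrightarrow> \<Delta> t q < e \<Longrightarrow>
       0 \<le> g \<Longrightarrow> g < e \<Longrightarrow> 0 \<le> g' \<Longrightarrow> g' < e \<Longrightarrow> \<bar>R z t q g - R z' t q g'\<bar> \<le> L * (\<bar>z - z'\<bar> + \<bar>g - g'\<bar>)"
proof -
  let ?x0 = "(zcrit M, taucrit M, qcrit M, 0::real)"
  from dens obtain \<rho>' where \<rho>': "smooth_near \<rho>' ?x0" "\<rho>' ?x0 \<noteq> 0"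
      "\<forall>\<^sub>F (z, \<tau>, q, g) in nhds ?x0. g > 0 \<longrightarrow> \<rho> z \<tau> q g = \<rho>' (z, \<tau>, q, g)"
    and nn: "\<And>z \<tau> q g. z \<in> branch M \<tau> q \<Longrightarrow> g > 0 \<Longrightarrow> \<rho> z \<tau> q g \<ge> 0"
    unfolding density_near_saddle_def by blast
  from \<rho>'(3) obtain d1 where d1: "d1 > 0" "\<And>z t q g. dist (z, t, q, g) ?x0 < d1 \<Longrightarrow> g > 0 \<Longrightarrow> \<rho> z t q g = \<rho>' (z, t, q, g)"
    unfolding eventually_nhds_metric by fastforce
  obtain d2 L where d2: "d2 > 0" "L \<ge> 0" "\<And>p p'. p \<in> ball ?x0 d2 \<Longrightarrow> p' \<in> ball ?x0 d2 \<Longrightarrow> \<bar>\<rho>' p - \<rho>' p'\<bar> \<le> L * norm (p - p')"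
    using smooth_near_lipschitz[OF \<rho>'(1)] by blast
  from loc obtain r where r: "r > 0" "\<forall>\<^sub>F (t, q) in nhds (crit M). ball (zcrit M) r \<subseteq> branch M t q"
    unfolding cusp_local_def by blast
  have "zcrit M \<in> branch M (taucrit M) (qcrit M)"
    using eventually_nhds_x_imp_x[OF r(2)] r(1) by auto
  note nn = nn[OF this]
  have dist4: "dist (z, t, q, g) ?x0 \<le> \<bar>z - zcrit M\<bar> + \<Delta> t q + \<bar>g\<bar>" for z t q g
  proof -
    have "norm (t - taucrit M, q - qcrit M, g) \<le> norm (t - taucrit M, q - qcrit M, 0::real) + norm (0::real, 0::real, g)"
      using norm_triangle_ineq[of "(t - taucrit M, q - qcrit M, 0::real)" "(0::real, 0::real, g)"] by simp
    then show ?thesis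
      using norm_Pair_le[of "z - zcrit M" "(t - taucrit M, q - qcrit M, g)"]
      by (simp add: dist_norm control_size_def norm_Pair)
  qed
  define c where "c = \<rho>' ?x0"
  have c0: "c > 0"
  proof -
    have "(\<rho>' \<longlongrightarrow> c) (nhds ?x0)" unfolding c_def by (rule smooth_near_continuous[OF \<rho>'(1)])
    moreover have "((\<lambda>g. (zcrit M, taucrit M, qcrit M, g)) \<longlongrightarrow> ?x0) (at_right 0)" by (intro tendsto_intros)
    ultimately have "((\<lambda>g. \<rho>' (zcrit M, taucrit M, qcrit M, g)) \<longlongrightarrow> c) (at_right 0)"
      by (rule filterlim_compose)
    moreover have "\<forall>\<^sub>F g in at_right 0. \<rho>' (zcrit M, taucrit M, qcrit M, g) \<ge> 0"
    proof -
      have "\<forall>\<^sub>F g in at_right 0. g \<in> {0<..<d1}" by (rule eventually_at_right_real[OF d1(1)])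
      then show ?thesis
      proof eventually_elim
        case (elim g)
        then have "\<rho> (zcrit M) (taucrit M) (qcrit M) g = \<rho>' (zcrit M, taucrit M, qcrit M, g)"
          using dist4[of "zcrit M" "taucrit M" "qcrit M" g] by (intro d1(2)) auto
        then show ?case using nn[of g] elim by simp
      qed
    qed
    ultimately have "c \<ge> 0" by (intro tendsto_lowerbound[of _ c "at_right (0::real)" 0]) auto
    then show ?thesis using \<rho>'(2) by (simp add: c_def)
  qed
  \<comment> \<open>Three displacements of size below \<open>e\<close>, in z, in the controls and in
    g, together move the extension by at most c / 2.\<close>
  define e where "e = min (min (d1 / 3) (d2 / 3)) (c / (6 * (L + 1)))"
  have "c / (6 * (L + 1)) > 0" using d2(2) c0 by simp
  then have e: "e > 0" "e \<le> d1 / 3" "e \<le> d2 / 3" "e \<le> c / (6 * (L + 1))"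
    using d1(1) d2(1) unfolding e_def by linarith+
  have ball: "(z, t, q, g) \<in> ball ?x0 d2" if "\<bar>z - zcrit M\<bar> < e" "\<Delta> t q < e" "0 \<le> g" "g < e" for z t q g
    using dist4[of z t q g] that e by (simp add: dist_commute)
  show ?thesis
  proof (rule that[of e "c / 2" "L + 2 * c" "\<lambda>z t q g. \<rho>' (z, t, q, g)"])
    fix z t q g assume *: "\<bar>z - zcrit M\<bar> < e" "\<Delta> t q < e" "0 < g" "g < e"
    show "\<rho> z t q g = \<rho>' (z, t, q, g)"
      using dist4[of z t q g] * e by (intro d1(2)) auto
  next
    fix z t q g assume *: "\<bar>z - zcrit M\<bar> < e" "\<Delta> t q < e" "0 \<le> g" "g < e"
    have "\<bar>\<rho>' (z, t, q, g) - c\<bar> \<le> L * dist (z, t, q, g) ?x0"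
      using d2(3)[OF ball[OF *], of ?x0] d2(1) by (simp add: c_def dist_norm)
    also have "\<dots> \<le> (L + 1) * (3 * e)"
      using d2(2) dist4[of z t q g] * by (intro mult_mono) auto
    also have "\<dots> \<le> c / 2" using e(4) d2(2) by (simp add: field_simps)
    finally show "c / 2 \<le> \<rho>' (z, t, q, g) \<and> \<rho>' (z, t, q, g) \<le> L + 2 * c" using d2(2) c0 by linarith
  next
    fix z z' t q g g' assume *: "\<bar>z - zcrit M\<bar> < e" "\<bar>z' - zcrit M\<bar> < e" "\<Delta> t q < e" "0 \<le> g" "g < e" "0 \<le> g'" "g' < e"
    have "\<bar>\<rho>' (z, t, q, g) - \<rho>' (z', t, q, g')\<bar> \<le> L * norm (z - z', 0::real, 0::real, g - g')"
      using d2(3)[OF ball[OF *(1,3,4,5)] ball[OF *(2,3,6,7)]] by simp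
    also have "norm (z - z', 0::real, 0::real, g - g') \<le> \<bar>z - z'\<bar> + \<bar>g - g'\<bar>"
      using norm_Pair_le[of "z - z'" "(0::real, 0::real, g - g')"] by (simp add: norm_Pair)
    also have "L * (\<bar>z - z'\<bar> + \<bar>g - g'\<bar>) \<le> (L + 2 * c) * (\<bar>z - z'\<bar> + \<bar>g - g'\<bar>)"
      using c0 by (intro mult_right_mono) auto
    finally show "\<bar>\<rho>' (z, t, q, g) - \<rho>' (z', t, q, g')\<bar> \<le> (L + 2 * c) * (\<bar>z - z'\<bar> + \<bar>g - g'\<bar>)"
      using d2(2) by (simp add: mult_left_mono)
  qed (use e c0 d2 in auto)
qed

section \<open>The length unit, the scaling curve and the scaled normal form\<close>

lemma coef_pos: "coef1 M > 0" "coef2 M > 0" "coef4 M > 0"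
  using loc by (auto simp: cusp_local_def)

definition kscale :: "real \<Rightarrow> real" where
  "kscale g = (g / coef4 M) powr (1/4)"

lemma kscale_pos: "g > 0 \<Longrightarrow> kscale g > 0"
  using coef_pos by (simp add: kscale_def)

lemma kscale_power4: "g > 0 \<Longrightarrow> g = coef4 M * kscale g ^ 4"
  using coef_pos by (simp add: kscale_def powr_realpow[symmetric] powr_powr)

lemma kscale_eq: "g > 0 \<Longrightarrow> kscale g = g powr (1/4) / coef4 M powr (1/4)"
  using coef_pos by (simp add: kscale_def powr_divide)

lemma kscale_tendsto: "(kscale \<longlongrightarrow> 0) (at_right 0)"
proof -
  have "((\<lambda>g. (g / coef4 M) powr (1/4)) \<longlongrightarrow> (0 / coef4 M) powr (1/4)) (at_right 0)"
    using coef_pos by (intro tendsto_powr2 tendsto_intros) (auto simp: eventually_at_right_less intro!: eventually_mono[OF eventually_at_right_less])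
  then show ?thesis by (simp add: kscale_def[abs_def])
qed

lemma eventually_kscale_less:
  assumes "c > 0" shows "\<forall>\<^sub>F g in at_right 0. 0 < g \<and> 0 < kscale g \<and> kscale g < c"
proof -
  have "\<forall>\<^sub>F g in at_right 0. kscale g < c" using order_tendstoD(2)[OF kscale_tendsto assms] .
  moreover have "\<forall>\<^sub>F g in at_right (0::real). 0 < g" by (rule eventually_at_right_less)
  ultimately show ?thesis by eventually_elim (simp add: kscale_pos)
qed

text \<open>In terms of k = \<open>kscale g\<close> the fractional powers disappear: the denominator
  of \<open>scal_lambda\<close> is c4 k^2 and that of \<open>scal_h\<close> is c4 k^3.\<close>

lemma scaling_variables:
  assumes "g > 0" "scal_lambda M t q g = l" "scal_h M t q g = h"
  shows "coef2 M * ufield M t q = l * coef4 M * kscale g ^ 2"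
    "coef1 M * wfield M t q = h * coef4 M * kscale g ^ 3"
proof -
  have k: "kscale g > 0" "g = coef4 M * kscale g ^ 4" using kscale_pos kscale_power4 assms(1) by auto
  have "coef4 M * g = (coef4 M * kscale g ^ 2)\<^sup>2"
    by (subst k(2)) (simp add: power2_eq_square power4_eq_xxxx)
  then have "sqrt (coef4 M * g) = coef4 M * kscale g ^ 2" using coef_pos by simp
  then show "coef2 M * ufield M t q = l * coef4 M * kscale g ^ 2"
    using assms(2) k(1) coef_pos by (auto simp: scal_lambda_def)
  have "(kscale g ^ 4) powr (3/4) = kscale g ^ 3"
    using k(1) by (simp add: powr_powr flip: powr_numeral)
  then have "g powr (3/4) = coef4 M powr (3/4) * kscale g ^ 3"
    using arg_cong[OF k(2), of "\<lambda>g. g powr (3/4)"] k(1) coef_pos by (simp add: powr_mult)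
  moreover have "coef4 M powr (1/4) * coef4 M powr (3/4) = coef4 M" using coef_pos by (simp flip: powr_add)
  ultimately have "coef4 M powr (1/4) * g powr (3/4) = coef4 M * kscale g ^ 3"
    by (metis mult.assoc)
  then show "coef1 M * wfield M t q = h * coef4 M * kscale g ^ 3"
    using assms(3) k(1) coef_pos by (auto simp: scal_h_def)
qed

text \<open>The fields are multiples of k^2 and k^3, so for k < 1 both are at most multiples of k^2;
  the Jacobian estimate at their common zero transfers this order to the controls.\<close>

lemma scaling_curve_controls:
  assumes "scaling_curve M l h T Q"
  obtains C where "C \<ge> 0"
    "\<forall>\<^sub>F g in at_right 0. \<Delta> (T g) (Q g) \<le> C * kscale g ^ 2 \<and>
      coef2 M * ufield M (T g) (Q g) = l * coef4 M * kscale g ^ 2 \<and>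
      coef1 M * wfield M (T g) (Q g) = h * coef4 M * kscale g ^ 3"
proof -
  have lim: "((\<lambda>g. (T g, Q g)) \<longlongrightarrow> crit M) (at_right 0)"
    and vars: "\<forall>\<^sub>F g in at_right 0. scal_lambda M (T g) (Q g) g = l \<and> scal_h M (T g) (Q g) g = h"
    using assms by (auto simp: scaling_curve_def)
  have zero: "ufield M (taucrit M) (qcrit M) = 0" "wfield M (taucrit M) (qcrit M) = 0"
    and sm: "smooth_near (\<lambda>(t, q). ufield M t q) (crit M)" "smooth_near (\<lambda>(t, q). wfield M t q) (crit M)"
    and jac: "jacobian2 (ufield M) (wfield M) (taucrit M) (qcrit M) \<noteq> 0"
    using loc by (auto simp: cusp_local_def)
  obtain C where C: "C > 0"
    "\<forall>\<^sub>F (t, q) in nhds (crit M). norm (t - taucrit M, q - qcrit M) \<le> C * (\<bar>ufield M t q\<bar> + \<bar>wfield M t q\<bar>)"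
    using jacobian2_controls_distance[OF sm jac] unfolding zero diff_zero by blast
  define D where "D = C * (\<bar>l\<bar> * coef4 M / coef2 M + \<bar>h\<bar> * coef4 M / coef1 M)"
  show ?thesis
  proof (rule that[of D])
    show "D \<ge> 0" using C coef_pos by (simp add: D_def)
    have "\<forall>\<^sub>F g in at_right 0. \<Delta> (T g) (Q g) \<le> C * (\<bar>ufield M (T g) (Q g)\<bar> + \<bar>wfield M (T g) (Q g)\<bar>)"
      using eventually_compose_filterlim[OF C(2) lim] by (simp add: control_size_def)
    with vars eventually_kscale_less[of 1, simplified]
    show "\<forall>\<^sub>F g in at_right 0. \<Delta> (T g) (Q g) \<le> D * kscale g ^ 2 \<and>
      coef2 M * ufield M (T g) (Q g) = l * coef4 M * kscale g ^ 2 \<and>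
      coef1 M * wfield M (T g) (Q g) = h * coef4 M * kscale g ^ 3"
    proof eventually_elim
      case (elim g)
      let ?k = "kscale g"
      have u: "coef2 M * ufield M (T g) (Q g) = l * coef4 M * ?k ^ 2"
        and w: "coef1 M * wfield M (T g) (Q g) = h * coef4 M * ?k ^ 3"
        using scaling_variables[of g "T g" "Q g" l h] elim by auto
      have "ufield M (T g) (Q g) = l * coef4 M / coef2 M * ?k ^ 2" using u coef_pos by (simp add: field_simps)
      then have u': "\<bar>ufield M (T g) (Q g)\<bar> = \<bar>l\<bar> * coef4 M / coef2 M * ?k ^ 2" using coef_pos by (simp add: abs_mult)
      have "wfield M (T g) (Q g) = h * coef4 M / coef1 M * ?k ^ 3" using w coef_pos by (simp add: field_simps)
      then have "\<bar>wfield M (T g) (Q g)\<bar> = \<bar>h\<bar> * coef4 M / coef1 M * ?k ^ 3"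
        using coef_pos elim by (simp add: abs_mult)
      also have "\<dots> \<le> \<bar>h\<bar> * coef4 M / coef1 M * ?k ^ 2"
        using coef_pos elim by (intro mult_left_mono power_decreasing) auto
      finally have "\<bar>ufield M (T g) (Q g)\<bar> + \<bar>wfield M (T g) (Q g)\<bar>
          \<le> (\<bar>l\<bar> * coef4 M / coef2 M + \<bar>h\<bar> * coef4 M / coef1 M) * ?k ^ 2"
        unfolding u' distrib_right by simp
      then have "C * (\<bar>ufield M (T g) (Q g)\<bar> + \<bar>wfield M (T g) (Q g)\<bar>)
          \<le> C * ((\<bar>l\<bar> * coef4 M / coef2 M + \<bar>h\<bar> * coef4 M / coef1 M) * ?k ^ 2)"
        using C(1) by (intro mult_left_mono) auto
      then have "\<Delta> (T g) (Q g) \<le> D * ?k ^ 2" unfolding D_def mult.assoc using elim by linarith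
      then show ?case using u w by simp
    qed
  qed
qed

lemma normal_form_bound:
  obtains e L where "e > 0" "L \<ge> 0"
    "\<And>y t q. \<bar>y\<bar> < e \<Longrightarrow> \<Delta> t q < e \<Longrightarrow>
      \<bar>action M (chart M y t q) t q - action0 M t q
        - (coef4 M * y ^ 4 + coef2 M * ufield M t q * y\<^sup>2 - coef1 M * wfield M t q * y)\<bar>
      \<le> L * (\<bar>y\<bar> ^ 5 + \<Delta> t q * \<bar>y\<bar> ^ 3 + (\<Delta> t q)\<^sup>2 * \<bar>y\<bar>)"
proof -
  from loc have "has_normal_form M" by (simp add: cusp_local_def)
  then obtain L where L: "L > 0" and ev: "\<forall>\<^sub>F p in nhds (0, taucrit M, qcrit M).
     norm ((\<lambda>(y, \<tau>, q). action M (chart M y \<tau> q) \<tau> q - action0 M \<tau> q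
        - (coef4 M * y ^ 4 + coef2 M * ufield M \<tau> q * y\<^sup>2 - coef1 M * wfield M \<tau> q * y)) p)
      \<le> L * norm (cusp_order (taucrit M) (qcrit M) p)"
    unfolding has_normal_form_def by (elim landau_o.bigE)
  then obtain d where d: "d > 0" "\<And>p. dist p (0, taucrit M, qcrit M) < d \<Longrightarrow>
     norm ((\<lambda>(y, \<tau>, q). action M (chart M y \<tau> q) \<tau> q - action0 M \<tau> q
        - (coef4 M * y ^ 4 + coef2 M * ufield M \<tau> q * y\<^sup>2 - coef1 M * wfield M \<tau> q * y)) p)
      \<le> L * norm (cusp_order (taucrit M) (qcrit M) p)"
    unfolding eventually_nhds_metric by blast
  show ?thesis
  proof (rule that[of "d / 2" L])
    fix y t q assume "\<bar>y\<bar> < d / 2" "\<Delta> t q < d / 2"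
    then have "dist (y, t, q) (0, taucrit M, qcrit M) < d"
      using dist_triple_le[of y t q 0 "taucrit M" "qcrit M"] by simp
    from d(2)[OF this] show "\<bar>action M (chart M y t q) t q - action0 M t q
        - (coef4 M * y ^ 4 + coef2 M * ufield M t q * y\<^sup>2 - coef1 M * wfield M t q * y)\<bar>
      \<le> L * (\<bar>y\<bar> ^ 5 + \<Delta> t q * \<bar>y\<bar> ^ 3 + (\<Delta> t q)\<^sup>2 * \<bar>y\<bar>)"
      by (simp add: cusp_order_def abs_of_nonneg)
  qed (use d L in auto)
qed

definition scaled_action :: "real \<Rightarrow> real \<Rightarrow> real \<Rightarrow> real \<Rightarrow> real" where
  "scaled_action t q g z = (action M z t q - action0 M t q) / g"

text \<open>In the variable \<open>x = y / kscale g\<close> the normal form is \<open>cusp_V\<close> up to relative corrections of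
  order \<open>kscale g\<close>, and shrinking the \<open>y\<close>-window keeps the quintic term below the quartic one.\<close>

lemma scaled_action_bounds:
  obtains e where "e > 0" "\<And>l h T Q. scaling_curve M l h T Q \<Longrightarrow>
    \<exists>C\<ge>0. \<exists>K. (\<forall>x. cusp_V l h x \<ge> x ^ 4 / 4 - K) \<and> (\<forall>\<^sub>F g in at_right 0. \<forall>x. kscale g * \<bar>x\<bar> < e \<longrightarrow>
      cusp_close l h C K (kscale g) x (scaled_action (T g) (Q g) g (chart M (kscale g * x) (T g) (Q g))))"
proof -
  obtain e1 L where e1: "e1 > 0" and L: "L \<ge> 0" and nf: "\<And>y t q. \<bar>y\<bar> < e1 \<Longrightarrow> \<Delta> t q < e1 \<Longrightarrow>
      \<bar>action M (chart M y t q) t q - action0 M t q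
        - (coef4 M * y ^ 4 + coef2 M * ufield M t q * y\<^sup>2 - coef1 M * wfield M t q * y)\<bar>
      \<le> L * (\<bar>y\<bar> ^ 5 + \<Delta> t q * \<bar>y\<bar> ^ 3 + (\<Delta> t q)\<^sup>2 * \<bar>y\<bar>)"
    using normal_form_bound by blast
  \<comment> \<open>For |y| below this bound the quintic remainder L |y|^5 is at most a quarter of
    \<open>coef4 M * y ^ 4\<close>.\<close>
  define e where "e = min e1 (coef4 M / (4 * (L + 1)))"
  have "coef4 M / (4 * (L + 1)) > 0" using L coef_pos by simp
  then have e: "e > 0" "e \<le> e1" "e \<le> coef4 M / (4 * (L + 1))" using e1 unfolding e_def by linarith+
  show ?thesis
  proof (rule that[OF e(1)])
    fix l h T Q assume curve: "scaling_curve M l h T Q"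
    obtain C where C: "C \<ge> 0" and ev: "\<forall>\<^sub>F g in at_right 0. \<Delta> (T g) (Q g) \<le> C * kscale g ^ 2 \<and>
      coef2 M * ufield M (T g) (Q g) = l * coef4 M * kscale g ^ 2 \<and>
      coef1 M * wfield M (T g) (Q g) = h * coef4 M * kscale g ^ 3"
      using scaling_curve_controls[OF curve] by blast
    define A where "A = L / coef4 M"
    have A: "A \<ge> 0" using L coef_pos by (simp add: A_def)
    \<comment> \<open>After \<Delta> \<le> C k^2 the three remainder terms carry the coefficients 1,
      C and C^2; their sum serves for all of them.\<close>
    define D where "D = A * (1 + C + C\<^sup>2)"
    have D: "D \<ge> 0" using A C by (simp add: D_def)
    obtain K where K: "K \<ge> 0" "\<And>x::real. x ^ 4 / 2 + l * x\<^sup>2 - h * x - D * (\<bar>x\<bar> ^ 3 + \<bar>x\<bar>) \<ge> - K"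
      using cusp_V_coercive[of l h D] by blast
    have pos: "D * (\<bar>x\<bar> ^ 3 + \<bar>x\<bar>) \<ge> 0" for x :: real using D by simp
    have lin: "X + b \<ge> X / 4 - K" "X + b - X / 4 - c \<ge> X / 4 - K" if "X / 2 + b - c \<ge> - K" "X \<ge> 0" "c \<ge> 0" for X b c :: real
      using that by linarith+
    have V: "cusp_V l h x \<ge> x ^ 4 / 4 - K" for x
      using lin(1)[of "x ^ 4" "l * x\<^sup>2 - h * x" "D * (\<bar>x\<bar> ^ 3 + \<bar>x\<bar>)"] K(2)[of x] pos[of x]
      by (simp add: cusp_V_def add_diff_eq)
    have V': "cusp_V l h x - x ^ 4 / 4 - D * (\<bar>x\<bar> ^ 3 + \<bar>x\<bar>) \<ge> x ^ 4 / 4 - K" for x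
      using lin(2)[of "x ^ 4" "l * x\<^sup>2 - h * x" "D * (\<bar>x\<bar> ^ 3 + \<bar>x\<bar>)"] K(2)[of x] pos[of x]
      by (simp add: cusp_V_def add_diff_eq)
    \<comment> \<open>With k < 1 and (C + 1) k < e1 the controls, of size at most C k^2, lie where
      the normal form holds.\<close>
    have "min 1 (e1 / (C + 1)) > 0" using C e1 by simp
    from eventually_kscale_less[OF this] ev
    have "\<forall>\<^sub>F g in at_right 0. \<forall>x. kscale g * \<bar>x\<bar> < e \<longrightarrow>
      cusp_close l h D K (kscale g) x (scaled_action (T g) (Q g) g (chart M (kscale g * x) (T g) (Q g)))"
    proof eventually_elim
      case (elim g)
      define k where "k = kscale g"
      have k: "0 < k" "k < 1" "k < e1 / (C + 1)" and g: "g > 0" "g = coef4 M * k ^ 4"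
        using elim kscale_power4[of g] by (auto simp: k_def)
      define d where "d = \<Delta> (T g) (Q g)"
      have d: "d \<le> C * k\<^sup>2" "d \<ge> 0" using elim by (auto simp: d_def k_def)
      have "d < e1"
      proof -
        have "C * k\<^sup>2 \<le> (C + 1) * k" using k C by (intro mult_mono) (auto simp: power2_eq_square mult_le_one)
        also have "\<dots> < e1" using k(3) C by (simp add: field_simps)
        finally show ?thesis using d by simp
      qed
      show ?case
      proof (intro allI impI)
        fix x assume x: "kscale g * \<bar>x\<bar> < e"
        define P where "P = scaled_action (T g) (Q g) g (chart M (k * x) (T g) (Q g))"
        have V_eq: "coef4 M * (k * x) ^ 4 + coef2 M * ufield M (T g) (Q g) * (k * x)\<^sup>2
            - coef1 M * wfield M (T g) (Q g) * (k * x) = g * cusp_V l h x"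
        proof -
          have u: "coef2 M * ufield M (T g) (Q g) = l * coef4 M * k ^ 2"
            and w: "coef1 M * wfield M (T g) (Q g) = h * coef4 M * k ^ 3" using elim by (auto simp: k_def)
          have "coef4 M * (k * x) ^ 4 + l * coef4 M * k ^ 2 * (k * x)\<^sup>2 - h * coef4 M * k ^ 3 * (k * x)
              = (coef4 M * k ^ 4) * cusp_V l h x" unfolding cusp_V_def by algebra
          then show ?thesis unfolding u w g(2)[symmetric] .
        qed
        have "\<bar>k * x\<bar> < e1" using x e k by (simp add: k_def abs_mult)
        from nf[OF this \<open>d < e1\<close>[unfolded d_def]]
        have "\<bar>g * P - g * cusp_V l h x\<bar> \<le> L * (\<bar>k * x\<bar> ^ 5 + d * \<bar>k * x\<bar> ^ 3 + d\<^sup>2 * \<bar>k * x\<bar>)"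
          unfolding V_eq P_def scaled_action_def d_def using g(1) by simp
        also have "\<dots> \<le> L * (\<bar>k * x\<bar> ^ 5 + (C * k\<^sup>2) * \<bar>k * x\<bar> ^ 3 + (C * k\<^sup>2)\<^sup>2 * \<bar>k * x\<bar>)"
          using d L by (intro mult_left_mono add_mono mult_right_mono power_mono) auto
        also have "\<dots> = g * (A * k * (\<bar>x\<bar> ^ 5 + C * \<bar>x\<bar> ^ 3 + C\<^sup>2 * \<bar>x\<bar>))"
          using coef_pos k unfolding g(2) A_def
          by (simp add: abs_mult power_mult_distrib field_simps power_numeral_reduce)
        finally have "g * \<bar>P - cusp_V l h x\<bar> \<le> g * (A * k * (\<bar>x\<bar> ^ 5 + C * \<bar>x\<bar> ^ 3 + C\<^sup>2 * \<bar>x\<bar>))"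
          using g(1) by (simp add: abs_mult flip: right_diff_distrib)
        then have main: "\<bar>P - cusp_V l h x\<bar> \<le> A * k * (\<bar>x\<bar> ^ 5 + C * \<bar>x\<bar> ^ 3 + C\<^sup>2 * \<bar>x\<bar>)"
          using g(1) by simp
        also have "\<dots> \<le> A * k * ((1 + C + C\<^sup>2) * \<bar>x\<bar> ^ 5 + (1 + C + C\<^sup>2) * \<bar>x\<bar> ^ 3 + (1 + C + C\<^sup>2) * \<bar>x\<bar>)"
        proof (intro mult_left_mono add_mono mult_right_mono)
          have "1 * \<bar>x\<bar> ^ 5 \<le> (1 + C + C\<^sup>2) * \<bar>x\<bar> ^ 5" using C by (intro mult_right_mono) auto
          then show "\<bar>x\<bar> ^ 5 \<le> (1 + C + C\<^sup>2) * \<bar>x\<bar> ^ 5" by simp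
        qed (use A C k in auto)
        also have "\<dots> = D * k * (\<bar>x\<bar> ^ 5 + \<bar>x\<bar> ^ 3 + \<bar>x\<bar>)" by (simp add: D_def algebra_simps)
        finally have 1: "\<bar>P - cusp_V l h x\<bar> \<le> D * k * (\<bar>x\<bar> ^ 5 + \<bar>x\<bar> ^ 3 + \<bar>x\<bar>)" .
        have "A * (k * \<bar>x\<bar>) \<le> 1 / 4"
        proof -
          have "A * (k * \<bar>x\<bar>) \<le> A * e" using x A by (intro mult_left_mono) (auto simp: k_def)
          also have "\<dots> \<le> A * (coef4 M / (4 * (L + 1)))" using e A by (intro mult_left_mono) auto
          also have "\<dots> = L / (4 * (L + 1))" using coef_pos by (simp add: A_def)
          also have "\<dots> \<le> 1 / 4" using L by (simp add: field_simps)
          finally show ?thesis .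
        qed
        \<comment> \<open>Here the smallness of the window enters: the quintic term is k |x| times a
          quartic one, whose coefficient thus stays below 1/4.\<close>
        then have q: "A * (k * \<bar>x\<bar>) * x ^ 4 \<le> 1 / 4 * x ^ 4" by (rule mult_right_mono) simp
        have "A * k * (\<bar>x\<bar> ^ 5 + C * \<bar>x\<bar> ^ 3 + C\<^sup>2 * \<bar>x\<bar>)
            = A * (k * \<bar>x\<bar>) * x ^ 4 + k * (A * (C * \<bar>x\<bar> ^ 3 + C\<^sup>2 * \<bar>x\<bar>))"
          by (simp add: algebra_simps power_numeral_reduce)
        also have "k * (A * (C * \<bar>x\<bar> ^ 3 + C\<^sup>2 * \<bar>x\<bar>)) \<le> 1 * (A * ((1 + C + C\<^sup>2) * \<bar>x\<bar> ^ 3 + (1 + C + C\<^sup>2) * \<bar>x\<bar>))"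
          using k A C by (intro mult_mono add_mono) auto
        also have "\<dots> = D * (\<bar>x\<bar> ^ 3 + \<bar>x\<bar>)" by (simp add: D_def algebra_simps)
        finally have "\<bar>P - cusp_V l h x\<bar> \<le> x ^ 4 / 4 + D * (\<bar>x\<bar> ^ 3 + \<bar>x\<bar>)"
          using main q by linarith
        \<comment> \<open>Of the quartic term one quarter is spent on the quintic remainder and one
          half on coercivity; the last quarter remains.\<close>
        then have "P \<ge> x ^ 4 / 4 - K" using V'[of x] by linarith
        with 1 show "cusp_close l h D K (kscale g) x (scaled_action (T g) (Q g) g (chart M (kscale g * x) (T g) (Q g)))"
          unfolding cusp_close_def P_def k_def by blast
      qed
    qed
    with V D show "\<exists>C\<ge>0. \<exists>K. (\<forall>x. cusp_V l h x \<ge> x ^ 4 / 4 - K) \<and> (\<forall>\<^sub>F g in at_right 0. \<forall>x. kscale g * \<bar>x\<bar> < e \<longrightarrow>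
      cusp_close l h C K (kscale g) x (scaled_action (T g) (Q g) g (chart M (kscale g * x) (T g) (Q g))))"
      by blast
  qed
qed

text \<open>Everything that the change of variables and \<open>scaled_laplace\<close> need at one
  value of g. The set \<open>S\<close> is the preimage of the saddle region in the scaled variable;
  the constants are arguments, so that they can be chosen before g.\<close>

definition saddle_scaling ::
  "real \<Rightarrow> real \<Rightarrow> real \<Rightarrow> real \<Rightarrow> real \<Rightarrow> real \<Rightarrow> real \<Rightarrow> real \<Rightarrow> real \<Rightarrow> real \<Rightarrow> bool" where
  "saddle_scaling a b l h C K \<eta> t q g \<longleftrightarrow>
     continuous_on {a<..<b} (\<lambda>z. \<rho> z t q g) \<and> continuous_on {a<..<b} (\<lambda>z. action M z t q) \<and>
     (\<exists>S. inj_on (\<lambda>x. chart M (kscale g * x) t q) S \<and>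
        (\<lambda>x. chart M (kscale g * x) t q) ` S = {a<..<b} \<and>
        (\<forall>x\<in>S. ((\<lambda>x. chart M (kscale g * x) t q) has_real_derivative slope (kscale g * x) t q * kscale g) (at x)) \<and>
        laplace_data l h C K \<eta> (kscale g) S (\<lambda>x. scaled_action t q g (chart M (kscale g * x) t q))
          (\<lambda>x. \<rho> (chart M (kscale g * x) t q) t q g * \<bar>slope (kscale g * x) t q\<bar> / mu0 M \<rho> t q))"

lemma eventually_Delta_less: "e > 0 \<Longrightarrow> \<forall>\<^sub>F (t, q) in nhds (crit M). \<Delta> t q < e"
  unfolding eventually_nhds_controls by blast

lemma curve_eventually:
  assumes "scaling_curve M l h T Q" "\<forall>\<^sub>F (t, q) in nhds (crit M). P t q"
  shows "\<forall>\<^sub>F g in at_right 0. P (T g) (Q g)"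
  using eventually_compose_filterlim[OF assms(2), of "\<lambda>g. (T g, Q g)"] assms(1)
  by (simp add: scaling_curve_def)

text \<open>Along the signed chart the slope is at least \<open>m\<close>, so the window of
  half-width \<eta> covers all values within m \<eta> of the centre; the intermediate value theorem
  supplies the preimage.\<close>

lemma slope_crossing:
  assumes der: "\<And>y. \<bar>y\<bar> < e \<Longrightarrow> ((\<lambda>y. chart M y t q) has_real_derivative slope y t q) (at y)"
    and sl: "\<And>y. \<bar>y\<bar> < e \<Longrightarrow> m \<le> \<sigma> * slope y t q \<and> \<bar>slope y t q\<bar> \<le> L"
    and e: "0 < \<eta>" "\<eta> < e" "\<bar>\<sigma>\<bar> = 1" and z: "\<bar>z - chart M 0 t q\<bar> < m * \<eta>"
  obtains y where "\<bar>y\<bar> < \<eta>" "chart M y t q = z"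
proof -
  let ?f = "\<lambda>y. \<sigma> * chart M y t q"
  have s: "\<bar>\<sigma> * z - ?f 0\<bar> < m * \<eta>"
    using z e(3) by (simp add: abs_mult flip: right_diff_distrib)
  have "m * (0 - - \<eta>) \<le> \<sigma> * (chart M 0 t q - chart M (- \<eta>) t q)"
    by (rule chart_mvt(1)[where e = e]) (use der sl e in auto)
  moreover have "m * (\<eta> - 0) \<le> \<sigma> * (chart M \<eta> t q - chart M 0 t q)"
    by (rule chart_mvt(1)[where e = e]) (use der sl e in auto)
  ultimately have ends: "?f (- \<eta>) < \<sigma> * z" "\<sigma> * z < ?f \<eta>"
    using s by (auto simp: algebra_simps)
  have "isCont (\<lambda>y. chart M y t q) y" if "y \<in> {- \<eta>..\<eta>}" for y
    using that e by (intro DERIV_isCont[OF der]) auto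
  then have "continuous_on {- \<eta>..\<eta>} ?f"
    by (intro continuous_on_mult_left continuous_at_imp_continuous_on ballI)
  then obtain y where y: "- \<eta> \<le> y" "y \<le> \<eta>" "?f y = \<sigma> * z"
    using IVT'[of ?f "- \<eta>" "\<sigma> * z" \<eta>] ends e by auto
  moreover have "y \<noteq> \<eta>" "y \<noteq> - \<eta>" using y(3) ends by auto
  moreover have "\<sigma> \<noteq> 0" using e by auto
  ultimately show ?thesis by (intro that[of y]) auto
qed

text \<open>The radius \<open>r\<close> and the lower bound of \<open>mu0\<close> serve every curve
  and interval, whereas \<open>C\<close>, \<open>K\<close> and \<open>\<eta>\<close> may depend on
  them. On its window the chart must be injective and still cover the fixed interval, although its
  centre moves with the controls.\<close>

lemma saddle_chart:
  obtains r \<mu> where "r > 0" "\<mu> > 0"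
    "\<forall>\<^sub>F (t, q) in nhds (crit M). \<mu> \<le> mu0 M \<rho> t q"
    "\<forall>\<^sub>F (t, q) in nhds (crit M). continuous_on {z. \<bar>z - zcrit M\<bar> < r} (\<lambda>z. action M z t q)"
    "\<And>a b l h T Q. zcrit M - r < a \<Longrightarrow> a < zcrit M \<Longrightarrow> zcrit M < b \<Longrightarrow> b < zcrit M + r \<Longrightarrow>
      scaling_curve M l h T Q \<Longrightarrow>
      \<exists>C\<ge>0. \<exists>K. \<exists>\<eta>>0. (\<forall>x. cusp_V l h x \<ge> x ^ 4 / 4 - K) \<and>
        (\<forall>\<^sub>F g in at_right 0. saddle_scaling a b l h C K \<eta> (T g) (Q g) g)"
proof -
  obtain e1 m L \<sigma> where e1: "e1 > 0" and m: "m > 0" and L: "L \<ge> 0" and \<sigma>: "\<bar>\<sigma>\<bar> = (1::real)"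
    and der: "\<And>y t q. \<bar>y\<bar> < e1 \<Longrightarrow> \<Delta> t q < e1 \<Longrightarrow> ((\<lambda>y. chart M y t q) has_real_derivative slope y t q) (at y)"
    and sl: "\<And>y t q. \<bar>y\<bar> < e1 \<Longrightarrow> \<Delta> t q < e1 \<Longrightarrow> m \<le> \<sigma> * slope y t q \<and> \<bar>slope y t q\<bar> \<le> L"
    and sl_lip: "\<And>y y' t q. \<bar>y\<bar> < e1 \<Longrightarrow> \<bar>y'\<bar> < e1 \<Longrightarrow> \<Delta> t q < e1 \<Longrightarrow> \<bar>slope y t q - slope y' t q\<bar> \<le> L * \<bar>y - y'\<bar>"
    using chart_slope by blast
  obtain e2 m2 L2 R where e2: "e2 > 0" and m2: "m2 > 0" and L2: "L2 \<ge> 0"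
    and R: "\<And>z t q g. \<bar>z - zcrit M\<bar> < e2 \<Longrightarrow> \<Delta> t q < e2 \<Longrightarrow> 0 < g \<Longrightarrow> g < e2 \<Longrightarrow> \<rho> z t q g = R z t q g"
    and R_bds: "\<And>z t q g. \<bar>z - zcrit M\<bar> < e2 \<Longrightarrow> \<Delta> t q < e2 \<Longrightarrow> 0 \<le> g \<Longrightarrow> g < e2 \<Longrightarrow> m2 \<le> R z t q g \<and> R z t q g \<le> L2"
    and R_lip: "\<And>z z' t q g g'. \<bar>z - zcrit M\<bar> < e2 \<Longrightarrow> \<bar>z' - zcrit M\<bar> < e2 \<Longrightarrow> \<Delta> t q < e2 \<Longrightarrow>
       0 \<le> g \<Longrightarrow> g < e2 \<Longrightarrow> 0 \<le> g' \<Longrightarrow> g' < e2 \<Longrightarrow> \<bar>R z t q g - R z' t q g'\<bar> \<le> L2 * (\<bar>z - z'\<bar> + \<bar>g - g'\<bar>)"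
    by (rule density_extension) (rule that)
  obtain e3 where e3: "e3 > 0" and nf: "\<And>l h T Q. scaling_curve M l h T Q \<Longrightarrow>
    \<exists>C\<ge>0. \<exists>K. (\<forall>x. cusp_V l h x \<ge> x ^ 4 / 4 - K) \<and> (\<forall>\<^sub>F g in at_right 0. \<forall>x. kscale g * \<bar>x\<bar> < e3 \<longrightarrow>
      cusp_close l h C K (kscale g) x (scaled_action (T g) (Q g) g (chart M (kscale g * x) (T g) (Q g))))"
    using scaled_action_bounds by blast
  have act_smooth: "smooth_near (\<lambda>(z, t, q). action M z t q) (zcrit M, taucrit M, qcrit M)"
    and chart_smooth: "smooth_near (\<lambda>(y, t, q). chart M y t q) (0, taucrit M, qcrit M)"
    using loc by (auto simp: cusp_local_def)
  obtain e4 L4 where e4: "e4 > 0" and L4: "L4 \<ge> 0" and act_lip: "\<And>y y' t q. \<bar>y - zcrit M\<bar> < e4 \<Longrightarrow> \<bar>y' - zcrit M\<bar> < e4 \<Longrightarrow>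
      \<Delta> t q < e4 \<Longrightarrow> \<bar>action M y t q - action M y' t q\<bar> \<le> L4 * \<bar>y - y'\<bar>"
    by (rule smooth_near_lipschitz3[OF act_smooth]) (rule that)
  obtain e5 L5 where e5: "e5 > 0" and L5: "L5 \<ge> 0" and chart_lip: "\<And>y t q. \<bar>y - 0\<bar> < e5 \<Longrightarrow> \<Delta> t q < e5 \<Longrightarrow>
      \<bar>chart M y t q - chart M 0 (taucrit M) (qcrit M)\<bar> \<le> L5 * (\<bar>y - 0\<bar> + \<Delta> t q)"
    by (rule smooth_near_lipschitz3[OF chart_smooth]) (rule that)
  define e where "e = min (min (min e1 e2) (min e3 e4)) e5"
  have e: "e > 0" "e \<le> e1" "e \<le> e2" "e \<le> e3" "e \<le> e4" "e \<le> e5"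
    using e1 e2 e3 e4 e5 unfolding e_def by linarith+
  have centre: "\<bar>chart M 0 t q - zcrit M\<bar> < d" if "\<Delta> t q < e" "\<Delta> t q < d / (L5 + 1)" for t q d
  proof -
    have "\<bar>chart M 0 t q - zcrit M\<bar> \<le> L5 * \<Delta> t q" using chart_lip[of 0 t q] that e chart_crit by simp
    also have "\<dots> \<le> (L5 + 1) * \<Delta> t q" by (intro mult_right_mono) auto
    also have "\<dots> < d" using that(2) L5 by (simp add: field_simps)
    finally show ?thesis .
  qed
  \<comment> \<open>The limit is computed, so no default value of \<open>Lim\<close> occurs: for
    small \<open>g > 0\<close> the density at the chart centre is the extension, which is Lipschitz
    in \<open>g\<close> up to \<open>g = 0\<close>.\<close>
  have mu0_eq: "mu0 M \<rho> t q = R (chart M 0 t q) t q 0 * \<bar>slope 0 t q\<bar>"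
    if "\<Delta> t q < e" "\<bar>chart M 0 t q - zcrit M\<bar> < e" for t q
  proof -
    let ?c = "R (chart M 0 t q) t q"
    have "((\<lambda>g. L2 * \<bar>g\<bar>) \<longlongrightarrow> L2 * \<bar>0\<bar>) (at_right 0)" by (intro tendsto_intros)
    then have 0: "((\<lambda>g. L2 * \<bar>g\<bar>) \<longlongrightarrow> 0) (at_right 0)" by simp
    have ev: "\<forall>\<^sub>F g in at_right 0. g \<in> {0<..<e}" by (rule eventually_at_right_real[OF e(1)])
    have "((\<lambda>g. ?c g - ?c 0) \<longlongrightarrow> 0) (at_right 0)"
    proof (rule Lim_null_comparison[OF _ 0], use ev in eventually_elim)
      case (elim g)
      then show ?case using R_lip[of "chart M 0 t q" "chart M 0 t q" t q g 0] that e by simp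
    qed
    then have "(?c \<longlongrightarrow> ?c 0) (at_right 0)" by (simp add: LIM_zero_iff)
    then have "((\<lambda>g. ?c g * \<bar>slope 0 t q\<bar>) \<longlongrightarrow> ?c 0 * \<bar>slope 0 t q\<bar>) (at_right 0)" by (intro tendsto_intros)
    moreover have "\<forall>\<^sub>F g in at_right 0. ?c g * \<bar>slope 0 t q\<bar> = rho_y M \<rho> 0 t q g"
      using ev by eventually_elim (use R[of "chart M 0 t q" t q] that e in \<open>auto simp: rho_y_def\<close>)
    ultimately have "((\<lambda>g. rho_y M \<rho> 0 t q g) \<longlongrightarrow> ?c 0 * \<bar>slope 0 t q\<bar>) (at_right 0)"
      by (rule Lim_transform_eventually)
    then show ?thesis unfolding mu0_def by (intro tendsto_Lim) auto
  qed
  have abs_slope: "m \<le> \<bar>slope y t q\<bar>" if "\<bar>y\<bar> < e" "\<Delta> t q < e" for y t q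
  proof -
    have "m \<le> \<bar>\<sigma> * slope y t q\<bar>" using sl[of y t q] that e by linarith
    then show ?thesis using \<sigma> by (simp add: abs_mult)
  qed
  have mu0_ge: "m2 * m \<le> mu0 M \<rho> t q" if "\<Delta> t q < e" "\<bar>chart M 0 t q - zcrit M\<bar> < e" for t q
    unfolding mu0_eq[OF that] using R_bds[of "chart M 0 t q" t q 0] abs_slope[of 0 t q] that e m m2
    by (intro mult_mono) auto
  define \<eta>0 where "\<eta>0 = e / 2"
  have \<eta>0: "0 < \<eta>0" "\<eta>0 < e" using e(1) by (auto simp: \<eta>0_def)
  \<comment> \<open>A point of the interval and the chart centre are both within \<open>r\<close> of
    the critical saddle, hence within m \<eta>0 of each other, as \<open>slope_crossing\<close>
    requires.\<close>
  define r where "r = min e (m * \<eta>0 / 2)"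
  have "m * \<eta>0 / 2 > 0" using m \<eta>0 by simp
  then have r: "r > 0" "r \<le> e" "r \<le> m * \<eta>0 / 2" using e(1) unfolding r_def by linarith+
  have small: "\<forall>\<^sub>F (t, q) in nhds (crit M). \<Delta> t q < e \<and> \<bar>chart M 0 t q - zcrit M\<bar> < d" if "d > 0" for d
  proof -
    have "\<forall>\<^sub>F (t, q) in nhds (crit M). \<Delta> t q < min e (d / (L5 + 1))"
      using e(1) L5 that by (intro eventually_Delta_less) auto
    then show ?thesis by eventually_elim (auto intro: centre)
  qed
  show ?thesis
  proof (rule that[of r "m2 * m"])
    show "\<forall>\<^sub>F (t, q) in nhds (crit M). m2 * m \<le> mu0 M \<rho> t q"
      using small[OF e(1)] by eventually_elim (auto intro: mu0_ge)
    have act_cont: "continuous_on {z. \<bar>z - zcrit M\<bar> < e} (\<lambda>z. action M z t q)" if "\<Delta> t q < e" for t q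
      by (rule lipschitz_continuous_on[of _ _ L4]) (use act_lip that e L4 in auto)
    show "\<forall>\<^sub>F (t, q) in nhds (crit M). continuous_on {z. \<bar>z - zcrit M\<bar> < r} (\<lambda>z. action M z t q)"
      using eventually_Delta_less[OF e(1)]
      by eventually_elim (use r in \<open>auto intro: continuous_on_subset[OF act_cont]\<close>)
    fix a b l h T Q
    assume ab: "zcrit M - r < a" "a < zcrit M" "zcrit M < b" "b < zcrit M + r"
      and curve: "scaling_curve M l h T Q"
    obtain C1 K where C1: "C1 \<ge> 0" and V: "\<forall>x. cusp_V l h x \<ge> x ^ 4 / 4 - K"
      and act: "\<forall>\<^sub>F g in at_right 0. \<forall>x. kscale g * \<bar>x\<bar> < e3 \<longrightarrow>
      cusp_close l h C1 K (kscale g) x (scaled_action (T g) (Q g) g (chart M (kscale g * x) (T g) (Q g)))"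
      using nf[OF curve] by blast
    \<comment> \<open>In units of k (1 + |x|) the density varies by
      \<open>L2 * (L + coef4 M)\<close> and the slope by \<open>L\<close>; each is multiplied by the
      bound of the other factor, and normalising by \<open>mu0\<close> costs its lower bound
      \<open>m2 * m\<close>.\<close>
    define C2 where "C2 = L2 * L * (L + coef4 M + 1) / (m2 * m)"
    have C2: "C2 \<ge> 0" using L2 L coef_pos m m2 by (simp add: C2_def)
    define d where "d = min (b - zcrit M) (zcrit M - a)"
    have d: "d > 0" "d \<le> b - zcrit M" "d \<le> zcrit M - a" using ab unfolding d_def by linarith+
    \<comment> \<open>For k |x| below \<eta> the chart moves by at most d / 2 from its centre, which
      is itself within d / 2 of the critical saddle, so the point stays in (a, b).\<close>
    define \<eta> where "\<eta> = min \<eta>0 (d / (2 * (L + 1)))"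
    have "d / (2 * (L + 1)) > 0" using d L by simp
    then have \<eta>: "\<eta> > 0" "\<eta> \<le> \<eta>0" "\<eta> \<le> d / (2 * (L + 1))" using \<eta>0 unfolding \<eta>_def by linarith+
    have "min (min r (d / 2)) e > 0" using r d e by simp
    note sm = curve_eventually[OF curve small[OF this]]
    have "\<forall>\<^sub>F g in at_right 0. g \<in> {0<..<e}" by (rule eventually_at_right_real[OF e(1)])
    from this sm act eventually_kscale_less[OF zero_less_one]
    have "\<forall>\<^sub>F g in at_right 0. saddle_scaling a b l h (C1 + C2) K \<eta> (T g) (Q g) g"
    proof eventually_elim
      case (elim g)
      define t q k where "t = T g" and "q = Q g" and "k = kscale g"
      have g: "0 < g" "g < e" and k: "0 < k" "k < 1" using elim by (auto simp: k_def)
      have \<Delta>: "\<Delta> t q < e" and c0: "\<bar>chart M 0 t q - zcrit M\<bar> < r" "\<bar>chart M 0 t q - zcrit M\<bar> < d / 2"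
          "\<bar>chart M 0 t q - zcrit M\<bar> < e"
        using elim by (auto simp: t_def q_def)
      have der': "((\<lambda>y. chart M y t q) has_real_derivative slope y t q) (at y)" if "\<bar>y\<bar> < e" for y
        using der that \<Delta> e by simp
      have sl': "m \<le> \<sigma> * slope y t q \<and> \<bar>slope y t q\<bar> \<le> L" if "\<bar>y\<bar> < e" for y
        using sl that \<Delta> e by simp
      have lip: "\<bar>chart M y' t q - chart M y t q\<bar> \<le> L * \<bar>y' - y\<bar>" if "\<bar>y\<bar> < e" "\<bar>y'\<bar> < e" for y y'
        using chart_mvt(2)[OF der' sl' _ that(1,2) \<sigma>] chart_mvt(2)[OF der' sl' _ that(2,1) \<sigma>]
        by (cases y y' rule: linorder_cases) (auto simp: abs_minus_commute)
      define S where "S = {x. \<bar>k * x\<bar> < \<eta>0} \<inter> (\<lambda>x. chart M (k * x) t q) -` {a<..<b}"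
      let ?\<phi> = "\<lambda>x. chart M (k * x) t q"
      have \<phi>_der: "(?\<phi> has_real_derivative slope (k * x) t q * k) (at x)" if "\<bar>k * x\<bar> < e" for x
        by (rule DERIV_chain2[where f = "\<lambda>y. chart M y t q" and g = "\<lambda>x. k * x", OF der'[OF that]])
          (auto intro!: derivative_eq_intros)
      have \<phi>_cont: "continuous_on {x. \<bar>k * x\<bar> < \<eta>0} ?\<phi>"
        using \<eta>0 by (intro continuous_at_imp_continuous_on ballI DERIV_isCont[OF \<phi>_der]) auto
      have "open {x. \<bar>k * x\<bar> < \<eta>0}" by (intro open_Collect_less continuous_intros)
      then have "open S" unfolding S_def by (intro continuous_open_preimage[OF \<phi>_cont]) auto
      have S: "\<bar>k * x\<bar> < \<eta>0" "\<bar>k * x\<bar> < e" "a < ?\<phi> x" "?\<phi> x < b" "\<bar>?\<phi> x - zcrit M\<bar> < e" if "x \<in> S" for x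
        using that \<eta>0 ab r by (auto simp: S_def)
      have inj: "inj_on ?\<phi> S"
      proof (rule linorder_inj_onI)
        fix x x' assume *: "x < x'" "x \<in> S" "x' \<in> S"
        then have "k * x < k * x'" using k by simp
        then have "m * (k * x' - k * x) \<le> \<sigma> * (?\<phi> x' - ?\<phi> x)"
          using chart_mvt(1)[OF der' sl' _ S(2)[OF *(2)] S(2)[OF *(3)] \<sigma>] by simp
        moreover have "m * (k * x' - k * x) > 0" using m \<open>k * x < k * x'\<close> by simp
        ultimately show "?\<phi> x \<noteq> ?\<phi> x'" by auto
      qed auto
      have im: "?\<phi> ` S = {a<..<b}"
      proof (intro equalityI subsetI)
        fix z assume z: "z \<in> {a<..<b}"
        then have "\<bar>z - zcrit M\<bar> < r" using ab by auto
        then have "\<bar>z - chart M 0 t q\<bar> < m * \<eta>0" using c0(1) r(3) by linarith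
        then obtain y where y: "\<bar>y\<bar> < \<eta>0" "chart M y t q = z"
          using slope_crossing[OF der' sl' \<eta>0 \<sigma>] by blast
        then have "y / k \<in> S" "z = ?\<phi> (y / k)" using z k by (auto simp: S_def)
        then show "z \<in> ?\<phi> ` S" by blast
      qed (auto simp: S_def)
      have out: "\<eta> \<le> k * \<bar>x\<bar>" if "x \<notin> S" for x
      proof (rule ccontr)
        assume "\<not> \<eta> \<le> k * \<bar>x\<bar>"
        then have x: "\<bar>k * x\<bar> < \<eta>" using k by (simp add: abs_mult)
        then have "\<bar>k * x\<bar> < e" using \<eta>(2) \<eta>0(2) by linarith
        then have "\<bar>?\<phi> x - chart M 0 t q\<bar> \<le> L * \<bar>k * x\<bar>" using lip[of 0 "k * x"] e(1) by simp
        also have "\<dots> \<le> (L + 1) * \<eta>" using x L by (intro mult_mono) auto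
        also have "\<dots> \<le> d / 2" using \<eta>(3) L by (simp add: field_simps)
        finally have "\<bar>?\<phi> x - zcrit M\<bar> < d" using c0(2) by linarith
        then have "a < ?\<phi> x" "?\<phi> x < b" using d by auto
        then show False using that x \<eta> by (simp add: S_def)
      qed
      have R_cont: "continuous_on {z. \<bar>z - zcrit M\<bar> < e} (\<lambda>z. \<rho> z t q g)"
      proof (rule lipschitz_continuous_on[of _ _ L2])
        fix z z' assume "z \<in> {z. \<bar>z - zcrit M\<bar> < e}" "z' \<in> {z. \<bar>z - zcrit M\<bar> < e}"
        then show "\<bar>\<rho> z t q g - \<rho> z' t q g\<bar> \<le> L2 * \<bar>z - z'\<bar>"
          using R[of z t q g] R[of z' t q g] R_lip[of z z' t q g g] \<Delta> g e by simp
      qed (rule L2)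
      have sl_cont: "continuous_on S (\<lambda>x. slope (k * x) t q)"
      proof (rule lipschitz_continuous_on[of _ _ "L * k"])
        fix x x' assume *: "x \<in> S" "x' \<in> S"
        have "\<bar>slope (k * x) t q - slope (k * x') t q\<bar> \<le> L * \<bar>k * x - k * x'\<bar>"
          using sl_lip[of "k * x" "k * x'" t q] S(2)[OF *(1)] S(2)[OF *(2)] \<Delta> e by simp
        then show "\<bar>slope (k * x) t q - slope (k * x') t q\<bar> \<le> L * k * \<bar>x - x'\<bar>"
          using k by (simp add: abs_mult flip: right_diff_distrib)
      qed (use L k in simp)
      have \<phi>S: "continuous_on S ?\<phi>" "?\<phi> ` S \<subseteq> {z. \<bar>z - zcrit M\<bar> < e}"
        using continuous_on_subset[OF \<phi>_cont, of S] S(5) by (auto simp: S_def)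
      have ab_e: "{a<..<b} \<subseteq> {z. \<bar>z - zcrit M\<bar> < e}" using ab r by auto
      have \<mu>: "m2 * m \<le> mu0 M \<rho> t q" "mu0 M \<rho> t q = R (chart M 0 t q) t q 0 * \<bar>slope 0 t q\<bar>"
        using mu0_ge mu0_eq \<Delta> c0(3) by auto
      have mm: "m2 * m > 0" using m m2 by simp
      have W: "\<bar>\<rho> (?\<phi> x) t q g * \<bar>slope (k * x) t q\<bar> / mu0 M \<rho> t q - 1\<bar> \<le> C2 * k * (1 + \<bar>x\<bar>)" if x: "x \<in> S" for x
      proof -
        let ?r = "R (?\<phi> x) t q g" and ?rc = "R (chart M 0 t q) t q 0"
        let ?s = "\<bar>slope (k * x) t q\<bar>" and ?sc = "\<bar>slope 0 t q\<bar>"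
        \<comment> \<open>\<open>mu0\<close> uses the density at g = 0; passing to the actual g
          costs an error of order g, and g is below a multiple of k.\<close>
        have "g = coef4 M * k ^ 4" using kscale_power4 g by (simp add: k_def)
        also have "\<dots> \<le> coef4 M * k ^ 1" using k coef_pos by (intro mult_left_mono power_decreasing) auto
        finally have gk: "g \<le> coef4 M * k" by simp
        have "\<bar>?\<phi> x - chart M 0 t q\<bar> \<le> L * (k * \<bar>x\<bar>)"
          using lip[of 0 "k * x"] S(2)[OF x] e(1) k by (simp add: abs_mult)
        then have "L2 * (\<bar>?\<phi> x - chart M 0 t q\<bar> + \<bar>g - 0\<bar>) \<le> L2 * (L * (k * \<bar>x\<bar>) + coef4 M * k)"
          using g gk L2 by (intro mult_left_mono add_mono) auto
        moreover have "\<bar>?r - ?rc\<bar> \<le> L2 * (\<bar>?\<phi> x - chart M 0 t q\<bar> + \<bar>g - 0\<bar>)"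
          by (rule R_lip; use S(5)[OF x] c0(3) \<Delta> g e(1,3) in linarith)
        ultimately have "\<bar>?r - ?rc\<bar> \<le> L2 * (L * (k * \<bar>x\<bar>) + coef4 M * k)" by (rule order_trans[rotated])
        also have "\<dots> \<le> L2 * (L * (k * (1 + \<bar>x\<bar>)) + coef4 M * (k * (1 + \<bar>x\<bar>)))"
          using L2 L coef_pos k by (intro mult_left_mono add_mono) auto
        finally have 1: "\<bar>?r - ?rc\<bar> \<le> L2 * (L + coef4 M) * (k * (1 + \<bar>x\<bar>))" by (simp add: algebra_simps)
        have "\<bar>?s - ?sc\<bar> \<le> \<bar>slope (k * x) t q - slope 0 t q\<bar>" by (rule abs_triangle_ineq3)
        also have "\<dots> \<le> L * (k * \<bar>x\<bar>)"
          using sl_lip[of "k * x" 0 t q] S(2)[OF x] \<Delta> e k by (simp add: abs_mult)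
        also have "\<dots> \<le> L * (k * (1 + \<bar>x\<bar>))" using L k by (intro mult_left_mono) auto
        finally have 2: "\<bar>?s - ?sc\<bar> \<le> L * (k * (1 + \<bar>x\<bar>))" .
        have rc: "0 \<le> ?rc" "?rc \<le> L2" using R_bds[of "chart M 0 t q" t q 0] c0(3) \<Delta> e m2 by auto
        have sL: "?s \<le> L" using sl'[OF S(2)[OF x]] by blast
        have eq: "?r * ?s - ?rc * ?sc = (?r - ?rc) * ?s + ?rc * (?s - ?sc)" by algebra
        have "\<bar>?r * ?s - ?rc * ?sc\<bar> \<le> \<bar>?r - ?rc\<bar> * ?s + ?rc * \<bar>?s - ?sc\<bar>"
          unfolding eq using abs_triangle_ineq[of "(?r - ?rc) * ?s" "?rc * (?s - ?sc)"]
            rc(1) by (simp add: abs_mult)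
        also have "\<dots> \<le> (L2 * (L + coef4 M) * (k * (1 + \<bar>x\<bar>))) * L + L2 * (L * (k * (1 + \<bar>x\<bar>)))"
          by (rule add_mono[OF mult_mono[OF 1 sL] mult_mono[OF rc(2) 2]]) (use 1 L2 in linarith)+
        also have "\<dots> = C2 * (m2 * m) * (k * (1 + \<bar>x\<bar>))"
        proof -
          have "C2 * (m2 * m) = L2 * L * (L + coef4 M + 1)" using m m2 by (simp add: C2_def)
          then show ?thesis by (simp add: algebra_simps)
        qed
        also have "\<dots> \<le> C2 * mu0 M \<rho> t q * (k * (1 + \<bar>x\<bar>))"
          using \<mu>(1) C2 k by (intro mult_right_mono mult_left_mono) auto
        finally have "\<bar>?r * ?s - mu0 M \<rho> t q\<bar> \<le> (C2 * k * (1 + \<bar>x\<bar>)) * mu0 M \<rho> t q"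
          unfolding \<mu>(2) by (simp add: mult_ac)
        moreover have "\<rho> (?\<phi> x) t q g = ?r" using R S(5)[OF x] \<Delta> g e by simp
        moreover have "mu0 M \<rho> t q > 0" using \<mu>(1) mm by linarith
        ultimately show ?thesis by (simp add: divide_simps abs_if split: if_splits)
      qed
      have kx: "kscale g * \<bar>x\<bar> < e3" if "x \<in> S" for x
        using S(2)[OF that] e k by (simp add: k_def abs_mult)
      have Wk: "C2 * k * (1 + \<bar>x\<bar>) \<le> (C1 + C2) * k * (1 + \<bar>x\<bar>)" 
        and Pk: "C1 * k * (\<bar>x\<bar> ^ 5 + \<bar>x\<bar> ^ 3 + \<bar>x\<bar>) \<le> (C1 + C2) * k * (\<bar>x\<bar> ^ 5 + \<bar>x\<bar> ^ 3 + \<bar>x\<bar>)" for x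
        using C1 C2 k by (intro mult_right_mono; simp)+
      have mu0_nz: "mu0 M \<rho> t q \<noteq> 0" using \<mu>(1) mm by linarith
      show ?case
        unfolding saddle_scaling_def laplace_data_def t_def[symmetric] q_def[symmetric] k_def[symmetric]
      proof (intro conjI exI[of _ S] allI ballI impI)
        show "continuous_on S (\<lambda>x. scaled_action t q g (?\<phi> x))"
          unfolding scaled_action_def using g
          by (intro continuous_intros continuous_on_compose2[OF act_cont[OF \<Delta>] \<phi>S]) auto
        show "continuous_on S (\<lambda>x. \<rho> (?\<phi> x) t q g * \<bar>slope (k * x) t q\<bar> / mu0 M \<rho> t q)"
          using mu0_nz by (intro continuous_intros continuous_on_compose2[OF R_cont \<phi>S] sl_cont) auto
        fix x assume x: "x \<in> S"
        show "(?\<phi> has_real_derivative slope (k * x) t q * k) (at x)" by (rule \<phi>_der[OF S(2)[OF x]])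
        show "cusp_close l h (C1 + C2) K k x (scaled_action t q g (?\<phi> x))"
          using elim(3)[rule_format, OF kx[OF x]] Pk[of x]
          unfolding cusp_close_def t_def[symmetric] q_def[symmetric] k_def[symmetric] by auto
        show "\<bar>\<rho> (?\<phi> x) t q g * \<bar>slope (k * x) t q\<bar> / mu0 M \<rho> t q - 1\<bar> \<le> (C1 + C2) * k * (1 + \<bar>x\<bar>)"
          using W[OF x] Wk[of x] by linarith
      qed (use \<open>open S\<close> inj im out in \<open>auto intro: continuous_on_subset[OF R_cont ab_e] continuous_on_subset[OF act_cont[OF \<Delta>] ab_e]\<close>)
    qed
    then show "\<exists>C\<ge>0. \<exists>K. \<exists>\<eta>>0. (\<forall>x. cusp_V l h x \<ge> x ^ 4 / 4 - K) \<and>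
        (\<forall>\<^sub>F g in at_right 0. saddle_scaling a b l h C K \<eta> (T g) (Q g) g)"
      using V C1 C2 \<eta>(1) by (intro exI[of _ "C1 + C2"] conjI exI[of _ K] exI[of _ \<eta>]) auto
  qed (use r m m2 in auto)
qed

end

section \<open>The local partition function\<close>

lemma cusp_Z_pos: "cusp_Z l h > 0"
proof -
  have i: "integrable lborel (\<lambda>x. exp (- cusp_V l h x))"
    by (rule exp_tame_cusp_integrable[OF exp_tame_exp])
  have "cusp_Z l h \<noteq> 0"
  proof
    assume "cusp_Z l h = 0"
    then have "AE x in lborel. exp (- cusp_V l h x) = 0"
      using integral_nonneg_eq_0_iff_AE[OF i] by (simp add: cusp_Z_def)
    then show False by (simp add: AE_iff_null null_sets_def)
  qed
  moreover have "cusp_Z l h \<ge> 0" unfolding cusp_Z_def by (intro integral_nonneg_AE) simp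
  ultimately show ?thesis by simp
qed

text \<open>The inequality ln x \<le> x - 1 is applied to x and to 1/x; the factor 2 bounds 1/x for
  x \<ge> 1/2.\<close>

lemma abs_ln_le:
  fixes x :: real
  assumes "\<bar>x - 1\<bar> \<le> 1 / 2"
  shows "\<bar>ln x\<bar> \<le> 2 * \<bar>x - 1\<bar>"
proof -
  have x: "x \<ge> 1 / 2" using assms by linarith
  have "ln x \<le> x - 1" using x by (intro ln_le_minus_one) auto
  moreover have "- ln x \<le> \<bar>x - 1\<bar> * 2"
  proof -
    have "- ln x \<le> inverse x - 1" using ln_le_minus_one[of "inverse x"] x by (simp add: ln_inverse)
    also have "\<dots> = (1 - x) * inverse x" using x by (simp add: field_simps)
    also have "\<dots> \<le> \<bar>x - 1\<bar> * 2" using x by (intro mult_mono) (auto simp: field_simps)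
    finally show ?thesis .
  qed
  moreover have "x - 1 \<le> \<bar>x - 1\<bar> * 2" by (cases "x \<ge> 1") (auto simp: abs_if)
  ultimately show ?thesis by (intro abs_leI) (simp_all add: mult.commute)
qed

text \<open>For averages, which are quotients of two integrals known up to a common error: while the
  error is below Z / 2 the denominator stays above Z / 2.\<close>

lemma ratio_perturbation:
  fixes X0 X1 Y Z :: real
  assumes Z: "Z > 0" and X1: "\<bar>X1 - Y\<bar> \<le> \<epsilon>" and X0: "\<bar>X0 - Z\<bar> \<le> \<epsilon>" and "\<epsilon> \<le> Z / 2"
  shows "\<bar>X1 / X0 - Y / Z\<bar> \<le> 2 / Z * (1 + \<bar>Y\<bar> / Z) * \<epsilon>"
proof -
  have X0': "X0 \<ge> Z / 2" using assms by linarith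
  have "X1 / X0 - Y / Z = ((X1 - Y) - Y / Z * (X0 - Z)) / X0"
    using Z X0' by (simp add: field_simps)
  then have "\<bar>X1 / X0 - Y / Z\<bar> = \<bar>(X1 - Y) - Y / Z * (X0 - Z)\<bar> / X0" using X0' Z by simp
  also have "\<dots> \<le> (\<epsilon> + \<bar>Y\<bar> / Z * \<epsilon>) / X0"
  proof (rule divide_right_mono)
    have "\<bar>Y / Z * (X0 - Z)\<bar> \<le> \<bar>Y\<bar> / Z * \<epsilon>" using X0 Z by (simp add: abs_mult mult_left_mono divide_right_mono)
    then show "\<bar>(X1 - Y) - Y / Z * (X0 - Z)\<bar> \<le> \<epsilon> + \<bar>Y\<bar> / Z * \<epsilon>" using X1 by linarith
  qed (use X0' Z in simp)
  also have "\<dots> \<le> (\<epsilon> + \<bar>Y\<bar> / Z * \<epsilon>) / (Z / 2)"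
    using X0' Z X1 by (intro divide_left_mono) auto
  also have "\<dots> = 2 / Z * (1 + \<bar>Y\<bar> / Z) * \<epsilon>" using Z by (simp add: field_simps)
  finally show ?thesis .
qed

text \<open>For an excess s \<ge> d over \<open>a0\<close>, the exponent s (1/(2 g) - 1/g1) is at
  least its value at s = d because 2 g \<le> g1. So the weight at coupling g is at most exp(- d / (2
  g)) times a constant times the weight at coupling g1, whose integral is bounded.\<close>

lemma outer_integral:
  fixes act \<rho> G :: "real \<Rightarrow> real"
  assumes Br: "open Br" "continuous_on Br act" and A: "open A"
    and int: "set_integrable lborel Br (\<lambda>z. \<rho> z * exp (- act z / g1))"
    and le: "(LINT z:Br|lborel. \<rho> z * exp (- act z / g1)) \<le> Ct"
    and \<rho>: "\<And>z. z \<in> Br \<Longrightarrow> \<rho> z \<ge> 0"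
    and d: "\<And>z. z \<in> Br - A \<Longrightarrow> act z \<ge> a0 + d" "d > 0"
    and g: "0 < g" "2 * g \<le> g1"
    and G: "continuous_on UNIV G" "\<And>p. p \<ge> 0 \<Longrightarrow> \<bar>G p\<bar> \<le> exp (- p / 2)"
  shows "set_integrable lborel (Br - A) (\<lambda>z. \<rho> z * G ((act z - a0) / g))"
    "\<bar>LINT z:Br - A|lborel. \<rho> z * G ((act z - a0) / g)\<bar> \<le> Ct * exp (a0 / g1 + d / g1) * exp (- (d / (2 * g)))"
proof -
  let ?D = "Br - A"
  define E where "E = exp (a0 / g1 + d / g1) * exp (- (d / (2 * g)))"
  define w where "w z = indicat_real Br z * (\<rho> z * exp (- act z / g1))" for z
  define F where "F z = indicat_real ?D z * (\<rho> z * G ((act z - a0) / g))" for z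
  have iw: "integrable lborel w" using int by (simp add: set_integrable_def w_def[abs_def])
  have cont: "continuous_on Br (\<lambda>z. exp (act z / g1) * G ((act z - a0) / g))"
    using g Br by (intro continuous_intros continuous_on_compose2[OF G(1)]) auto
  \<comment> \<open>Measurability of \<rho> on the branch comes through the integrable reference
    weight \<open>w\<close>, so the integrand is written as \<open>w\<close> times a continuous
    quotient.\<close>
  have "(\<lambda>z. indicat_real Br z *\<^sub>R (exp (act z / g1) * G ((act z - a0) / g))) \<in> borel_measurable borel"
    using borel_measurable_continuous_on_indicator[OF _ cont] Br(1) by simp
  moreover have "indicat_real ?D \<in> borel_measurable borel" using Br(1) A by (intro borel_measurable_indicator) auto
  moreover have "w \<in> borel_measurable borel" using iw by simp
  ultimately have "(\<lambda>z. w z * (indicat_real ?D z * (indicat_real Br z *\<^sub>R (exp (act z / g1) * G ((act z - a0) / g))))) \<in> borel_measurable borel"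
    by (intro borel_measurable_times)
  moreover have "w z * (indicat_real ?D z * (indicat_real Br z *\<^sub>R (exp (act z / g1) * G ((act z - a0) / g)))) = F z" for z
    by (auto simp: w_def F_def indicator_def simp flip: exp_add)
  ultimately have meas: "F \<in> borel_measurable borel" by simp
  have pt: "\<bar>F z\<bar> \<le> E * w z" for z
  proof (cases "z \<in> ?D")
    case True
    define s where "s = act z - a0"
    have s: "s \<ge> d" using d(1)[OF True] by (simp add: s_def)
    have "1 / (2 * g) - 1 / g1 \<ge> 0" using g by (simp add: field_simps)
    then have "d * (1 / (2 * g) - 1 / g1) \<le> s * (1 / (2 * g) - 1 / g1)" using s by (rule mult_right_mono[rotated])
    then have "- (s / g / 2) \<le> d / g1 + - (d / (2 * g)) + - (s / g1)" by (simp add: algebra_simps)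
    then have "- (s / g / 2) \<le> (a0 / g1 + d / g1) + - (d / (2 * g)) + - act z / g1"
      by (simp add: s_def diff_divide_distrib)
    then have e: "exp (- (s / g) / 2) \<le> E * exp (- act z / g1)" unfolding E_def by (simp flip: exp_add)
    have "\<bar>F z\<bar> = \<rho> z * \<bar>G (s / g)\<bar>" using True \<rho>[of z] by (simp add: F_def s_def abs_mult)
    also have "\<dots> \<le> \<rho> z * (E * exp (- act z / g1))"
      using G(2)[of "s / g"] e s d(2) g \<rho>[of z] True by (intro mult_left_mono) auto
    also have "\<dots> = E * w z" using True by (simp add: w_def)
    finally show ?thesis .
  next
    case False
    then show ?thesis using \<rho>[of z] by (auto simp: F_def w_def E_def indicator_def)
  qed
  have w0: "w z \<ge> 0" for z using \<rho>[of z] by (auto simp: w_def indicator_def)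
  have iE: "integrable lborel (\<lambda>z. E * w z)" using iw by simp
  have iF: "integrable lborel F"
    by (rule Bochner_Integration.integrable_bound[OF iE])
      (use meas pt in \<open>auto intro: order_trans[OF _ abs_ge_self]\<close>)
  then show "set_integrable lborel ?D (\<lambda>z. \<rho> z * G ((act z - a0) / g))"
    by (simp add: set_integrable_def F_def[abs_def])
  have "\<bar>LINT z|lborel. F z\<bar> \<le> (LINT z|lborel. \<bar>F z\<bar>)" by (rule integral_abs_bound)
  also have "\<dots> \<le> (LINT z|lborel. E * w z)" by (rule integral_mono) (use iF iE pt in auto)
  also have "\<dots> = E * (LINT z|lborel. w z)" by simp
  also have "\<dots> \<le> E * Ct"
    using le by (intro mult_left_mono) (auto simp: E_def set_lebesgue_integral_def w_def[abs_def])
  finally show "\<bar>LINT z:?D|lborel. \<rho> z * G ((act z - a0) / g)\<bar> \<le> Ct * exp (a0 / g1 + d / g1) * exp (- (d / (2 * g)))"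
    by (simp add: set_lebesgue_integral_def F_def[abs_def] E_def mult_ac)
qed

context cusp_saddle
begin

text \<open>The divisor is what the substitution leaves behind: \<open>mu0\<close> from density and
  chart slope at the saddle, \<open>kscale g\<close> from y = k x. The set \<open>A\<close> is the
  saddle region or the whole branch.\<close>

definition integral_close ::
  "real \<Rightarrow> real \<Rightarrow> (real \<Rightarrow> real) \<Rightarrow> real \<Rightarrow> real set \<Rightarrow> real \<Rightarrow> real \<Rightarrow> real \<Rightarrow> bool" where
  "integral_close l h G B A t q g \<longleftrightarrow>
     set_integrable lborel A (\<lambda>z. \<rho> z t q g * G (scaled_action t q g z)) \<and>
     \<bar>(LINT z:A|lborel. \<rho> z t q g * G (scaled_action t q g z)) / (mu0 M \<rho> t q * kscale g)
        - (LINT x|lborel. G (cusp_V l h x))\<bar> \<le> B * kscale g"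

text \<open>The bound of \<open>scaled_laplace\<close> depends only on its constants, so after the
  substitution one \<open>B\<close> serves all intervals, controls and couplings.\<close>

lemma saddle_integral:
  assumes G: "exp_tame G" and "\<eta> > 0" and "\<forall>x. cusp_V l h x \<ge> x ^ 4 / 4 - K" and "C \<ge> 0"
  obtains B where "B \<ge> 0"
    "\<And>a b t q g. 0 < g \<Longrightarrow> kscale g \<le> 1 \<Longrightarrow> mu0 M \<rho> t q > 0 \<Longrightarrow> saddle_scaling a b l h C K \<eta> t q g \<Longrightarrow>
      integral_close l h G B {a<..<b} t q g"
proof -
  obtain B where B0: "B \<ge> 0" and B: "\<And>k S P W. 0 < k \<Longrightarrow> k \<le> 1 \<Longrightarrow> laplace_data l h C K \<eta> k S P W \<Longrightarrow>
      set_integrable lborel S (\<lambda>x. W x * G (P x)) \<and>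
      \<bar>(LINT x:S|lborel. W x * G (P x)) - (LINT x|lborel. G (cusp_V l h x))\<bar> \<le> B * k"
    by (rule scaled_laplace[OF G assms(2) assms(3)[rule_format] assms(4)]) (rule that)
  have "integral_close l h G B {a<..<b} t q g"
    if g: "0 < g" and k1: "kscale g \<le> 1" and mu: "mu0 M \<rho> t q > 0" and sc: "saddle_scaling a b l h C K \<eta> t q g"
    for a b t q g
  proof -
    let ?k = "kscale g" and ?\<mu> = "mu0 M \<rho> t q"
    have k: "?k > 0" using kscale_pos[OF g] .
    define \<phi> P W where "\<phi> = (\<lambda>x. chart M (?k * x) t q)" and "P = (\<lambda>x. scaled_action t q g (\<phi> x))"
      and "W = (\<lambda>x. \<rho> (\<phi> x) t q g * \<bar>slope (?k * x) t q\<bar> / ?\<mu>)"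
    from sc obtain S where cont: "continuous_on {a<..<b} (\<lambda>z. \<rho> z t q g)" "continuous_on {a<..<b} (\<lambda>z. action M z t q)"
      and S: "inj_on \<phi> S" "\<phi> ` S = {a<..<b}"
        "\<And>x. x \<in> S \<Longrightarrow> (\<phi> has_real_derivative slope (?k * x) t q * ?k) (at x)"
      and data: "laplace_data l h C K \<eta> ?k S P W"
      unfolding saddle_scaling_def \<phi>_def P_def W_def by blast
    have "open S" using data by (simp add: laplace_data_def)
    have lap: "set_integrable lborel S (\<lambda>x. W x * G (P x))"
      "\<bar>(LINT x:S|lborel. W x * G (P x)) - (LINT x|lborel. G (cusp_V l h x))\<bar> \<le> B * ?k"
      using B[OF k k1 data] by auto
    let ?f = "\<lambda>z. \<rho> z t q g * G (scaled_action t q g z)"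
    have Gc: "continuous_on UNIV G" by (rule conjunct1[OF G[unfolded exp_tame_def]])
    have f: "continuous_on {a<..<b} ?f"
      unfolding scaled_action_def using g
      by (intro continuous_intros continuous_on_compose2[OF Gc] cont) auto
    have eq: "\<bar>slope (?k * x) t q * ?k\<bar> * ?f (\<phi> x) = (?\<mu> * ?k) * (W x * G (P x))" for x
      using mu k by (simp add: W_def P_def abs_mult)
    have int: "set_integrable lborel S (\<lambda>x. \<bar>slope (?k * x) t q * ?k\<bar> * ?f (\<phi> x))"
      unfolding eq using lap(1) by (rule set_integrable_mult_right[rotated])
    note cv = lborel_change_of_variables[OF \<open>open S\<close> S(3,1,2) _ f int]
    have "(LINT z:{a<..<b}|lborel. ?f z) = (?\<mu> * ?k) * (LINT x:S|lborel. W x * G (P x))"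
      using cv(2) unfolding eq by simp
    then show ?thesis using cv(1) lap(2) mu k by (simp add: integral_close_def)
  qed
  then show ?thesis using B0 that by blast
qed

lemma kscale_bigoI:
  assumes "\<forall>\<^sub>F g in at_right 0. \<bar>f g\<bar> \<le> B * kscale g"
  shows "f \<in> O[at_right 0](\<lambda>g. g powr (1/4))"
proof (rule bigoI[of _ "B / coef4 M powr (1/4)"])
  show "\<forall>\<^sub>F g in at_right 0. norm (f g) \<le> B / coef4 M powr (1/4) * norm (g powr (1/4))"
    using assms eventually_at_right_less[of "0::real"]
    by eventually_elim (simp add: kscale_eq)
qed

text \<open>With exp(- action0 / g) split off, the ratio to the asserted form is the normalised
  saddle integral divided by \<open>cusp_Z\<close>; the error of \<open>Gamma_eff\<close> is minus
  the logarithm of that ratio.\<close>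

theorem partition_crossover_saddle:
  assumes N: "\<forall>g>0. N g > 0"
  shows "partition_crossover M \<rho> N"
proof -
  obtain r \<mu> where r: "r > 0" and \<mu>: "\<mu> > 0"
    and mu: "\<forall>\<^sub>F (t, q) in nhds (crit M). \<mu> \<le> mu0 M \<rho> t q"
    and sc: "\<And>a b l h T Q. zcrit M - r < a \<Longrightarrow> a < zcrit M \<Longrightarrow> zcrit M < b \<Longrightarrow> b < zcrit M + r \<Longrightarrow>
      scaling_curve M l h T Q \<Longrightarrow>
      \<exists>C\<ge>0. \<exists>K. \<exists>\<eta>>0. (\<forall>x. cusp_V l h x \<ge> x ^ 4 / 4 - K) \<and>
        (\<forall>\<^sub>F g in at_right 0. saddle_scaling a b l h C K \<eta> (T g) (Q g) g)"
    by (rule saddle_chart) (rule that)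
  show ?thesis
    unfolding partition_crossover_def
  proof (intro exI[of _ r] conjI r allI impI)
    fix a b l h T Q
    assume ab: "zcrit M - r < a \<and> a < zcrit M \<and> zcrit M < b \<and> b < zcrit M + r"
      and curve: "scaling_curve M l h T Q"
    obtain C K \<eta> where C: "C \<ge> 0" "\<eta> > 0" "\<forall>x. cusp_V l h x \<ge> x ^ 4 / 4 - K"
      and ev: "\<forall>\<^sub>F g in at_right 0. saddle_scaling a b l h C K \<eta> (T g) (Q g) g"
      using sc[OF _ _ _ _ curve] ab by blast
    obtain B where B0: "B \<ge> 0" and B: "\<And>a b t q g. 0 < g \<Longrightarrow> kscale g \<le> 1 \<Longrightarrow> mu0 M \<rho> t q > 0 \<Longrightarrow> saddle_scaling a b l h C K \<eta> t q g \<Longrightarrow>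
      integral_close l h (\<lambda>s. exp (- s)) B {a<..<b} t q g"
      by (rule saddle_integral[OF exp_tame_exp C(2,3,1)]) (rule that)
    let ?Z = "cusp_Z l h"
    note Z = cusp_Z_pos[of l h]
    let ?den = "\<lambda>g. exp (- action0 M (T g) (Q g) / g) * N g * mu0 M \<rho> (T g) (Q g) * (g / coef4 M) powr (1/4) * ?Z"
    let ?ratio = "\<lambda>g. Z_loc M \<rho> N a b (T g) (Q g) g / ?den g"
    have "Z / (2 * (B + 1)) > 0" if "Z > 0" for Z using that B0 by simp
    \<comment> \<open>This bound on k makes B k / Z at most 1/2, the range in which
      \<open>abs_ln_le\<close> controls the logarithm.\<close>
    from this[OF Z] have "min 1 (?Z / (2 * (B + 1))) > 0" by simp
    from eventually_kscale_less[OF this] ev curve_eventually[OF curve mu]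
    have main: "\<forall>\<^sub>F g in at_right 0. 0 < g \<and> 0 < mu0 M \<rho> (T g) (Q g) \<and>
        \<bar>?ratio g - 1\<bar> \<le> B / ?Z * kscale g \<and> \<bar>?ratio g - 1\<bar> \<le> 1 / 2"
    proof eventually_elim
      case (elim g)
      define t q k where "t = T g" and "q = Q g" and "k = kscale g"
      have g: "0 < g" and k: "0 < k" "k < 1" "k < ?Z / (2 * (B + 1))" using elim by (auto simp: k_def)
      have m: "0 < mu0 M \<rho> t q" using elim \<mu> by (simp add: t_def q_def)
      have sc: "saddle_scaling a b l h C K \<eta> t q g" using elim by (simp add: t_def q_def)
      define J where "J = (LINT z:{a<..<b}|lborel. \<rho> z t q g * exp (- scaled_action t q g z))"
      have J: "\<bar>J / (mu0 M \<rho> t q * k) - ?Z\<bar> \<le> B * k"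
        using B[OF g _ m sc] k by (simp add: J_def k_def cusp_Z_def integral_close_def)
      have "N g * \<rho> z t q g * exp (- action M z t q / g)
          = (N g * exp (- action0 M t q / g)) * (\<rho> z t q g * exp (- scaled_action t q g z))" for z
      proof -
        have "exp (- action M z t q / g) = exp (- action0 M t q / g) * exp (- scaled_action t q g z)"
          by (simp add: scaled_action_def diff_divide_distrib flip: exp_add)
        then show ?thesis by simp
      qed
      then have Zl: "Z_loc M \<rho> N a b t q g = (N g * exp (- action0 M t q / g)) * J"
        unfolding Z_loc_def J_def by (simp only: set_integral_mult_right)
      have "N g > 0" using N g by simp
      then have "?ratio g = J / (mu0 M \<rho> t q * k) / ?Z"
        unfolding t_def[symmetric] q_def[symmetric] Zl kscale_def[symmetric] k_def[symmetric] by simp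
      then have "?ratio g - 1 = (J / (mu0 M \<rho> t q * k) - ?Z) / ?Z"
        using Z by (simp only: diff_divide_distrib) simp
      then have "\<bar>?ratio g - 1\<bar> = \<bar>J / (mu0 M \<rho> t q * k) - ?Z\<bar> / ?Z" using Z by simp
      also have "\<dots> \<le> B * k / ?Z" using J Z by (intro divide_right_mono) auto
      finally have 1: "\<bar>?ratio g - 1\<bar> \<le> B / ?Z * k" by simp
      have "B * k \<le> (B + 1) * k" using k by simp
      also have "\<dots> \<le> ?Z / 2" using k(3) B0 by (simp add: field_simps)
      finally have "B / ?Z * k \<le> 1 / 2" using Z by (simp add: field_simps)
      then show ?case using 1 g m unfolding t_def q_def k_def by linarith
    qed
    have "(\<lambda>g. ?ratio g - 1) \<in> O[at_right 0](\<lambda>g. g powr (1/4))"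
      by (rule kscale_bigoI[of _ "B / ?Z"], use main in eventually_elim) auto
    moreover have "(\<lambda>g. Gamma_eff M \<rho> N a b (T g) (Q g) g - action0 M (T g) (Q g) / g
               - (1/4 * ln (coef4 M / g) - ln ?Z - ln (N g * mu0 M \<rho> (T g) (Q g))))
           \<in> O[at_right 0](\<lambda>g. g powr (1/4))"
    proof (rule kscale_bigoI[of _ "2 * (B / ?Z)"], use main in eventually_elim)
      case (elim g)
      let ?t = "T g" and ?q = "Q g"
      have pos: "N g > 0" "g > 0" "mu0 M \<rho> ?t ?q > 0" using N elim by auto
      have den: "?den g > 0" using pos Z coef_pos by simp
      have "?ratio g > 0" using elim by linarith
      then have zl: "Z_loc M \<rho> N a b ?t ?q g > 0" using den by (simp add: zero_less_divide_iff)
      have "ln (?den g) = - action0 M ?t ?q / g + ln (N g * mu0 M \<rho> ?t ?q) + 1/4 * ln (g / coef4 M) + ln ?Z"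
        using pos Z coef_pos by (simp add: ln_mult ln_powr)
      moreover have "ln (g / coef4 M) = - ln (coef4 M / g)" using pos coef_pos by (simp add: ln_div)
      moreover have "ln (?ratio g) = ln (Z_loc M \<rho> N a b ?t ?q g) - ln (?den g)" by (rule ln_divide_pos[OF zl den])
      ultimately have "Gamma_eff M \<rho> N a b ?t ?q g - action0 M ?t ?q / g
               - (1/4 * ln (coef4 M / g) - ln ?Z - ln (N g * mu0 M \<rho> ?t ?q)) = - ln (?ratio g)"
        by (simp add: Gamma_eff_def)
      moreover have "\<bar>ln (?ratio g)\<bar> \<le> 2 * \<bar>?ratio g - 1\<bar>" using elim by (intro abs_ln_le) auto
      ultimately show ?case using elim by simp
    qed
    ultimately show "(\<lambda>g. ?ratio g - 1) \<in> O[at_right 0](\<lambda>g. g powr (1/4))" and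
      "(\<lambda>g. Gamma_eff M \<rho> N a b (T g) (Q g) g - action0 M (T g) (Q g) / g
               - (1/4 * ln (coef4 M / g) - ln ?Z - ln (N g * mu0 M \<rho> (T g) (Q g))))
           \<in> O[at_right 0](\<lambda>g. g powr (1/4))" by blast+
  qed
qed

end

section \<open>The normalized free energy\<close>

text \<open>Supplies the decay that \<open>outer_integral\<close> asks of s exp(- s): half of the
  exponent absorbs the factor s, with constant 1.\<close>

lemma mult_exp_le_exp_half:
  fixes p :: real assumes "p \<ge> 0" shows "\<bar>p * exp (- p)\<bar> \<le> exp (- p / 2)"
proof -
  have q: "1 + p / 2 + (p / 2)\<^sup>2 / 2 \<le> exp (p / 2)"
    using exp_lower_Taylor_quadratic[of "p / 2"] assms by simp
  have "0 \<le> (p - 2)\<^sup>2" by simp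
  \<comment> \<open>The difference of the two sides is ((p - 2)^2 + 4) / 8.\<close>
  then have "p \<le> 1 + p / 2 + (p / 2)\<^sup>2 / 2" by (simp add: power2_eq_square field_simps)
  then have "p \<le> exp (p / 2)" using q by (rule order_trans)
  then have "p * exp (- p) \<le> exp (p / 2) * exp (- p)" by (rule mult_right_mono) simp
  also have "\<dots> = exp (- p / 2)" by (simp flip: exp_add)
  finally show ?thesis using assms by simp
qed

context cusp_saddle
begin

section \<open>The global minimum and the contribution of the whole branch\<close>

lemma chart_centre_tendsto: "((\<lambda>(t, q). chart M 0 t q) \<longlongrightarrow> zcrit M) (nhds (crit M))"
proof -
  have "smooth_near (\<lambda>(y, t, q). chart M y t q) (0, taucrit M, qcrit M)"
    using loc by (simp add: cusp_local_def)
  from smooth_near_continuous[OF this]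
  have "((\<lambda>(y, t, q). chart M y t q) \<longlongrightarrow> zcrit M) (nhds (0, crit M))" by (simp add: chart_crit)
  moreover have "((\<lambda>p. (0::real, p)) \<longlongrightarrow> (0, crit M)) (nhds (crit M))"
    by (intro tendsto_intros filterlim_ident)
  ultimately have "((\<lambda>p. (\<lambda>(y, t, q). chart M y t q) (0, p)) \<longlongrightarrow> zcrit M) (nhds (crit M))"
    by (rule filterlim_compose)
  then show ?thesis by (simp add: case_prod_unfold)
qed

lemma action_tendsto:
  assumes "((\<lambda>(t, q). f t q) \<longlongrightarrow> zcrit M) (nhds (crit M))"
  shows "((\<lambda>(t, q). action M (f t q) t q) \<longlongrightarrow> action M (zcrit M) (taucrit M) (qcrit M)) (nhds (crit M))"
proof -
  have "smooth_near (\<lambda>(z, t, q). action M z t q) (zcrit M, taucrit M, qcrit M)"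
    using loc by (simp add: cusp_local_def)
  from smooth_near_continuous[OF this]
  have "((\<lambda>(z, t, q). action M z t q) \<longlongrightarrow> action M (zcrit M) (taucrit M) (qcrit M)) (nhds (zcrit M, crit M))"
    by simp
  moreover have "((\<lambda>p. ((\<lambda>(t, q). f t q) p, p)) \<longlongrightarrow> (zcrit M, crit M)) (nhds (crit M))"
    by (intro tendsto_Pair assms filterlim_ident)
  ultimately have "((\<lambda>p. (\<lambda>(z, t, q). action M z t q) ((\<lambda>(t, q). f t q) p, p)) \<longlongrightarrow>
      action M (zcrit M) (taucrit M) (qcrit M)) (nhds (crit M))"
    by (rule filterlim_compose)
  then show ?thesis by (simp add: case_prod_unfold)
qed

text \<open>The gap in \<open>cusp_global\<close> is measured from the critical value of the action,
  while integrals and minima are taken relative to values at the current controls; continuity lets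
  these differ by only a part of the gap.\<close>

lemma eventually_action_near_crit:
  assumes "d > 0"
  shows "\<forall>\<^sub>F (t, q) in nhds (crit M). \<bar>action M (zcrit M) t q - action M (zcrit M) (taucrit M) (qcrit M)\<bar> < d \<and>
    \<bar>action0 M t q - action M (zcrit M) (taucrit M) (qcrit M)\<bar> < d"
proof -
  have "((\<lambda>(t::real, q::real). zcrit M) \<longlongrightarrow> zcrit M) (nhds (crit M))" by (simp add: case_prod_unfold)
  from tendstoD[OF action_tendsto[OF this] assms] tendstoD[OF action_tendsto[OF chart_centre_tendsto] assms]
  show ?thesis by eventually_elim (auto simp: action0_def dist_real_def)
qed

text \<open>Compactness gives a minimiser over the closed interval; points at distance at least
  \<open>r\<close> lie above the value at the centre, so it is interior and minimal on the whole
  branch.\<close>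

lemma branch_minimum:
  assumes act: "continuous_on (branch M t q) (\<lambda>z. action M z t q)"
    and sub: "{zcrit M - r..zcrit M + r} \<subseteq> branch M t q" and "r > 0"
    and out: "\<And>z. z \<in> branch M t q \<Longrightarrow> \<bar>z - zcrit M\<bar> \<ge> r \<Longrightarrow> action M z t q > action M (zcrit M) t q"
  obtains z where "z \<in> {zcrit M - r<..<zcrit M + r}" "z \<in> branch M t q"
    "\<And>z'. z' \<in> branch M t q \<Longrightarrow> action M z t q \<le> action M z' t q"
proof -
  let ?I = "{zcrit M - r..zcrit M + r}"
  obtain z where z: "z \<in> ?I" "\<And>z'. z' \<in> ?I \<Longrightarrow> action M z t q \<le> action M z' t q"
    using continuous_attains_inf[OF compact_Icc _ continuous_on_subset[OF act sub]] \<open>r > 0\<close> by force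
  have le: "action M z t q \<le> action M (zcrit M) t q" using z(2)[of "zcrit M"] \<open>r > 0\<close> by simp
  have zb: "z \<in> branch M t q" using z(1) sub by blast
  have "\<not> \<bar>z - zcrit M\<bar> \<ge> r" using out[OF zb] le by force
  then have zi: "z \<in> {zcrit M - r<..<zcrit M + r}" by auto
  have "action M z t q \<le> action M z' t q" if z': "z' \<in> branch M t q" for z'
  proof (cases "\<bar>z' - zcrit M\<bar> \<ge> r")
    case True then show ?thesis using out[OF z'] le by force
  next
    case False then show ?thesis by (intro z(2)) auto
  qed
  then show ?thesis using that zi zb by blast
qed

text \<open>From above, the minimiser is compared with the point of scaled coordinate
  \<open>xs\<close>. From below, its own scaled coordinate x has \<open>cusp_V l h x\<close> at
  least the minimum, and coercivity confines x to a fixed range, so both errors are multiples of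
  k.\<close>

lemma scaled_minimum:
  assumes V: "\<forall>x. cusp_V l h x \<ge> x ^ 4 / 4 - K" and C: "C \<ge> 0" "\<eta> > 0"
    and xs: "\<And>x. cusp_V l h xs \<le> cusp_V l h x"
  obtains B e where "B \<ge> 0" "e > 0"
    "\<And>a b t q g z. 0 < g \<Longrightarrow> kscale g < e \<Longrightarrow> saddle_scaling a b l h C K \<eta> t q g \<Longrightarrow> z \<in> {a<..<b} \<Longrightarrow>
      (\<And>z'. z' \<in> {a<..<b} \<Longrightarrow> action M z t q \<le> action M z' t q) \<Longrightarrow>
      \<bar>scaled_action t q g z - cusp_V l h xs\<bar> \<le> B * kscale g"
proof -
  define U where "U = cusp_V l h xs + C * (\<bar>xs\<bar> ^ 5 + \<bar>xs\<bar> ^ 3 + \<bar>xs\<bar>)"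
  \<comment> \<open>\<open>U\<close> bounds the minimal scaled action for k \<le> 1; with the lower
    bound x^4 / 4 - K this gives x^4 \<le> 4 (U + K), and |x| \<le> 1 + x^4.\<close>
  define X where "X = 1 + \<bar>4 * (U + K)\<bar>"
  define B where "B = C * (X ^ 5 + X ^ 3 + X) + C * (\<bar>xs\<bar> ^ 5 + \<bar>xs\<bar> ^ 3 + \<bar>xs\<bar>)"
  \<comment> \<open>The second bound puts k |xs| below \<eta>, so that \<open>xs\<close> lies in the
    scaled saddle region.\<close>
  define e where "e = min 1 (\<eta> / (\<bar>xs\<bar> + 1))"
  have X: "X \<ge> 0" by (simp add: X_def)
  have "\<eta> / (\<bar>xs\<bar> + 1) > 0" using C by simp
  then have e: "e > 0" by (simp add: e_def)
  have "\<bar>scaled_action t q g z - cusp_V l h xs\<bar> \<le> B * kscale g"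
    if g: "0 < g" and ke: "kscale g < e" and sc: "saddle_scaling a b l h C K \<eta> t q g" and z: "z \<in> {a<..<b}"
      and min: "\<And>z'. z' \<in> {a<..<b} \<Longrightarrow> action M z t q \<le> action M z' t q" for a b t q g z
  proof -
    define k where "k = kscale g"
    have k: "0 < k" "k \<le> 1" "k < \<eta> / (\<bar>xs\<bar> + 1)" using ke kscale_pos[OF g] by (auto simp: k_def e_def)
    define \<phi> where "\<phi> = (\<lambda>x. chart M (k * x) t q)"
    from sc obtain S where S: "\<phi> ` S = {a<..<b}" "\<And>x. x \<notin> S \<Longrightarrow> \<eta> \<le> k * \<bar>x\<bar>"
        "\<And>x. x \<in> S \<Longrightarrow> \<bar>scaled_action t q g (\<phi> x) - cusp_V l h x\<bar> \<le> C * k * (\<bar>x\<bar> ^ 5 + \<bar>x\<bar> ^ 3 + \<bar>x\<bar>)"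
        "\<And>x. x \<in> S \<Longrightarrow> scaled_action t q g (\<phi> x) \<ge> x ^ 4 / 4 - K"
      unfolding saddle_scaling_def laplace_data_def cusp_close_def \<phi>_def k_def by blast
    have "k * \<bar>xs\<bar> \<le> k * (\<bar>xs\<bar> + 1)" using k by simp
    also have "\<dots> < \<eta>" using k(3) by (simp add: field_simps)
    finally have xsS: "xs \<in> S" using S(2)[of xs] by linarith
    have "action M z t q \<le> action M (\<phi> xs) t q" by (rule min) (use S(1) xsS in blast)
    then have "scaled_action t q g z \<le> scaled_action t q g (\<phi> xs)"
      unfolding scaled_action_def using g by (simp add: divide_right_mono)
    also have "\<dots> \<le> cusp_V l h xs + C * k * (\<bar>xs\<bar> ^ 5 + \<bar>xs\<bar> ^ 3 + \<bar>xs\<bar>)"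
      using S(3)[OF xsS] by linarith
    finally have up: "scaled_action t q g z \<le> cusp_V l h xs + C * k * (\<bar>xs\<bar> ^ 5 + \<bar>xs\<bar> ^ 3 + \<bar>xs\<bar>)" .
    have "C * k * (\<bar>xs\<bar> ^ 5 + \<bar>xs\<bar> ^ 3 + \<bar>xs\<bar>) \<le> C * 1 * (\<bar>xs\<bar> ^ 5 + \<bar>xs\<bar> ^ 3 + \<bar>xs\<bar>)"
      using k C by (intro mult_right_mono mult_left_mono) auto
    then have upU: "scaled_action t q g z \<le> U" using up by (simp add: U_def)
    obtain x where x: "x \<in> S" "z = \<phi> x" using z S(1) by blast
    have "x ^ 4 / 4 - K \<le> U" using S(4)[OF x(1)] upU x(2) by simp
    then have "x ^ 4 \<le> 4 * (U + K)" by (simp add: field_simps)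
    moreover have "\<bar>x\<bar> ^ 1 \<le> 1 + \<bar>x\<bar> ^ 4" by (rule power_le_one_plus_power) auto
    ultimately have xX: "\<bar>x\<bar> \<le> X" unfolding X_def by simp
    have "C * k * (\<bar>x\<bar> ^ 5 + \<bar>x\<bar> ^ 3 + \<bar>x\<bar>) \<le> C * k * (X ^ 5 + X ^ 3 + X)"
      using xX C k by (intro mult_left_mono add_mono power_mono) auto
    then have "scaled_action t q g z \<ge> cusp_V l h xs - C * k * (X ^ 5 + X ^ 3 + X)"
      using S(3)[OF x(1)] xs[of x] unfolding x(2) by linarith
    moreover have "C * k * (X ^ 5 + X ^ 3 + X) \<ge> 0" "C * k * (\<bar>xs\<bar> ^ 5 + \<bar>xs\<bar> ^ 3 + \<bar>xs\<bar>) \<ge> 0" using C k X by auto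
    ultimately have "\<bar>scaled_action t q g z - cusp_V l h xs\<bar>
        \<le> C * k * (X ^ 5 + X ^ 3 + X) + C * k * (\<bar>xs\<bar> ^ 5 + \<bar>xs\<bar> ^ 3 + \<bar>xs\<bar>)"
      using up by linarith
    also have "\<dots> = B * kscale g" by (simp add: B_def k_def algebra_simps)
    finally show ?thesis .
  qed
  moreover have "B \<ge> 0" using C X by (simp add: B_def)
  ultimately show ?thesis using e that by blast
qed

text \<open>Away from the saddle the action exceeds its critical value, so that part of the branch
  contributes \<open>exp (- const / g)\<close>, negligible against the \<open>kscale g\<^sup>2\<close> tolerated here.\<close>

lemma branch_integral:
  assumes curve: "scaling_curve M l h T Q" and G: "exp_tame G" "\<And>p. p \<ge> 0 \<Longrightarrow> \<bar>G p\<bar> \<le> exp (- p / 2)"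
    and r: "r > 0" and V: "\<forall>x. cusp_V l h x \<ge> x ^ 4 / 4 - K" and C: "C \<ge> 0" "\<eta> > 0"
    and sc: "\<forall>\<^sub>F g in at_right 0. saddle_scaling (zcrit M - r) (zcrit M + r) l h C K \<eta> (T g) (Q g) g"
    and mu: "\<mu> > 0" "\<forall>\<^sub>F (t, q) in nhds (crit M). \<mu> \<le> mu0 M \<rho> t q"
    and sub: "\<forall>\<^sub>F (t, q) in nhds (crit M). {zcrit M - r<..<zcrit M + r} \<subseteq> branch M t q"
    and glob: "cusp_global M" "density_tail M \<rho>"
  obtains B where "B \<ge> 0"
    "\<forall>\<^sub>F g in at_right 0. integral_close l h G B (branch M (T g) (Q g)) (T g) (Q g) g"
proof -
  let ?ac = "action M (zcrit M) (taucrit M) (qcrit M)"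
  let ?I = "{zcrit M - r<..<zcrit M + r}"
  obtain B where B0: "B \<ge> 0" and B: "\<And>a b t q g. 0 < g \<Longrightarrow> kscale g \<le> 1 \<Longrightarrow> mu0 M \<rho> t q > 0 \<Longrightarrow> saddle_scaling a b l h C K \<eta> t q g \<Longrightarrow>
      integral_close l h G B {a<..<b} t q g"
    by (rule saddle_integral[OF G(1) C(2) V C(1)]) (rule that)
  from glob(1) r obtain d where d: "d > 0" and far: "\<forall>\<^sub>F (\<tau>, q) in nhds (crit M). \<forall>z\<in>branch M \<tau> q.
        \<bar>z - zcrit M\<bar> \<ge> r \<longrightarrow> action M z \<tau> q \<ge> ?ac + d"
    unfolding cusp_global_def by meson
  from glob(1) have reg: "\<forall>\<^sub>F (\<tau>, q) in nhds (crit M).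
        open (branch M \<tau> q) \<and> continuous_on (branch M \<tau> q) (\<lambda>z. action M z \<tau> q)"
    unfolding cusp_global_def by blast
  from glob(2) obtain g1 Ct where g1: "g1 > 0" and "\<forall>\<^sub>F ((\<tau>, q), g) in nhds (crit M) \<times>\<^sub>F at_right 0.
        set_integrable lborel (branch M \<tau> q) (\<lambda>z. \<rho> z \<tau> q g * exp (- action M z \<tau> q / g1)) \<and>
        (LINT z:branch M \<tau> q|lborel. \<rho> z \<tau> q g * exp (- action M z \<tau> q / g1)) \<le> Ct"
    unfolding density_tail_def by blast
  moreover have "filterlim (\<lambda>g. ((T g, Q g), g)) (nhds (crit M) \<times>\<^sub>F at_right 0) (at_right 0)"
    using curve by (intro filterlim_Pair) (auto simp: scaling_curve_def filterlim_ident)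
  ultimately have tail: "\<forall>\<^sub>F g in at_right 0.
        set_integrable lborel (branch M (T g) (Q g)) (\<lambda>z. \<rho> z (T g) (Q g) g * exp (- action M z (T g) (Q g) / g1)) \<and>
        (LINT z:branch M (T g) (Q g)|lborel. \<rho> z (T g) (Q g) g * exp (- action M z (T g) (Q g) / g1)) \<le> Ct"
    by (drule_tac eventually_compose_filterlim) (assumption, simp)
  define c where "c = \<bar>Ct\<bar> * exp ((\<bar>?ac\<bar> + d / 2) / g1 + d / 2 / g1) * (4 * coef4 M / d) / \<mu>"
  have c0: "c \<ge> 0" using d coef_pos mu by (simp add: c_def)
  have "d / 2 > 0" using d by simp
  have ev_g: "\<forall>\<^sub>F g in at_right 0. g \<in> {0<..<g1 / 2}" by (rule eventually_at_right_real) (use g1 in simp)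
  have main: "\<forall>\<^sub>F g in at_right 0. integral_close l h G (B + c) (branch M (T g) (Q g)) (T g) (Q g) g"
    using curve_eventually[OF curve far] curve_eventually[OF curve reg] tail ev_g
      eventually_kscale_less[OF zero_less_one] curve_eventually[OF curve mu(2)]
      curve_eventually[OF curve eventually_action_near_crit[OF \<open>d / 2 > 0\<close>]] curve_eventually[OF curve sub] sc
  proof eventually_elim
    case (elim g)
    define t q k where "t = T g" and "q = Q g" and "k = kscale g"
    note e = elim[folded t_def q_def k_def]
    have g: "0 < g" "2 * g \<le> g1" and k: "0 < k" "k < 1" using e by auto
    have m: "\<mu> \<le> mu0 M \<rho> t q" "mu0 M \<rho> t q > 0" using e(6) mu(1) by linarith+
    let ?Br = "branch M t q" and ?f = "\<lambda>z. \<rho> z t q g * G (scaled_action t q g z)"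
    have I: "set_integrable lborel ?I ?f"
      "\<bar>(LINT z:?I|lborel. ?f z) / (mu0 M \<rho> t q * k) - (LINT x|lborel. G (cusp_V l h x))\<bar> \<le> B * k"
      using B[OF g(1) _ m(2) e(9)] k by (auto simp: k_def integral_close_def)
    have Gc: "continuous_on UNIV G" by (rule conjunct1[OF G(1)[unfolded exp_tame_def]])
    \<comment> \<open>Half of the gap \<open>d\<close> pays for the distance of
      \<open>action0\<close> from the critical action; the other half remains as the gap above
      \<open>action0\<close>.\<close>
    have far': "action M z t q \<ge> action0 M t q + d / 2" if z: "z \<in> ?Br - ?I" for z
    proof -
      have "\<bar>z - zcrit M\<bar> \<ge> r" using z by auto
      then have "action M z t q \<ge> ?ac + d" using e(1) z by blast
      then show ?thesis using e(7) by linarith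
    qed
    have \<rho>: "\<rho> z t q g \<ge> 0" if "z \<in> ?Br" for z
      using dens that g(1) unfolding density_near_saddle_def by blast
    have D: "set_integrable lborel (?Br - ?I) ?f"
      "\<bar>LINT z:?Br - ?I|lborel. ?f z\<bar> \<le> Ct * exp (action0 M t q / g1 + d / 2 / g1) * exp (- (d / 2 / (2 * g)))"
      using outer_integral[of ?Br "\<lambda>z. action M z t q" ?I "\<lambda>z. \<rho> z t q g" g1 Ct "action0 M t q" "d / 2" g G] e(2,3) \<rho> far' d g G(2) Gc
      unfolding scaled_action_def by auto
    have Br: "?I \<union> (?Br - ?I) = ?Br" using e(8) by auto
    have int: "set_integrable lborel ?Br ?f"
      using set_integrable_Un[OF I(1) D(1)] e(2) unfolding Br by auto
    have split: "(LINT z:?Br|lborel. ?f z) = (LINT z:?I|lborel. ?f z) + (LINT z:?Br - ?I|lborel. ?f z)"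
      using set_integral_Un[OF _ I(1) D(1)] unfolding Br by auto
    \<comment> \<open>exp(- y) \<le> 1/y with y = d / (4 g) gives order k^4. Two powers suffice: one
      is consumed by the division by mu0 k, the other is the error.\<close>
    have small: "exp (- (d / 2 / (2 * g))) \<le> 4 * coef4 M / d * k\<^sup>2"
    proof -
      define y where "y = d / (4 * g)"
      have y: "y > 0" using d g by (simp add: y_def)
      have "y \<le> exp y" using exp_ge_add_one_self[of y] by linarith
      then have "exp (- y) \<le> 1 / y" using y by (simp add: exp_minus field_simps)
      also have "1 / y = 4 * coef4 M / d * k ^ 4" using kscale_power4[OF g(1)] d g by (simp add: y_def k_def)
      also have "\<dots> \<le> 4 * coef4 M / d * k\<^sup>2" using k coef_pos d by (intro mult_left_mono power_decreasing) auto
      finally show ?thesis by (simp add: y_def)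
    qed
    have "\<bar>LINT z:?Br - ?I|lborel. ?f z\<bar> \<le> \<bar>Ct\<bar> * exp ((\<bar>?ac\<bar> + d / 2) / g1 + d / 2 / g1) * (4 * coef4 M / d * k\<^sup>2)"
    proof (rule order_trans[OF D(2)], intro mult_mono small)
      have "action0 M t q \<le> \<bar>?ac\<bar> + d / 2" using e(7) by linarith
      then show "exp (action0 M t q / g1 + d / 2 / g1) \<le> exp ((\<bar>?ac\<bar> + d / 2) / g1 + d / 2 / g1)"
        using g1 by (simp add: divide_right_mono)
    qed auto
    also have "\<dots> = c * k * (\<mu> * k)" using mu(1) by (simp add: c_def power2_eq_square)
    also have "\<dots> \<le> c * k * (mu0 M \<rho> t q * k)" using c0 k m by (intro mult_left_mono mult_right_mono) auto
    finally have "\<bar>LINT z:?Br - ?I|lborel. ?f z\<bar> / (mu0 M \<rho> t q * k) \<le> c * k"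
      using m k by (simp add: divide_le_eq)
    then have "\<bar>(LINT z:?Br - ?I|lborel. ?f z) / (mu0 M \<rho> t q * k)\<bar> \<le> c * k" using m k by (simp add: abs_divide)
    with I(2) have "\<bar>(LINT z:?Br|lborel. ?f z) / (mu0 M \<rho> t q * k) - (LINT x|lborel. G (cusp_V l h x))\<bar> \<le> (B + c) * k"
      unfolding split add_divide_distrib distrib_right by linarith
    with int show ?case unfolding integral_close_def t_def q_def k_def by blast
  qed
  show ?thesis by (rule that[OF _ main]) (use B0 c0 in simp)
qed

text \<open>Both free energies carry the same shift a = action0 / g, so their difference over
  \<open>T_E\<close> is the ratio of the two scaled integrals minus the scaled minimum;
  \<open>ratio_perturbation\<close> and \<open>scaled_minimum\<close> control these two.\<close>

theorem free_energy_crossover_saddle: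
  assumes glob: "cusp_global M" "density_tail M \<rho>"
  shows "free_energy_crossover M \<rho>"
proof -
  obtain r0 \<mu> where r0: "r0 > 0" and \<mu>: "\<mu> > 0"
    and mu: "\<forall>\<^sub>F (t, q) in nhds (crit M). \<mu> \<le> mu0 M \<rho> t q"
    and sc: "\<And>a b l h T Q. zcrit M - r0 < a \<Longrightarrow> a < zcrit M \<Longrightarrow> zcrit M < b \<Longrightarrow> b < zcrit M + r0 \<Longrightarrow>
      scaling_curve M l h T Q \<Longrightarrow>
      \<exists>C\<ge>0. \<exists>K. \<exists>\<eta>>0. (\<forall>x. cusp_V l h x \<ge> x ^ 4 / 4 - K) \<and>
        (\<forall>\<^sub>F g in at_right 0. saddle_scaling a b l h C K \<eta> (T g) (Q g) g)"
    by (rule saddle_chart) (rule that)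
  from loc obtain rb where rb: "rb > 0" "\<forall>\<^sub>F (t, q) in nhds (crit M). ball (zcrit M) rb \<subseteq> branch M t q"
    unfolding cusp_local_def by blast
  define r where "r = min r0 rb / 2"
  have r: "r > 0" "r < r0" "r < rb" using r0 rb(1) by (auto simp: r_def)
  have sub: "\<forall>\<^sub>F (t, q) in nhds (crit M). {zcrit M - r..zcrit M + r} \<subseteq> branch M t q"
    using rb(2) by eventually_elim (use r in \<open>force simp: subset_iff dist_real_def\<close>)
  have sub': "\<forall>\<^sub>F (t, q) in nhds (crit M). {zcrit M - r<..<zcrit M + r} \<subseteq> branch M t q"
    using sub by eventually_elim (force simp: subset_iff)
  let ?ac = "action M (zcrit M) (taucrit M) (qcrit M)"
  from glob(1) r(1) obtain d where d: "d > 0" and far: "\<forall>\<^sub>F (\<tau>, q) in nhds (crit M). \<forall>z\<in>branch M \<tau> q.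
        \<bar>z - zcrit M\<bar> \<ge> r \<longrightarrow> action M z \<tau> q \<ge> ?ac + d"
    unfolding cusp_global_def by meson
  from glob(1) have reg: "\<forall>\<^sub>F (\<tau>, q) in nhds (crit M).
        open (branch M \<tau> q) \<and> continuous_on (branch M \<tau> q) (\<lambda>z. action M z \<tau> q)"
    and tc: "taucrit M > 0"
    unfolding cusp_global_def by blast+
  show ?thesis
    unfolding free_energy_crossover_def
  proof (intro allI impI)
    fix Len l h T Q xs
    assume Len: "(Len::real) > 0"
      and "scaling_curve M l h T Q \<and> (\<forall>x. x \<noteq> xs \<longrightarrow> cusp_V l h xs < cusp_V l h x)"
    then have curve: "scaling_curve M l h T Q" and xs: "\<And>x. x \<noteq> xs \<Longrightarrow> cusp_V l h xs < cusp_V l h x" by auto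
    obtain C K \<eta> where C: "C \<ge> 0" "\<eta> > 0" and V: "\<forall>x. cusp_V l h x \<ge> x ^ 4 / 4 - K"
      and ev: "\<forall>\<^sub>F g in at_right 0. saddle_scaling (zcrit M - r) (zcrit M + r) l h C K \<eta> (T g) (Q g) g"
      using sc[OF _ _ _ _ curve, of "zcrit M - r" "zcrit M + r"] r by auto
    have xs': "cusp_V l h xs \<le> cusp_V l h x" for x using xs[of x] by (cases "x = xs") auto
    note Z = cusp_Z_pos[of l h]
    let ?Y = "LINT x|lborel. cusp_V l h x * exp (- cusp_V l h x)"
    have half: "\<bar>exp (- p)\<bar> \<le> exp (- p / 2)" if "p \<ge> 0" for p :: real using that by simp
    obtain B0 where B0: "B0 \<ge> 0" "\<forall>\<^sub>F g in at_right 0.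
      integral_close l h (\<lambda>s. exp (- s)) B0 (branch M (T g) (Q g)) (T g) (Q g) g"
      by (rule branch_integral[OF curve exp_tame_exp half r(1) V C ev \<mu> mu sub' glob]) (assumption, rule that)
    obtain B1 where B1: "B1 \<ge> 0" "\<forall>\<^sub>F g in at_right 0.
      integral_close l h (\<lambda>s. s * exp (- s)) B1 (branch M (T g) (Q g)) (T g) (Q g) g"
      by (rule branch_integral[OF curve exp_tame_mult_exp mult_exp_le_exp_half r(1) V C ev \<mu> mu sub' glob]) (assumption, rule that)
    obtain B2 e where B2: "B2 \<ge> 0" "e > 0" and min: "\<And>a b t q g z. 0 < g \<Longrightarrow> kscale g < e \<Longrightarrow>
        saddle_scaling a b l h C K \<eta> t q g \<Longrightarrow> z \<in> {a<..<b} \<Longrightarrow>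
      (\<And>z'. z' \<in> {a<..<b} \<Longrightarrow> action M z t q \<le> action M z' t q) \<Longrightarrow>
      \<bar>scaled_action t q g z - cusp_V l h xs\<bar> \<le> B2 * kscale g"
    proof (rule scaled_minimum[OF V C xs'])
      fix B2 e :: real
      assume "0 \<le> B2" "0 < e" "\<And>a b t q g z. 0 < g \<Longrightarrow> kscale g < e \<Longrightarrow>
        saddle_scaling a b l h C K \<eta> t q g \<Longrightarrow> z \<in> {a<..<b} \<Longrightarrow>
        (\<And>z'. z' \<in> {a<..<b} \<Longrightarrow> action M z t q \<le> action M z' t q) \<Longrightarrow>
        \<bar>scaled_action t q g z - cusp_V l h xs\<bar> \<le> B2 * kscale g"
      then show thesis by (rule that)
    qed
    define D where "D = 2 / cusp_Z l h * (1 + \<bar>?Y\<bar> / cusp_Z l h) * (B0 + B1) + B2"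
    \<comment> \<open>The second bound keeps the error (B0 + B1) k of the denominator below half of
      \<open>cusp_Z\<close>.\<close>
    have "min e (cusp_Z l h / (2 * (B0 + B1 + 1))) > 0" using Z B0 B1 B2 by simp
    note ev_k = eventually_kscale_less[OF this]
    have "\<forall>\<^sub>F (t, q) in nhds (crit M). t > 0"
    proof -
      have "(fst \<longlongrightarrow> fst (crit M)) (nhds (crit M))" by (intro tendsto_intros filterlim_ident)
      from order_tendstoD(1)[OF this, of 0] tc show ?thesis by (simp add: case_prod_unfold)
    qed
    note ev_T = curve_eventually[OF curve this]
    let ?well_defined = "\<lambda>g. (\<exists>z. is_arg_min (F_gen M Len (T g) (Q g) g) (\<lambda>z. z \<in> branch M (T g) (Q g)) z) \<and>
          set_integrable lborel (branch M (T g) (Q g))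
            (\<lambda>z. \<rho> z (T g) (Q g) g * exp (- action M z (T g) (Q g) / g)) \<and>
          set_integrable lborel (branch M (T g) (Q g))
            (\<lambda>z. F_gen M Len (T g) (Q g) g z
                 * (\<rho> z (T g) (Q g) g * exp (- action M z (T g) (Q g) / g)))"
    let ?error = "\<lambda>g. (F_bar M \<rho> Len (T g) (Q g) g - F_cl M Len (T g) (Q g) g) / T_E Len (T g)
             - (cusp_mean_V l h - cusp_V l h xs)"
    have main: "\<forall>\<^sub>F g in at_right 0. ?well_defined g \<and> \<bar>?error g\<bar> \<le> D * kscale g"
      using curve_eventually[OF curve far] curve_eventually[OF curve reg] ev_k ev_T B0(2) B1(2)
        curve_eventually[OF curve mu]
        curve_eventually[OF curve eventually_action_near_crit[OF d]] curve_eventually[OF curve sub] ev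
    proof eventually_elim
      case (elim g)
      define t q k where "t = T g" and "q = Q g" and "k = kscale g"
      note e = elim[folded t_def q_def k_def]
      have g: "0 < g" and k: "0 < k" "k < e" "k < cusp_Z l h / (2 * (B0 + B1 + 1))" using e(3) by auto
      have m: "mu0 M \<rho> t q > 0" using e(7) \<mu> by linarith
      let ?Br = "branch M t q" and ?p = "scaled_action t q g"
      define a where "a = action0 M t q / g"
      have act: "action M z t q / g = a + ?p z" for z
        by (simp add: a_def scaled_action_def diff_divide_distrib)
      have TE: "T_E Len t > 0" using e(4) Len by (simp add: T_E_def)
      obtain zm where zm: "zm \<in> {zcrit M - r<..<zcrit M + r}" "zm \<in> ?Br"
        "\<And>z'. z' \<in> ?Br \<Longrightarrow> action M zm t q \<le> action M z' t q"
      proof (rule branch_minimum[of t q r])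
        fix z assume "z \<in> ?Br" "\<bar>z - zcrit M\<bar> \<ge> r"
        then have "action M z t q \<ge> ?ac + d" using e(1) by blast
        then show "action M (zcrit M) t q < action M z t q" using e(8) by linarith
      qed (use e(2,9) r in auto)
      have argmin: "is_arg_min (F_gen M Len t q g) (\<lambda>z. z \<in> ?Br) zm"
        unfolding is_arg_min_linorder F_gen_def using zm(2,3) TE g
        by (auto intro!: mult_left_mono divide_right_mono)
      \<comment> \<open>\<open>arg_min_on\<close> picks some minimiser, possibly different from
        \<open>zm\<close>; only the common minimal value enters \<open>F_cl\<close>.\<close>
      then have "is_arg_min (F_gen M Len t q g) (\<lambda>z. z \<in> ?Br) (arg_min_on (F_gen M Len t q g) ?Br)"
        unfolding arg_min_on_def arg_min_def by (rule someI)
      then have "F_cl M Len t q g = F_gen M Len t q g zm"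
        using argmin unfolding F_cl_def is_arg_min_linorder by (intro antisym) auto
      then have Fcl: "F_cl M Len t q g = T_E Len t * (a + ?p zm)" by (simp add: F_gen_def act)
      have pm: "\<bar>?p zm - cusp_V l h xs\<bar> \<le> B2 * k"
        unfolding k_def
        by (rule min[OF g _ e(10) zm(1)]) (use k e(9) zm(3) in \<open>auto simp: k_def subset_iff\<close>)
      let ?w = "\<lambda>z. \<rho> z t q g * exp (- ?p z)" and ?v = "\<lambda>z. \<rho> z t q g * (?p z * exp (- ?p z))"
      define X0 X1 where "X0 = (LINT z:?Br|lborel. ?w z)" and "X1 = (LINT z:?Br|lborel. ?v z)"
      have w: "set_integrable lborel ?Br ?w" "\<bar>X0 / (mu0 M \<rho> t q * k) - cusp_Z l h\<bar> \<le> B0 * k"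
        using e(5) by (auto simp: integral_close_def k_def X0_def cusp_Z_def)
      have v: "set_integrable lborel ?Br ?v" "\<bar>X1 / (mu0 M \<rho> t q * k) - ?Y\<bar> \<le> B1 * k"
        using e(6) by (auto simp: integral_close_def k_def X1_def)
      have weight: "\<rho> z t q g * exp (- action M z t q / g) = exp (- a) * ?w z" for z
      proof -
        have "exp (- action M z t q / g) = exp (- a) * exp (- ?p z)" using act[of z] by (simp flip: exp_add)
        then show ?thesis by simp
      qed
      \<comment> \<open>The numerator is split into the shift \<open>a\<close> times the weight and
        the scaled action times the weight, the two integrands covered by
        \<open>branch_integral\<close>.\<close>
      have wF: "F_gen M Len t q g z * (\<rho> z t q g * exp (- action M z t q / g))
          = (T_E Len t * exp (- a)) * (a * ?w z + ?v z)" for z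
        unfolding weight F_gen_def act by (simp add: algebra_simps)
      have i1: "set_integrable lborel ?Br (\<lambda>z. \<rho> z t q g * exp (- action M z t q / g))"
        unfolding weight using w(1) by (rule set_integrable_mult_right[rotated])
      have iv: "set_integrable lborel ?Br (\<lambda>z. a * ?w z + ?v z)"
        by (intro set_integral_add(1) set_integrable_mult_right w(1) v(1))
      have i2: "set_integrable lborel ?Br (\<lambda>z. F_gen M Len t q g z * (\<rho> z t q g * exp (- action M z t q / g)))"
        unfolding wF using iv by (rule set_integrable_mult_right[rotated])
      have eps: "(B0 + B1) * k \<le> cusp_Z l h / 2"
      proof -
        have "(B0 + B1) * k \<le> (B0 + B1 + 1) * k" using k by simp
        also have "\<dots> \<le> cusp_Z l h / 2" using k(3) B0 B1 by (simp add: field_simps)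
        finally show ?thesis .
      qed
      have X0: "\<bar>X0 / (mu0 M \<rho> t q * k) - cusp_Z l h\<bar> \<le> (B0 + B1) * k"
        by (rule order_trans[OF w(2)]) (use B1 k in simp)
      have X1: "\<bar>X1 / (mu0 M \<rho> t q * k) - ?Y\<bar> \<le> (B0 + B1) * k"
        by (rule order_trans[OF v(2)]) (use B0 k in simp)
      have "X0 / (mu0 M \<rho> t q * k) > 0" using X0 eps Z by linarith
      then have X0nz: "X0 \<noteq> 0" by auto
      have ratio: "\<bar>X1 / X0 - cusp_mean_V l h\<bar> \<le> 2 / cusp_Z l h * (1 + \<bar>?Y\<bar> / cusp_Z l h) * ((B0 + B1) * k)"
        using ratio_perturbation[OF Z X1 X0 eps] m k by (simp add: cusp_mean_V_def)
      have sum: "(LINT z:?Br|lborel. a * ?w z + ?v z) = a * X0 + X1"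
        unfolding X0_def X1_def using set_integral_add(2)[OF set_integrable_mult_right[OF w(1)] v(1)] by simp
      have num: "(LINT z:?Br|lborel. F_gen M Len t q g z * (\<rho> z t q g * exp (- action M z t q / g)))
          = (T_E Len t * exp (- a)) * (a * X0 + X1)"
        by (simp only: wF set_integral_mult_right sum)
      have den: "(LINT z:?Br|lborel. \<rho> z t q g * exp (- action M z t q / g)) = exp (- a) * X0"
        by (simp only: weight set_integral_mult_right X0_def)
      have Fbar: "F_bar M \<rho> Len t q g = T_E Len t * (a + X1 / X0)"
        unfolding F_bar_def num den using X0nz by (simp add: field_simps)
      have "(F_bar M \<rho> Len t q g - F_cl M Len t q g) / T_E Len t = X1 / X0 - ?p zm"
        unfolding Fbar Fcl using TE by (simp flip: right_diff_distrib)
      moreover have "\<bar>X1 / X0 - ?p zm - (cusp_mean_V l h - cusp_V l h xs)\<bar> \<le> D * k"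
        using ratio pm unfolding D_def distrib_right mult.assoc by linarith
      ultimately show ?case
        using argmin i1 i2 unfolding t_def[symmetric] q_def[symmetric] k_def[symmetric] by auto
    qed
    then have "\<forall>\<^sub>F g in at_right 0. ?well_defined g" and fin: "\<forall>\<^sub>F g in at_right 0. \<bar>?error g\<bar> \<le> D * kscale g"
      unfolding eventually_conj_iff by blast+
    then show "(\<forall>\<^sub>F g in at_right 0. ?well_defined g) \<and> ?error \<in> O[at_right 0](\<lambda>g. g powr (1/4))"
      using kscale_bigoI[OF fin] by blast
  qed
qed

end

section \<open>The RN-AdS model\<close>

lemma rn_zc_sq: "rn_zc\<^sup>2 = 1 / 6" "rn_zc > 0"
  by (simp_all add: rn_zc_def power_divide)

lemma sqrt_qc: "sqrt rn_qc = rn_zc"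
  by (simp add: rn_qc_def rn_zc_def real_sqrt_divide)

lemma rn_tauc_pos: "rn_tauc > 0"
  by (simp add: rn_tauc_def)

lemma inverse_rn_tauc: "1 / rn_tauc = pi * sqrt 6 / 2"
  by (simp add: rn_tauc_def field_simps)

lemma control_components:
  "\<bar>t - t0\<bar> \<le> control_size t0 q0 t q" "\<bar>q - q0\<bar> \<le> control_size t0 q0 t q"
  using norm_fst_le[of "t - t0" "q - q0"] norm_snd_le[of "q - q0" "t - t0"] by (simp_all add: control_size_def)

lemma sqrt_lipschitz_at:
  assumes "c > 0" "q \<ge> 0" shows "\<bar>sqrt q - sqrt c\<bar> \<le> \<bar>q - c\<bar> / sqrt c"
proof -
  have "(sqrt q - sqrt c) * (sqrt q + sqrt c) = q - c" using assms by (simp add: algebra_simps)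
  then have "\<bar>q - c\<bar> = \<bar>sqrt q - sqrt c\<bar> * (sqrt q + sqrt c)" using assms by (metis abs_mult abs_of_nonneg add_nonneg_nonneg real_sqrt_ge_zero less_imp_le)
  also have "\<dots> \<ge> \<bar>sqrt q - sqrt c\<bar> * sqrt c" using assms by (intro mult_left_mono) auto
  finally show ?thesis using assms by (simp add: pos_le_divide_eq)
qed

lemma rn_shift_bound:
  assumes "q \<ge> 0" shows "\<bar>rn_shift t q\<bar> \<le> 3 * control_size rn_tauc rn_qc t q"
proof -
  have "\<bar>rn_shift t q\<bar> \<le> \<bar>q - rn_qc\<bar> / rn_zc"
    using sqrt_lipschitz_at[of rn_qc q] assms by (simp add: rn_shift_def sqrt_qc) (simp add: rn_qc_def)
  also have "\<dots> = sqrt 6 * \<bar>q - rn_qc\<bar>" by (simp add: rn_zc_def)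
  also have "\<dots> \<le> 3 * control_size rn_tauc rn_qc t q"
    using control_components(2)[of q rn_qc rn_tauc t] by (intro mult_mono real_le_lsqrt) auto
  finally show ?thesis .
qed

lemma rn_shift_bigo:
  "(\<lambda>(\<tau>, q). rn_shift \<tau> q) \<in> O[nhds (rn_tauc, rn_qc)](\<lambda>(\<tau>, q). control_size rn_tauc rn_qc \<tau> q)"
proof (rule bigoI[of _ 3])
  \<comment> \<open>Within 1/6 of \<open>rn_qc\<close> the charge stays nonnegative, as
    \<open>rn_shift_bound\<close> requires.\<close>
  have "\<forall>\<^sub>F (t, q) in nhds (rn_tauc, rn_qc). control_size rn_tauc rn_qc t q < 1 / 6"
    unfolding eventually_nhds_controls by (intro exI[of _ "1 / 6"]) auto
  then show "\<forall>\<^sub>F p in nhds (rn_tauc, rn_qc). norm (case p of (\<tau>, q) \<Rightarrow> rn_shift \<tau> q)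
      \<le> 3 * norm (case p of (\<tau>, q) \<Rightarrow> control_size rn_tauc rn_qc \<tau> q)"
  proof eventually_elim
    case (elim p)
    obtain t q where p: "p = (t, q)" by fastforce
    have "q \<ge> 0" using elim control_components(2)[of q rn_qc rn_tauc t] by (simp add: p rn_qc_def)
    from rn_shift_bound[OF this, of t] show ?case by (simp add: p)
  qed
qed

text \<open>The value of \<open>deriv\<close> at a point depends on nearby values, so each
  intermediate identity is proved on the whole open set before the next derivative is taken.\<close>

lemma deriv_funpow3:
  fixes f :: "real \<Rightarrow> real"
  assumes "open U" "x \<in> U" "\<And>y. y \<in> U \<Longrightarrow> (f has_real_derivative f1 y) (at y)"
    "\<And>y. y \<in> U \<Longrightarrow> (f1 has_real_derivative f2 y) (at y)"
    "\<And>y. y \<in> U \<Longrightarrow> (f2 has_real_derivative f3 y) (at y)"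
  shows "(deriv ^^ 3) f x = f3 x"
proof -
  have step: "deriv a y = b' y" if "\<And>y. y \<in> U \<Longrightarrow> a y = b y" "\<And>y. y \<in> U \<Longrightarrow> (b has_real_derivative b' y) (at y)" "y \<in> U"
    for a b b' :: "real \<Rightarrow> real" and y
  proof -
    have "\<forall>\<^sub>F y in nhds y. a y = b y" using eventually_nhds_in_open[OF assms(1) that(3)] by eventually_elim (rule that(1))
    then show ?thesis using deriv_cong_ev[of a b y y] DERIV_imp_deriv[OF that(2)[OF that(3)]] by simp
  qed
  have 1: "deriv f y = f1 y" if "y \<in> U" for y by (rule step[of f f]) (use assms that in auto)
  have 2: "deriv (deriv f) y = f2 y" if "y \<in> U" for y by (rule step[of _ f1]) (use assms 1 that in auto)
  have 3: "deriv (deriv (deriv f)) y = f3 y" if "y \<in> U" for y by (rule step[of _ f2]) (use assms 2 that in auto)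
  show ?thesis using 3[OF assms(2)] by (simp add: eval_nat_numeral)
qed

section \<open>The normal form of the RN-AdS action\<close>

lemma rn_chart_eq: "rn_chart y t q = sqrt q + y"
  by (simp add: rn_chart_def rn_shift_def)

lemma rn_action_derivatives:
  assumes "z > 0"
  shows "((\<lambda>z. rn_action z t q) has_real_derivative
      1 / (2 * t) * (1 + 3 * z\<^sup>2 - q\<^sup>2 / z\<^sup>2 - 4 * pi * t * z)) (at z)"
    "((\<lambda>z. 1 / (2 * t) * (1 + 3 * z\<^sup>2 - q\<^sup>2 / z\<^sup>2 - 4 * pi * t * z)) has_real_derivative
      1 / (2 * t) * (6 * z + 2 * q\<^sup>2 / z ^ 3 - 4 * pi * t)) (at z)"
    "((\<lambda>z. 1 / (2 * t) * (6 * z + 2 * q\<^sup>2 / z ^ 3 - 4 * pi * t)) has_real_derivative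
      1 / (2 * t) * (6 - 6 * q\<^sup>2 / z ^ 4)) (at z)"
proof -
  have "((\<lambda>z. z + z ^ 3 + q\<^sup>2 / z - 2 * pi * t * z\<^sup>2) has_real_derivative
      1 + 3 * z\<^sup>2 - q\<^sup>2 / z\<^sup>2 - 4 * pi * t * z) (at z)"
    using assms by (auto intro!: derivative_eq_intros simp: power2_eq_square)
  then show "((\<lambda>z. rn_action z t q) has_real_derivative
      1 / (2 * t) * (1 + 3 * z\<^sup>2 - q\<^sup>2 / z\<^sup>2 - 4 * pi * t * z)) (at z)"
    unfolding rn_action_def by (rule DERIV_cmult)
  have "((\<lambda>z. 1 + 3 * z\<^sup>2 - q\<^sup>2 / z\<^sup>2 - 4 * pi * t * z) has_real_derivative
      6 * z + 2 * q\<^sup>2 / z ^ 3 - 4 * pi * t) (at z)"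
    using assms by (auto intro!: derivative_eq_intros simp: power2_eq_square power3_eq_cube algebra_simps)
  then show "((\<lambda>z. 1 / (2 * t) * (1 + 3 * z\<^sup>2 - q\<^sup>2 / z\<^sup>2 - 4 * pi * t * z)) has_real_derivative
      1 / (2 * t) * (6 * z + 2 * q\<^sup>2 / z ^ 3 - 4 * pi * t)) (at z)"
    by (rule DERIV_cmult)
  have "((\<lambda>z. 6 * z + 2 * q\<^sup>2 / z ^ 3 - 4 * pi * t) has_real_derivative 6 - 6 * q\<^sup>2 / z ^ 4) (at z)"
    using assms by (auto intro!: derivative_eq_intros simp: power2_eq_square power3_eq_cube power4_eq_xxxx algebra_simps)
  then show "((\<lambda>z. 1 / (2 * t) * (6 * z + 2 * q\<^sup>2 / z ^ 3 - 4 * pi * t)) has_real_derivative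
      1 / (2 * t) * (6 - 6 * q\<^sup>2 / z ^ 4)) (at z)"
    by (rule DERIV_cmult)
qed

lemma DERIV_translate:
  fixes f :: "real \<Rightarrow> real"
  assumes "(f has_real_derivative D) (at (s + y))"
  shows "((\<lambda>y. f (s + y)) has_real_derivative D) (at y)"
  using assms DERIV_shift[of f D y s] by (simp add: add.commute)

lemma rn_third_derivative:
  assumes "q > 0"
  shows "(deriv ^^ 3) (\<lambda>y. rn_action (rn_chart y t q) t q) 0 = 0"
proof -
  let ?s = "sqrt q"
  have "(deriv ^^ 3) (\<lambda>y. rn_action (rn_chart y t q) t q) 0 = 1 / (2 * t) * (6 - 6 * q\<^sup>2 / (?s + 0) ^ 4)"
    unfolding rn_chart_eq
    by (rule deriv_funpow3[of "{- ?s<..}", OF _ _ DERIV_translate DERIV_translate DERIV_translate,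
          OF _ _ rn_action_derivatives])
      (use assms in auto)
  moreover have "?s ^ 4 = q\<^sup>2"
    using power_mult[of ?s 2 2] assms by simp
  ultimately show ?thesis using assms by simp
qed

text \<open>Since q = s^2, the charge term is s^4 / (s + y). Its cubic term - y^3 cancels the y^3 of
  z^3; the last geometric term y^4 / (s + y) is split into y^4 / s and an exact quintic
  remainder.\<close>

lemma rn_action_expansion:
  assumes "s > 0" "s + y > 0" "q = s\<^sup>2" "t > 0"
  shows "rn_action (s + y) t q - rn_action s t q =
    ((1 + 2 * q) / (2 * t) - 2 * pi * s) * y + (2 * s / t - pi) * y\<^sup>2 + 1 / (2 * t * s) * y ^ 4
      - y ^ 5 / (2 * t * s * (s + y))"
proof -
  have "q\<^sup>2 / (s + y) = s ^ 3 - s\<^sup>2 * y + s * y\<^sup>2 - y ^ 3 + y ^ 4 / s - y ^ 5 / (s * (s + y))"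
  proof -
    have "q\<^sup>2 = (s ^ 3 - s\<^sup>2 * y + s * y\<^sup>2 - y ^ 3) * (s + y) + y ^ 4" unfolding assms(3) by algebra
    then have "q\<^sup>2 / (s + y) = (s ^ 3 - s\<^sup>2 * y + s * y\<^sup>2 - y ^ 3) + y ^ 4 / (s + y)"
      using assms(2) by (simp only: add_divide_distrib) simp
    moreover have "y ^ 4 / (s + y) = y ^ 4 / s - y ^ 5 / (s * (s + y))"
    proof -
      have "y ^ 5 = y ^ 4 * (s + y) - y ^ 4 * s" by algebra
      then have "y ^ 5 / (s * (s + y)) = y ^ 4 * (s + y) / (s * (s + y)) - y ^ 4 * s / (s * (s + y))"
        by (simp only: diff_divide_distrib)
      then show ?thesis using assms(1,2) by simp
    qed
    ultimately show ?thesis by simp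
  qed
  moreover have "q\<^sup>2 / s = s ^ 3" using assms(1) unfolding assms(3) by (simp add: field_simps flip: power_mult power_Suc)
  ultimately have "rn_action (s + y) t q - rn_action s t q =
    1 / (2 * t) * ((s + y) + (s + y) ^ 3 + (s ^ 3 - s\<^sup>2 * y + s * y\<^sup>2 - y ^ 3 + y ^ 4 / s - y ^ 5 / (s * (s + y)))
      - 2 * pi * t * (s + y)\<^sup>2 - (s + s ^ 3 + s ^ 3 - 2 * pi * t * s\<^sup>2))"
    unfolding rn_action_def by (simp only: right_diff_distrib[symmetric])
  also have "\<dots> = 1 / (2 * t) * ((1 + 2 * s\<^sup>2 - 4 * pi * t * s) * y + (4 * s - 2 * pi * t) * y\<^sup>2 + y ^ 4 / s - y ^ 5 / (s * (s + y)))"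
    by (simp add: algebra_simps power2_eq_square power3_eq_cube)
  also have "\<dots> = ((1 + 2 * q) / (2 * t) - 2 * pi * s) * y + (2 * s / t - pi) * y\<^sup>2 + 1 / (2 * t * s) * y ^ 4
      - y ^ 5 / (2 * t * s * (s + y))"
  proof -
    define X Y where "X = y ^ 5 / (s * (s + y))" and "Y = y ^ 4 / s"
    have h: "y ^ 5 / (2 * t * s * (s + y)) = X / (2 * t)" "1 / (2 * t * s) * y ^ 4 = Y / (2 * t)"
      by (simp_all add: X_def Y_def mult_ac)
    then show ?thesis
      using assms(4) unfolding assms(3) h X_def[symmetric] Y_def[symmetric] by (simp add: field_simps)
  qed
  finally show ?thesis .
qed

text \<open>The exact coefficients at z = sqrt q differ from - w, u and 3 pi / 2 by orders d^2, d^2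
  and d in the control size d. For |y| \<le> 1 the errors d^2 y^2 and d y^4 are absorbed by d^2 |y|
  and d |y|^3.\<close>

lemma rn_normal_form:
  "(\<lambda>(y, \<tau>, q). rn_action (rn_chart y \<tau> q) \<tau> q
      - (rn_action (rn_chart 0 \<tau> q) \<tau> q - rn_w \<tau> q * y + rn_u \<tau> q * y\<^sup>2 + 3 * pi / 2 * y ^ 4))
    \<in> O[nhds (0, rn_tauc, rn_qc)](cusp_order rn_tauc rn_qc)"
proof -
  define C0 A1 where "C0 = 2 / rn_tauc ^ 3" and "A1 = 1 / rn_tauc\<^sup>2"
  define C1 where "C1 = 2 * C0 + A1 + 9 * pi * sqrt 6"
  define C2 where "C2 = 2 * C0 + 6 * A1 + 27 * pi"
  define C3 where "C3 = 4 * (1 + 3 * rn_tauc) / (rn_tauc\<^sup>2 * rn_zc)"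
  define C4 where "C4 = 32 / rn_tauc"
  have pos: "C0 \<ge> 0" "A1 \<ge> 0" "C1 \<ge> 0" "C2 \<ge> 0" "C3 \<ge> 0" "C4 \<ge> 0"
    using rn_tauc_pos rn_zc_sq(2) by (auto simp: C0_def A1_def C1_def C2_def C3_def C4_def)
  \<comment> \<open>With this radius q \<ge> 1/16, sqrt q lies in [1/4, 1], s + y \<ge> 1/8 and t
    \<ge> rn_tauc / 2, so every denominator below is bounded away from zero.\<close>
  define e where "e = min (1 / 16) (rn_tauc / 2)"
  have e: "e > 0" "e \<le> 1 / 16" "e \<le> rn_tauc / 2" using rn_tauc_pos by (auto simp: e_def)
  have main: "\<bar>rn_action (rn_chart y t q) t q
      - (rn_action (rn_chart 0 t q) t q - rn_w t q * y + rn_u t q * y\<^sup>2 + 3 * pi / 2 * y ^ 4)\<bar>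
      \<le> (C1 + C2 + C3 + C4) * cusp_order rn_tauc rn_qc (y, t, q)"
    if y: "\<bar>y\<bar> < e" and \<Delta>: "control_size rn_tauc rn_qc t q < e" for y t q
  proof -
    define d where "d = control_size rn_tauc rn_qc t q"
    define dt dq s \<delta> where "dt = t - rn_tauc" and "dq = q - rn_qc" and "s = sqrt q" and "\<delta> = sqrt q - rn_zc"
    have d: "d \<ge> 0" "\<bar>dt\<bar> \<le> d" "\<bar>dq\<bar> \<le> d" "d < e"
      using control_components[of t rn_tauc rn_qc q] control_components[of q rn_qc rn_tauc t] \<Delta>
      by (auto simp: d_def dt_def dq_def control_size_def)
    have q: "1 / 16 \<le> q" "q \<le> 1" using d e by (auto simp: dq_def rn_qc_def)
    have t: "rn_tauc / 2 \<le> t" "t > 0" using d e rn_tauc_pos by (auto simp: dt_def)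
    have s: "1 / 4 \<le> s" "s \<le> 1" "q = s\<^sup>2" using q real_sqrt_le_mono[of "1 / 16" q] by (auto simp: s_def real_sqrt_divide)
    have \<delta>: "\<bar>\<delta>\<bar> \<le> 3 * d" using rn_shift_bound[of q t] q by (simp add: rn_shift_def \<delta>_def d_def)
    have y': "\<bar>y\<bar> \<le> 1" "s + y \<ge> 1 / 8" using y e s by auto
    \<comment> \<open>The exact second-order remainder in the expansion of 1/t about 1 /
      rn_tauc.\<close>
    define et where "et = dt\<^sup>2 / (rn_tauc\<^sup>2 * t)"
    have et: "0 \<le> et" "et \<le> C0 * d\<^sup>2"
    proof -
      show "0 \<le> et" using t by (simp add: et_def)
      have "dt\<^sup>2 \<le> d\<^sup>2" using d by (simp add: abs_le_square_iff[symmetric])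
      then have "et \<le> d\<^sup>2 / (rn_tauc\<^sup>2 * (rn_tauc / 2))"
        unfolding et_def using t rn_tauc_pos by (intro frac_le mult_left_mono) auto
      also have "\<dots> = C0 * d\<^sup>2" by (simp add: C0_def power2_eq_square power3_eq_cube)
      finally show "et \<le> C0 * d\<^sup>2" .
    qed
    have inv_t: "1 / t = pi * sqrt 6 / 2 - A1 * dt + et"
    proof -
      have "1 / t = 1 / rn_tauc - dt / rn_tauc\<^sup>2 + dt\<^sup>2 / (rn_tauc\<^sup>2 * t)"
        using t rn_tauc_pos by (simp add: dt_def field_simps power2_eq_square)
      then show ?thesis by (simp add: inverse_rn_tauc A1_def et_def)
    qed
    have A1: "A1 = 3 * pi\<^sup>2 / 2"
    proof -
      have "A1 = (1 / rn_tauc)\<^sup>2" by (simp add: A1_def power_divide)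
      then show ?thesis unfolding inverse_rn_tauc by (simp add: power_mult_distrib power_divide)
    qed
    have s6: "sqrt 6 * sqrt 6 = (6::real)" by simp
    have zc: "rn_zc = sqrt 6 / 6" by (simp add: rn_zc_def field_simps)
    have s_eq: "s = sqrt 6 / 6 + \<delta>" by (simp add: s_def \<delta>_def zc)
    \<comment> \<open>The charge displacement in terms of the shift \<delta> of sqrt q; the linear
      parts so exhibited cancel in \<open>alpha\<close> and \<open>beta\<close>.\<close>
    have dq_eq: "dq = sqrt 6 / 3 * \<delta> + \<delta>\<^sup>2"
    proof -
      have "dq = (sqrt 6 / 6 + \<delta>)\<^sup>2 - 1 / 6" using s(3) s_eq by (simp add: dq_def rn_qc_def)
      also have "\<dots> = sqrt 6 / 3 * \<delta> + \<delta>\<^sup>2" by (simp add: power2_sum power_divide)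
      finally show ?thesis .
    qed
    have q_eq: "q = 1 / 6 + dq" by (simp add: dq_def rn_qc_def)
    \<comment> \<open>\<open>rn_w\<close> is minus the first-order part of the linear coefficient,
      so only products of two displacements remain on the right.\<close>
    have alpha: "(1 + 2 * q) / (2 * t) - 2 * pi * s + rn_w t q = (1 + 2 * q) / 2 * et - A1 * dt * dq + pi * sqrt 6 * \<delta>\<^sup>2"
    proof -
      have "(1 + 2 * q) / (2 * t) = (1 + 2 * q) / 2 * (1 / t)" by simp
      also have "\<dots> = (1 + 2 * q) / 2 * (pi * sqrt 6 / 2 - A1 * dt + et)" by (simp only: inv_t)
      finally have 1: "(1 + 2 * q) / (2 * t) = (1 + 2 * q) / 2 * (pi * sqrt 6 / 2 - A1 * dt) + (1 + 2 * q) / 2 * et"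
        by (simp add: distrib_left)
      have "(1 + 2 * q) / 2 * (pi * sqrt 6 / 2 - A1 * dt) - 2 * pi * s + (pi\<^sup>2 * dt + sqrt 6 * pi / 2 * dq)
          = pi * sqrt 6 * dq - 2 * pi * \<delta> - A1 * dt * dq"
        unfolding s_eq A1 q_eq by (simp add: field_simps)
      also have "\<dots> = pi * sqrt 6 * \<delta>\<^sup>2 - A1 * dt * dq"
      proof -
        have "pi * sqrt 6 * (sqrt 6 / 3 * \<delta> + \<delta>\<^sup>2) = pi * (sqrt 6 * sqrt 6) / 3 * \<delta> + pi * sqrt 6 * \<delta>\<^sup>2" by algebra
        then have "pi * sqrt 6 * dq = 2 * pi * \<delta> + pi * sqrt 6 * \<delta>\<^sup>2" unfolding dq_eq s6 by simp
        then show ?thesis by simp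
      qed
      finally show ?thesis using 1 by (simp add: rn_w_def dt_def dq_def)
    qed
    have beta: "2 * s / t - pi - rn_u t q = 2 * s * et - 2 * \<delta> * A1 * dt - 3 * pi * \<delta>\<^sup>2"
    proof -
      have "2 * s / t = 2 * s * (1 / t)" by simp
      also have "\<dots> = 2 * s * (pi * sqrt 6 / 2 - A1 * dt + et)" by (simp only: inv_t)
      finally have 1: "2 * s / t = 2 * s * (pi * sqrt 6 / 2 - A1 * dt) + 2 * s * et" by (simp add: distrib_left)
      have "2 * s * (pi * sqrt 6 / 2 - A1 * dt) = pi * (sqrt 6 * sqrt 6) / 6 + pi * sqrt 6 * \<delta>
          - sqrt 6 / 3 * A1 * dt - 2 * \<delta> * A1 * dt"
        unfolding s_eq by (simp add: field_simps)
      moreover have "3 * pi * dq = pi * sqrt 6 * \<delta> + 3 * pi * \<delta>\<^sup>2" unfolding dq_eq by (simp add: algebra_simps)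
      ultimately show ?thesis using 1 unfolding s6 by (simp add: rn_u_def dt_def[symmetric] dq_def[symmetric] A1)
    qed
    have dd: "\<bar>dt * dq\<bar> \<le> d\<^sup>2" "\<bar>\<delta>\<^sup>2\<bar> \<le> 9 * d\<^sup>2" "\<bar>\<delta> * dt\<bar> \<le> 3 * d\<^sup>2"
    proof -
      show "\<bar>dt * dq\<bar> \<le> d\<^sup>2" unfolding abs_mult power2_eq_square using d by (intro mult_mono) auto
      have "\<bar>\<delta>\<bar> * \<bar>\<delta>\<bar> \<le> (3 * d) * (3 * d)" using \<delta> d by (intro mult_mono) auto
      then show "\<bar>\<delta>\<^sup>2\<bar> \<le> 9 * d\<^sup>2" by (simp add: power2_eq_square abs_mult)
      have "\<bar>\<delta>\<bar> * \<bar>dt\<bar> \<le> (3 * d) * d" using \<delta> d by (intro mult_mono) auto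
      then show "\<bar>\<delta> * dt\<bar> \<le> 3 * d\<^sup>2" by (simp add: power2_eq_square abs_mult)
    qed
    have a_bd: "\<bar>(1 + 2 * q) / (2 * t) - 2 * pi * s + rn_w t q\<bar> \<le> C1 * d\<^sup>2"
    proof -
      have "\<bar>(1 + 2 * q) / 2 * et\<bar> \<le> 2 * (C0 * d\<^sup>2)" unfolding abs_mult using q et by (intro mult_mono) auto
      moreover have "\<bar>A1 * dt * dq\<bar> \<le> A1 * d\<^sup>2" using dd(1) pos(2) by (simp add: abs_mult mult.assoc mult_left_mono)
      moreover have "\<bar>pi * sqrt 6 * \<delta>\<^sup>2\<bar> \<le> pi * sqrt 6 * (9 * d\<^sup>2)" unfolding abs_mult using dd(2) by (intro mult_mono) auto
      moreover have "C1 * d\<^sup>2 = 2 * (C0 * d\<^sup>2) + A1 * d\<^sup>2 + pi * sqrt 6 * (9 * d\<^sup>2)" by (simp add: C1_def algebra_simps)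
      ultimately show ?thesis unfolding alpha by linarith
    qed
    have b_bd: "\<bar>2 * s / t - pi - rn_u t q\<bar> \<le> C2 * d\<^sup>2"
    proof -
      have "\<bar>2 * s * et\<bar> \<le> 2 * (C0 * d\<^sup>2)" unfolding abs_mult using s et by (intro mult_mono) auto
      moreover have "\<bar>2 * \<delta> * A1 * dt\<bar> \<le> 2 * A1 * (3 * d\<^sup>2)"
        using mult_left_mono[OF dd(3), of "2 * A1"] pos(2) by (simp add: abs_mult mult_ac)
      moreover have "\<bar>3 * pi * \<delta>\<^sup>2\<bar> \<le> 3 * pi * (9 * d\<^sup>2)" unfolding abs_mult using dd(2) by (intro mult_mono) auto
      moreover have "C2 * d\<^sup>2 = 2 * (C0 * d\<^sup>2) + 2 * A1 * (3 * d\<^sup>2) + 3 * pi * (9 * d\<^sup>2)" by (simp add: C2_def algebra_simps)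
      ultimately show ?thesis unfolding beta by linarith
    qed
    have c_bd: "\<bar>1 / (2 * t * s) - 3 * pi / 2\<bar> \<le> C3 * d"
    proof -
      \<comment> \<open>This value makes the exact quartic coefficient 1 / (2 t s) equal to 3 pi / 2
        at the critical controls.\<close>
      have "rn_tauc * rn_zc = 1 / (3 * pi)" by (simp add: rn_tauc_def rn_zc_def)
      then have c: "3 * pi / 2 = 1 / (2 * rn_tauc * rn_zc)" using rn_tauc_pos rn_zc_sq(2) by (simp add: field_simps)
      have num: "\<bar>rn_tauc * rn_zc - t * s\<bar> \<le> (1 + 3 * rn_tauc) * d"
      proof -
        have "rn_tauc * rn_zc - t * s = - (dt * s + rn_tauc * \<delta>)" unfolding dt_def \<delta>_def s_def by algebra
        moreover have "\<bar>dt * s\<bar> \<le> d * 1" unfolding abs_mult using d s by (intro mult_mono) auto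
        moreover have "\<bar>rn_tauc * \<delta>\<bar> \<le> rn_tauc * (3 * d)" unfolding abs_mult using rn_tauc_pos \<delta> by (intro mult_mono) auto
        moreover have "(1 + 3 * rn_tauc) * d = d * 1 + rn_tauc * (3 * d)" by (simp add: algebra_simps)
        ultimately show ?thesis by linarith
      qed
      have "1 / (2 * t * s) - 3 * pi / 2 = (rn_tauc * rn_zc - t * s) / (2 * t * s * rn_tauc * rn_zc)"
        unfolding c using t s rn_tauc_pos rn_zc_sq(2) by (simp add: field_simps)
      then have "\<bar>1 / (2 * t * s) - 3 * pi / 2\<bar> = \<bar>rn_tauc * rn_zc - t * s\<bar> / (2 * t * s * rn_tauc * rn_zc)"
        using t s rn_tauc_pos rn_zc_sq(2) by (simp add: abs_mult)
      also have "\<dots> \<le> ((1 + 3 * rn_tauc) * d) / (2 * (rn_tauc / 2) * (1 / 4) * rn_tauc * rn_zc)"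
        using num t s rn_tauc_pos rn_zc_sq(2) d by (intro frac_le mult_right_mono mult_mono) auto
      also have "\<dots> = C3 * d" by (simp add: C3_def power2_eq_square)
      finally show ?thesis .
    qed
    have d_bd: "\<bar>y ^ 5 / (2 * t * s * (s + y))\<bar> \<le> C4 * \<bar>y\<bar> ^ 5"
    proof -
      have "2 * t * s * (s + y) \<ge> 2 * (rn_tauc / 2) * (1 / 4) * (1 / 8)"
        using t s y' rn_tauc_pos by (intro mult_mono) auto
      then have "\<bar>y\<bar> ^ 5 / (2 * t * s * (s + y)) \<le> \<bar>y\<bar> ^ 5 / (2 * (rn_tauc / 2) * (1 / 4) * (1 / 8))"
        using rn_tauc_pos t s y' by (intro divide_left_mono mult_pos_pos) auto
      moreover have "\<bar>2 * t * s * (s + y)\<bar> = 2 * t * s * (s + y)" using t s y' by simp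
      ultimately show ?thesis by (simp add: C4_def abs_divide power_abs)
    qed
    let ?O = "cusp_order rn_tauc rn_qc (y, t, q)"
    have O: "?O = \<bar>y\<bar> ^ 5 + d * \<bar>y\<bar> ^ 3 + d\<^sup>2 * \<bar>y\<bar>" by (simp add: cusp_order_def d_def)
    have O_parts: "\<bar>y\<bar> ^ 5 \<le> ?O" "d * \<bar>y\<bar> ^ 3 \<le> ?O" "d\<^sup>2 * \<bar>y\<bar> \<le> ?O" unfolding O using d by auto
    have "rn_action (rn_chart y t q) t q
      - (rn_action (rn_chart 0 t q) t q - rn_w t q * y + rn_u t q * y\<^sup>2 + 3 * pi / 2 * y ^ 4)
      = ((1 + 2 * q) / (2 * t) - 2 * pi * s + rn_w t q) * y + (2 * s / t - pi - rn_u t q) * y\<^sup>2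
        + (1 / (2 * t * s) - 3 * pi / 2) * y ^ 4 - y ^ 5 / (2 * t * s * (s + y))"
      using rn_action_expansion[of s y q t] s y' t unfolding rn_chart_eq s_def[symmetric] by (simp add: algebra_simps)
    moreover have "\<bar>((1 + 2 * q) / (2 * t) - 2 * pi * s + rn_w t q) * y\<bar> \<le> C1 * ?O"
    proof -
      have "\<bar>((1 + 2 * q) / (2 * t) - 2 * pi * s + rn_w t q) * y\<bar> \<le> C1 * d\<^sup>2 * \<bar>y\<bar>"
        unfolding abs_mult using a_bd by (intro mult_right_mono) auto
      also have "\<dots> \<le> C1 * ?O" unfolding mult.assoc using O_parts(3) pos by (intro mult_left_mono) auto
      finally show ?thesis .
    qed
    moreover have "\<bar>(2 * s / t - pi - rn_u t q) * y\<^sup>2\<bar> \<le> C2 * ?O"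
    proof -
      have "\<bar>(2 * s / t - pi - rn_u t q) * y\<^sup>2\<bar> \<le> C2 * d\<^sup>2 * \<bar>y\<bar>\<^sup>2"
        unfolding abs_mult using b_bd by (intro mult_mono) auto
      also have "\<dots> \<le> C2 * d\<^sup>2 * \<bar>y\<bar>"
        using y' pos power_decreasing[of 1 2 "\<bar>y\<bar>"] by (intro mult_left_mono) auto
      also have "\<dots> \<le> C2 * ?O" unfolding mult.assoc using O_parts(3) pos by (intro mult_left_mono) auto
      finally show ?thesis .
    qed
    moreover have "\<bar>(1 / (2 * t * s) - 3 * pi / 2) * y ^ 4\<bar> \<le> C3 * ?O"
    proof -
      have "\<bar>(1 / (2 * t * s) - 3 * pi / 2) * y ^ 4\<bar> \<le> C3 * d * \<bar>y\<bar> ^ 4"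
        unfolding abs_mult power_abs[symmetric] using c_bd by (intro mult_mono) auto
      also have "\<dots> \<le> C3 * d * \<bar>y\<bar> ^ 3"
        using y' pos d power_decreasing[of 3 4 "\<bar>y\<bar>"] by (intro mult_left_mono) auto
      also have "\<dots> \<le> C3 * ?O" unfolding mult.assoc using O_parts(2) pos by (intro mult_left_mono) auto
      finally show ?thesis .
    qed
    moreover have "\<bar>y ^ 5 / (2 * t * s * (s + y))\<bar> \<le> C4 * ?O"
      by (rule order_trans[OF d_bd mult_left_mono[OF O_parts(1) pos(6)]])
    moreover have "\<bar>a1 + a2 + a3 - a4\<bar> \<le> (c1 + c2 + c3 + c4) * b"
      if "\<bar>a1\<bar> \<le> c1 * b" "\<bar>a2\<bar> \<le> c2 * b" "\<bar>a3\<bar> \<le> c3 * b" "\<bar>a4\<bar> \<le> c4 * b"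
      for a1 a2 a3 a4 b c1 c2 c3 c4 :: real
      using that unfolding distrib_right by linarith
    ultimately show ?thesis by presburger
  qed
  show ?thesis
  proof (rule bigoI[of _ "C1 + C2 + C3 + C4"], unfold eventually_nhds_metric, intro exI[of _ e] conjI allI impI e(1))
    fix p :: "real \<times> real \<times> real" assume "dist p (0, rn_tauc, rn_qc) < e"
    moreover obtain y t q where p: "p = (y, t, q)" by (cases p)
    ultimately have n: "norm (y, t - rn_tauc, q - rn_qc) < e" by (simp add: dist_norm)
    have "\<bar>y\<bar> < e" using n norm_fst_le[of y "(t - rn_tauc, q - rn_qc)"] by simp
    moreover have "control_size rn_tauc rn_qc t q < e"
      using n norm_snd_le[of "(t - rn_tauc, q - rn_qc)" y] by (simp add: control_size_def)
    ultimately have "\<bar>rn_action (rn_chart y t q) t q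
      - (rn_action (rn_chart 0 t q) t q - rn_w t q * y + rn_u t q * y\<^sup>2 + 3 * pi / 2 * y ^ 4)\<bar>
      \<le> (C1 + C2 + C3 + C4) * cusp_order rn_tauc rn_qc (y, t, q)"
      by (rule main)
    also have "\<dots> \<le> (C1 + C2 + C3 + C4) * norm (cusp_order rn_tauc rn_qc (y, t, q))"
      using pos by (intro mult_left_mono) auto
    finally show "norm (case p of (y, \<tau>, q) \<Rightarrow> rn_action (rn_chart y \<tau> q) \<tau> q
      - (rn_action (rn_chart 0 \<tau> q) \<tau> q - rn_w \<tau> q * y + rn_u \<tau> q * y\<^sup>2 + 3 * pi / 2 * y ^ 4))
      \<le> (C1 + C2 + C3 + C4) * norm (cusp_order rn_tauc rn_qc p)"
      by (simp add: p)
  qed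
qed

section \<open>The two control fields and the zero-field line\<close>

lemma rn_u_DERIV:
  "((\<lambda>t. rn_u t q) has_real_derivative - (sqrt 6 * pi\<^sup>2 / 2)) (at t)"
  "((\<lambda>q. rn_u t q) has_real_derivative 3 * pi) (at q)"
  unfolding rn_u_def by (auto intro!: derivative_eq_intros)

lemma rn_w_DERIV:
  "((\<lambda>t. rn_w t q) has_real_derivative pi\<^sup>2) (at t)"
  "((\<lambda>q. rn_w t q) has_real_derivative sqrt 6 * pi / 2) (at q)"
  unfolding rn_w_def by (auto intro!: derivative_eq_intros)

lemma jacobian2_rn: "jacobian2 rn_u rn_w t q = - (9 * pi ^ 3 / 2)"
proof -
  have "jacobian2 rn_u rn_w t q = - (sqrt 6 * pi\<^sup>2 / 2) * (sqrt 6 * pi / 2) - 3 * pi * pi\<^sup>2"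
    unfolding jacobian2_def rn_u_DERIV[THEN DERIV_imp_deriv] rn_w_DERIV[THEN DERIV_imp_deriv] ..
  also have "\<dots> = - ((sqrt 6 * sqrt 6) * pi ^ 3 / 4) - 3 * pi ^ 3" by algebra
  finally show ?thesis by simp
qed

lemma bij_rn_fields: "bij (\<lambda>(\<tau>, q). (rn_u \<tau> q, rn_w \<tau> q))"
proof -
  let ?f = "\<lambda>(\<tau>, q). (rn_u \<tau> q, rn_w \<tau> q)"
  \<comment> \<open>Cramer's rule for the linear system of determinant - 9 pi^3 / 2, with numerators
    and denominator rescaled by - 2.\<close>
  let ?inv = "\<lambda>(u, w). (rn_tauc + (6 * pi * w - sqrt 6 * pi * u) / (9 * pi ^ 3),
    rn_qc + (sqrt 6 * pi\<^sup>2 * w + 2 * pi\<^sup>2 * u) / (9 * pi ^ 3))"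
  have s6: "sqrt 6 * sqrt 6 = (6::real)" by simp
  have p: "9 * pi ^ 3 \<noteq> 0" by simp
  {
    fix t q :: real
    define a b where "a = t - rn_tauc" and "b = q - rn_qc"
    have uw: "rn_u t q = 3 * pi * b - sqrt 6 * pi\<^sup>2 / 2 * a" "rn_w t q = pi\<^sup>2 * a + sqrt 6 * pi / 2 * b"
      by (simp_all add: rn_u_def rn_w_def a_def b_def)
    have "6 * pi * rn_w t q - sqrt 6 * pi * rn_u t q = 6 * pi ^ 3 * a + (sqrt 6 * sqrt 6) * pi ^ 3 / 2 * a"
      unfolding uw by (simp add: field_simps power2_eq_square power3_eq_cube)
    also have "\<dots> = 9 * pi ^ 3 * a" unfolding s6 by simp
    finally have 1: "(6 * pi * rn_w t q - sqrt 6 * pi * rn_u t q) / (9 * pi ^ 3) = a" using p by simp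
    have "sqrt 6 * pi\<^sup>2 * rn_w t q + 2 * pi\<^sup>2 * rn_u t q = (sqrt 6 * sqrt 6) * pi ^ 3 / 2 * b + 6 * pi ^ 3 * b"
      unfolding uw by (simp add: field_simps power2_eq_square power3_eq_cube)
    also have "\<dots> = 9 * pi ^ 3 * b" unfolding s6 by simp
    finally have 2: "(sqrt 6 * pi\<^sup>2 * rn_w t q + 2 * pi\<^sup>2 * rn_u t q) / (9 * pi ^ 3) = b" using p by simp
    note 1 2
  } note inv = this
  have left: "\<forall>p\<in>UNIV. ?inv (?f p) = p" by (auto simp: inv)
  have right: "\<forall>p\<in>UNIV. ?f (?inv p) = p"
  proof (intro ballI)
    fix p :: "real \<times> real"
    obtain u w where pp: "p = (u, w)" by fastforce
    define A B where "A = (6 * pi * w - sqrt 6 * pi * u) / (9 * pi ^ 3)"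
      and "B = (sqrt 6 * pi\<^sup>2 * w + 2 * pi\<^sup>2 * u) / (9 * pi ^ 3)"
    have AB: "9 * pi ^ 3 * A = 6 * pi * w - sqrt 6 * pi * u" "9 * pi ^ 3 * B = sqrt 6 * pi\<^sup>2 * w + 2 * pi\<^sup>2 * u"
      by (simp_all add: A_def B_def)
    have "9 * pi ^ 3 * (3 * pi * B - sqrt 6 * pi\<^sup>2 / 2 * A)
        = 3 * pi * (9 * pi ^ 3 * B) - sqrt 6 * pi\<^sup>2 / 2 * (9 * pi ^ 3 * A)" by algebra
    also have "\<dots> = 6 * pi ^ 3 * u + (sqrt 6 * sqrt 6) * pi ^ 3 / 2 * u"
      unfolding AB by (simp add: field_simps power2_eq_square power3_eq_cube)
    also have "\<dots> = 9 * pi ^ 3 * u" unfolding s6 by simp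
    finally have 1: "3 * pi * B - sqrt 6 * pi\<^sup>2 / 2 * A = u" by (simp only: mult_cancel_left p) simp
    have "9 * pi ^ 3 * (pi\<^sup>2 * A + sqrt 6 * pi / 2 * B)
        = pi\<^sup>2 * (9 * pi ^ 3 * A) + sqrt 6 * pi / 2 * (9 * pi ^ 3 * B)" by algebra
    also have "\<dots> = 6 * pi ^ 3 * w + (sqrt 6 * sqrt 6) * pi ^ 3 / 2 * w"
      unfolding AB by (simp add: field_simps power2_eq_square power3_eq_cube)
    also have "\<dots> = 9 * pi ^ 3 * w" unfolding s6 by simp
    finally have 2: "pi\<^sup>2 * A + sqrt 6 * pi / 2 * B = w" by (simp only: mult_cancel_left p) simp
    show "?f (?inv p) = p"
      unfolding pp prod.case A_def[symmetric] B_def[symmetric] using 1 2 by (simp add: rn_u_def rn_w_def)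
  qed
  show ?thesis by (rule bij_betw_byWitness[OF left right]) auto
qed

lemma rn_w_zero_iff: "rn_w t q = 0 \<longleftrightarrow> t - rn_tauc = - (sqrt 6 / (2 * pi)) * (q - rn_qc)"
proof -
  define X where "X = - (sqrt 6 / (2 * pi)) * (q - rn_qc)"
  have "rn_w t q = pi\<^sup>2 * ((t - rn_tauc) - X)"
    by (simp add: rn_w_def X_def field_simps power2_eq_square)
  then show ?thesis unfolding X_def[symmetric] by simp
qed

lemma rn_u_on_zero_field:
  assumes "rn_w t q = 0" shows "rn_u t q = 9 * pi / 2 * (q - rn_qc)"
proof -
  have t: "t - rn_tauc = - (sqrt 6 / (2 * pi)) * (q - rn_qc)" using assms rn_w_zero_iff by blast
  have "rn_u t q = 3 * pi * (q - rn_qc) + (sqrt 6 * sqrt 6) * pi / 4 * (q - rn_qc)"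
    unfolding rn_u_def t by (simp add: power2_eq_square)
  then show ?thesis by simp
qed

section \<open>Uniqueness of the local minimum on the nonnegative zero-field side\<close>

lemma local_min_deriv_zero:
  assumes "local_min f x" "(f has_real_derivative D) (at x)"
  shows "D = 0"
proof -
  from assms(1) obtain d where "d > 0" "\<And>y. dist y x < d \<Longrightarrow> f x \<le> f y"
    unfolding local_min_def eventually_nhds_metric by blast
  then show ?thesis using DERIV_local_min[OF assms(2), of d] by (simp add: dist_real_def abs_minus_commute)
qed

text \<open>The derivative is y times 2 u + 4 c y^2, and c > 0 makes this factor positive for y
  \<noteq> 0 even when u = 0.\<close>

lemma quartic_unique_local_min:
  assumes "u \<ge> 0" "c > 0"
  shows "\<exists>!y. local_min (\<lambda>y. u * y\<^sup>2 + c * y ^ 4) y"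
proof (rule ex1I[of _ 0])
  show "local_min (\<lambda>y. u * y\<^sup>2 + c * y ^ 4) 0"
    unfolding local_min_def using assms by (intro always_eventually) simp
  fix y assume *: "local_min (\<lambda>y. u * y\<^sup>2 + c * y ^ 4) y"
  have "((\<lambda>y. u * y\<^sup>2 + c * y ^ 4) has_real_derivative (2 * u + 4 * c * y\<^sup>2) * y) (at y)"
    by (auto intro!: derivative_eq_intros simp: algebra_simps power2_eq_square power3_eq_cube)
  from local_min_deriv_zero[OF * this] have "2 * u + 4 * c * y\<^sup>2 = 0 \<or> y = 0" by simp
  moreover have "2 * u + 4 * c * y\<^sup>2 > 0" if "y \<noteq> 0" using that assms by (simp add: add_nonneg_pos)
  ultimately show "y = 0" by force
qed

lemma rn_ze_nonneg: "rn_ze q \<ge> 0"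
  by (simp add: rn_ze_def)

text \<open>The polynomial condition is the positivity of \<open>rn_rho_E\<close>. Both square roots
  disappear through 1 + 12 (z^2 + 3 z^4) = (1 + 6 z^2)^2.\<close>

lemma rn_branch_iff: "z \<in> rn_branch t q \<longleftrightarrow> z > 0 \<and> q\<^sup>2 < z\<^sup>2 + 3 * z ^ 4"
proof (cases "z > 0")
  case True
  have "rn_ze q < z \<longleftrightarrow> (- 1 + sqrt (1 + 12 * q\<^sup>2)) / 6 < z\<^sup>2"
    unfolding rn_ze_def using True by (simp add: real_sqrt_less_iff[of _ "z\<^sup>2", symmetric])
  also have "\<dots> \<longleftrightarrow> sqrt (1 + 12 * q\<^sup>2) < 1 + 6 * z\<^sup>2" by (simp add: field_simps)
  also have "\<dots> \<longleftrightarrow> sqrt (1 + 12 * q\<^sup>2) < sqrt ((1 + 6 * z\<^sup>2)\<^sup>2)" by simp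
  also have "\<dots> \<longleftrightarrow> 1 + 12 * q\<^sup>2 < (1 + 6 * z\<^sup>2)\<^sup>2" by (rule real_sqrt_less_iff)
  also have "(1 + 6 * z\<^sup>2)\<^sup>2 = 1 + 12 * (z\<^sup>2 + 3 * z ^ 4)" by algebra
  also have "1 + 12 * q\<^sup>2 < 1 + 12 * (z\<^sup>2 + 3 * z ^ 4) \<longleftrightarrow> q\<^sup>2 < z\<^sup>2 + 3 * z ^ 4"
    by (simp del: distrib_left_numeral)
  finally show ?thesis using True by (simp add: rn_branch_def)
next
  case False
  then show ?thesis using rn_ze_nonneg[of q] by (simp add: rn_branch_def)
qed

lemma rn_branch_pos: "z \<in> rn_branch t q \<Longrightarrow> z > 0"
  by (simp add: rn_branch_iff)

lemma rn_branch_open: "open (rn_branch t q)"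
  unfolding rn_branch_def by (simp add: greaterThan_def[symmetric])

lemma rn_action_continuous: "continuous_on (rn_branch t q) (\<lambda>z. rn_action z t q)"
  unfolding rn_action_def by (intro continuous_intros) (auto dest: rn_branch_pos)

text \<open>\<open>F z = 1/z + 3 z - q\<^sup>2/z\<^sup>3\<close> turns the saddle equation into \<open>F z = 4 pi \<tau>\<close>; its derivative is
  \<open>(3 z\<^sup>4 - z\<^sup>2 + 3 q\<^sup>2)/z\<^sup>4\<close>, a quadratic in \<open>z\<^sup>2\<close> of discriminant \<open>1 - 36 q\<^sup>2\<close>.\<close>

lemma rn_saddle_function_mono:
  fixes q x y :: real
  assumes "q \<ge> 1 / 6" "0 < x" "x < y"
  shows "1 / x + 3 * x - q\<^sup>2 / x ^ 3 < 1 / y + 3 * y - q\<^sup>2 / y ^ 3"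
proof -
  have q: "q\<^sup>2 \<ge> 1 / 36" using assms(1) power_mono[of "1/6" q 2] by (simp add: power_divide)
  \<comment> \<open>The difference is factored exactly instead of going through the derivative, so
    strictness survives at q = 1/6, where the derivative has a zero.\<close>
  have "(1 / y + 3 * y - q\<^sup>2 / y ^ 3) - (1 / x + 3 * x - q\<^sup>2 / x ^ 3)
      = (y - x) * (3 * x ^ 3 * y ^ 3 - x\<^sup>2 * y\<^sup>2 + q\<^sup>2 * (x\<^sup>2 + x * y + y\<^sup>2)) / (x ^ 3 * y ^ 3)"
  proof -
    have "1 / y - 1 / x = (y - x) * (- (x\<^sup>2 * y\<^sup>2)) / (x ^ 3 * y ^ 3)"
      using assms by (simp add: field_simps power2_eq_square power3_eq_cube)
    moreover have "3 * y - 3 * x = (y - x) * (3 * x ^ 3 * y ^ 3) / (x ^ 3 * y ^ 3)" using assms by simp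
    moreover have "q\<^sup>2 / x ^ 3 - q\<^sup>2 / y ^ 3 = (y - x) * (q\<^sup>2 * (x\<^sup>2 + x * y + y\<^sup>2)) / (x ^ 3 * y ^ 3)"
      using assms by (simp add: field_simps power2_eq_square power3_eq_cube)
    ultimately show ?thesis by (simp add: add_divide_distrib diff_divide_distrib algebra_simps)
  qed
  moreover have "3 * x ^ 3 * y ^ 3 - x\<^sup>2 * y\<^sup>2 + q\<^sup>2 * (x\<^sup>2 + x * y + y\<^sup>2) > 0"
  proof -
    define P where "P = x * y"
    have P: "P > 0" using assms by (simp add: P_def)
    have "(y - x)\<^sup>2 > 0" using assms by simp
    then have "x\<^sup>2 + x * y + y\<^sup>2 > 3 * P" by (simp add: P_def power2_eq_square algebra_simps)
    then have "q\<^sup>2 * (x\<^sup>2 + x * y + y\<^sup>2) > q\<^sup>2 * (3 * P)" using q by (intro mult_strict_left_mono) auto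
    moreover have "q\<^sup>2 * (3 * P) \<ge> 1 / 36 * (3 * P)" using q P by (intro mult_right_mono) auto
    \<comment> \<open>With x^2 + x y + y^2 > 3 P the bracket exceeds 3 P times a perfect square; the
      threshold q = 1/6 is what makes the discriminant vanish.\<close>
    moreover have "3 * P ^ 3 - P\<^sup>2 + 1 / 36 * (3 * P) = 3 * P * (P - 1 / 6)\<^sup>2" by algebra
    moreover have "3 * P * (P - 1 / 6)\<^sup>2 \<ge> 0" using P by simp
    moreover have "3 * x ^ 3 * y ^ 3 = 3 * P ^ 3" "x\<^sup>2 * y\<^sup>2 = P\<^sup>2" by (simp_all add: P_def power_mult_distrib)
    ultimately show ?thesis by linarith
  qed
  ultimately have "(1 / y + 3 * y - q\<^sup>2 / y ^ 3) - (1 / x + 3 * x - q\<^sup>2 / x ^ 3) > 0"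
    using assms by simp
  then show ?thesis by simp
qed

text \<open>The derivative of the action is a positive factor times F z - 4 pi t with F strictly
  increasing, so there is at most one stationary point. Since F vanishes at the extremal endpoint
  and 4 pi t > 0, the crossing lies strictly inside the branch.\<close>

lemma rn_unique_local_min:
  assumes q: "q \<ge> 1 / 6" and t: "t > 0"
  shows "\<exists>!z. z \<in> rn_branch t q \<and> local_min (\<lambda>z. rn_action z t q) z"
proof -
  define F where "F z = 1 / z + 3 * z - q\<^sup>2 / z ^ 3" for z :: real
  have mono: "F x < F y" if "0 < x" "x < y" for x y
    unfolding F_def using rn_saddle_function_mono[OF q that] .
  have der: "((\<lambda>z. rn_action z t q) has_real_derivative z / (2 * t) * (F z - 4 * pi * t)) (at z)" if "z > 0" for z
  proof -
    have eq: "1 / (2 * t) * (1 + 3 * z\<^sup>2 - q\<^sup>2 / z\<^sup>2 - 4 * pi * t * z) = z / (2 * t) * (F z - 4 * pi * t)"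
      using that t by (simp add: F_def field_simps power2_eq_square power3_eq_cube)
    show ?thesis using rn_action_derivatives(1)[OF that, of t q] unfolding eq .
  qed
  define z0 where "z0 = rn_ze q"
  have z0: "z0 > 0" "q\<^sup>2 = z0\<^sup>2 + 3 * z0 ^ 4"
  proof -
    have "sqrt (1 + 12 * q\<^sup>2) > 1" using q by simp
    then show "z0 > 0" by (simp add: z0_def rn_ze_def)
    have sq: "z0\<^sup>2 = (- 1 + sqrt (1 + 12 * q\<^sup>2)) / 6"
      unfolding z0_def rn_ze_def using \<open>sqrt (1 + 12 * q\<^sup>2) > 1\<close> by simp
    then have "1 + 6 * z0\<^sup>2 = sqrt (1 + 12 * q\<^sup>2)" by simp
    then have "(1 + 6 * z0\<^sup>2)\<^sup>2 = 1 + 12 * q\<^sup>2" by (simp only:) simp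
    moreover have "(1 + 6 * z0\<^sup>2)\<^sup>2 = 1 + 12 * (z0\<^sup>2 + 3 * z0 ^ 4)" by algebra
    ultimately show "q\<^sup>2 = z0\<^sup>2 + 3 * z0 ^ 4" by simp
  qed
  have F0: "F z0 = 0"
    unfolding F_def z0(2) using z0(1) by (simp add: field_simps power2_eq_square power3_eq_cube power4_eq_xxxx)
  \<comment> \<open>At z1 \<ge> q the charge term is dominated by 1 / z1, so F z1 \<ge> 3 z1 \<ge> 4
    pi t.\<close>
  define z1 where "z1 = z0 + q + 4 * pi * t"
  have z1: "z1 > z0" "z1 > 0" using q t z0(1) by (auto simp: z1_def intro!: add_pos_pos)
  have "F z1 \<ge> 4 * pi * t"
  proof -
    have "z1 \<ge> q" "z1 \<ge> 4 * pi * t" "q \<ge> 0" using z0(1) q t by (auto simp: z1_def)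
    then have "q\<^sup>2 \<le> z1\<^sup>2" by (intro power_mono) auto
    then have "q\<^sup>2 / z1 ^ 3 \<le> z1\<^sup>2 / z1 ^ 3" using z1 by (intro divide_right_mono) auto
    also have "\<dots> = 1 / z1" using z1 by (simp add: power2_eq_square power3_eq_cube)
    finally show ?thesis unfolding F_def using \<open>z1 \<ge> 4 * pi * t\<close> z1 by linarith
  qed
  moreover have "continuous_on {z0..z1} F" unfolding F_def using z0(1) by (intro continuous_intros) auto
  ultimately obtain zs where zs: "z0 \<le> zs" "zs \<le> z1" "F zs = 4 * pi * t"
    using IVT'[of F z0 "4 * pi * t" z1] F0 z1 t by auto
  have zs0: "zs > z0" using zs F0 t by (cases "zs = z0") auto
  have zs_pos: "zs > 0" using zs0 z0(1) by simp
  show ?thesis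
  proof (rule ex1I[of _ zs])
    have "rn_action zs t q \<le> rn_action z t q" if z: "z > 0" for z
    proof (cases z zs rule: linorder_cases)
      case less
      have "rn_action zs t q \<le> rn_action z t q"
      proof (rule DERIV_nonpos_imp_nonincreasing[of z zs])
        fix x assume x: "z \<le> x" "x \<le> zs"
        then have "F x \<le> 4 * pi * t" using mono[of x zs] zs(3) z by (cases "x = zs") auto
        then have "x / (2 * t) * (F x - 4 * pi * t) \<le> 0" using x z t by (intro mult_nonneg_nonpos) auto
        then show "\<exists>y. ((\<lambda>z. rn_action z t q) has_real_derivative y) (at x) \<and> y \<le> 0"
          using der[of x] x z by auto
      qed (use less in simp)
      then show ?thesis .
    next
      case greater
      have "rn_action zs t q \<le> rn_action z t q"
      proof (rule DERIV_nonneg_imp_nondecreasing[of zs z])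
        fix x assume x: "zs \<le> x" "x \<le> z"
        then have "F x \<ge> 4 * pi * t" using mono[of zs x] zs(3) zs_pos by (cases "x = zs") auto
        then have "x / (2 * t) * (F x - 4 * pi * t) \<ge> 0" using x zs_pos t by (intro mult_nonneg_nonneg) auto
        then show "\<exists>y. ((\<lambda>z. rn_action z t q) has_real_derivative y) (at x) \<and> 0 \<le> y"
          using der[of x] x zs_pos by auto
      qed (use greater in simp)
      then show ?thesis .
    qed simp
    moreover have "\<forall>\<^sub>F z in nhds zs. z \<in> {0<..}" by (rule eventually_nhds_in_open) (use zs_pos in auto)
    ultimately have "local_min (\<lambda>z. rn_action z t q) zs"
      unfolding local_min_def by (auto elim: eventually_mono)
    then show "zs \<in> rn_branch t q \<and> local_min (\<lambda>z. rn_action z t q) zs"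
      using zs0 by (simp add: rn_branch_def z0_def)
    fix z assume "z \<in> rn_branch t q \<and> local_min (\<lambda>z. rn_action z t q) z"
    then have z: "z > 0" "local_min (\<lambda>z. rn_action z t q) z" by (auto dest: rn_branch_pos)
    have "z / (2 * t) * (F z - 4 * pi * t) = 0" by (rule local_min_deriv_zero[OF z(2) der[OF z(1)]])
    then have "F z = F zs" using z(1) t zs(3) by simp
    then show "z = zs" using mono[of z zs] mono[of zs z] z(1) zs_pos by (cases z zs rule: linorder_cases) auto
  qed
qed

section \<open>Local and global hypotheses for the RN-AdS action\<close>

lemma smooth_near_fst: "smooth_near fst x" and smooth_near_fst_snd: "smooth_near (\<lambda>p. fst (snd p)) y"
  and smooth_near_snd: "smooth_near snd z" and smooth_near_snd_snd: "smooth_near (\<lambda>p. snd (snd p)) w"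
  by (auto intro!: smooth_near_linear bounded_linear_fst bounded_linear_snd bounded_linear_fst_comp bounded_linear_snd_comp)

lemma rn_action_smooth: "z > 0 \<Longrightarrow> t > 0 \<Longrightarrow> smooth_near (\<lambda>(z, \<tau>, q). rn_action z \<tau> q) (z, t, q)"
  unfolding rn_action_def case_prod_unfold
  by (intro smooth_near_mult smooth_near_add smooth_near_diff smooth_near_power smooth_near_divide
      smooth_near_const smooth_near_fst smooth_near_fst_snd smooth_near_snd_snd) auto

lemma cusp_local_rn: "cusp_local rn_model"
  unfolding cusp_local_def
proof (intro conjI)
  show "has_normal_form rn_model"
    unfolding has_normal_form_def action0_def using rn_normal_form
    by (simp add: rn_model_def algebra_simps)
  show "smooth_near (\<lambda>(\<tau>, q). ufield rn_model \<tau> q) (crit rn_model)"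
    "smooth_near (\<lambda>(\<tau>, q). wfield rn_model \<tau> q) (crit rn_model)"
    unfolding rn_model_def cusp_model.simps rn_u_def rn_w_def case_prod_unfold
    by (intro smooth_near_mult smooth_near_add smooth_near_diff smooth_near_const smooth_near_fst smooth_near_snd)+
  show "jacobian2 (ufield rn_model) (wfield rn_model) (taucrit rn_model) (qcrit rn_model) \<noteq> 0"
    by (simp add: rn_model_def jacobian2_rn)
  show "smooth_near (\<lambda>(z, \<tau>, q). action rn_model z \<tau> q) (zcrit rn_model, taucrit rn_model, qcrit rn_model)"
    using rn_action_smooth rn_zc_sq(2) rn_tauc_pos by (simp add: rn_model_def)
  show "smooth_near (\<lambda>(y, \<tau>, q). chart rn_model y \<tau> q) (0, taucrit rn_model, qcrit rn_model)"
    unfolding rn_model_def cusp_model.simps rn_chart_eq case_prod_unfold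
    by (intro smooth_near_add smooth_near_sqrt smooth_near_fst smooth_near_snd_snd) (simp add: rn_qc_def)
  show "deriv (\<lambda>y. chart rn_model y (taucrit rn_model) (qcrit rn_model)) 0 \<noteq> 0"
  proof -
    have "((\<lambda>y. sqrt rn_qc + y) has_real_derivative 1) (at 0)" by (auto intro!: derivative_eq_intros)
    then show ?thesis by (simp add: rn_model_def rn_chart_eq DERIV_imp_deriv)
  qed
  show "\<exists>r>0. \<forall>\<^sub>F (\<tau>, q) in nhds (crit rn_model). ball (zcrit rn_model) r \<subseteq> branch rn_model \<tau> q"
  proof (intro exI[of _ "rn_zc / 2"] conjI)
    \<comment> \<open>1/6 + 1/30 = 1/5 and (1/5)^2 < 1/24 = (rn_zc / 2)^2, so points above rn_zc / 2
      already satisfy q^2 < z^2.\<close>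
    have "\<forall>\<^sub>F (t, q) in nhds (rn_tauc, rn_qc). control_size rn_tauc rn_qc t q < 1 / 30"
      unfolding eventually_nhds_controls by (intro exI[of _ "1 / 30"]) auto
    then have "\<forall>\<^sub>F (t, q) in nhds (rn_tauc, rn_qc). ball rn_zc (rn_zc / 2) \<subseteq> rn_branch t q"
    proof eventually_elim
      case (elim p)
      obtain t q where p: "p = (t, q)" by fastforce
      have "\<bar>q\<bar> \<le> 1 / 5" using elim control_components(2)[of q rn_qc rn_tauc t] unfolding p prod.case rn_qc_def by linarith
      then have "\<bar>q\<bar>\<^sup>2 \<le> (1 / 5)\<^sup>2" by (intro power_mono) auto
      then have q: "q\<^sup>2 < 1 / 24" by (simp add: power_divide)
      have "z \<in> rn_branch t q" if "z \<in> ball rn_zc (rn_zc / 2)" for z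
      proof -
        have z: "z > rn_zc / 2" using that unfolding mem_ball dist_real_def by linarith
        then have "z\<^sup>2 > (rn_zc / 2)\<^sup>2" using rn_zc_sq(2) by (intro power_strict_mono) auto
        then have "z\<^sup>2 > 1 / 24" by (simp add: power_divide rn_zc_sq)
        moreover have "3 * z ^ 4 \<ge> 0" by simp
        ultimately have "q\<^sup>2 < z\<^sup>2 + 3 * z ^ 4" using q by linarith
        then show ?thesis using z rn_zc_sq(2) by (simp add: rn_branch_iff)
      qed
      then show ?case by (auto simp: p)
    qed
    then show "\<forall>\<^sub>F (\<tau>, q) in nhds (crit rn_model). ball (zcrit rn_model) (rn_zc / 2) \<subseteq> branch rn_model \<tau> q"
      by (simp add: rn_model_def)
  qed (use rn_zc_sq in simp)
qed (simp_all add: rn_model_def rn_u_def rn_w_def rn_chart_eq sqrt_qc)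

lemma rn_action_crit:
  assumes "z > 0"
  shows "rn_action z rn_tauc rn_qc - rn_action rn_zc rn_tauc rn_qc = (z - rn_zc) ^ 4 / (2 * rn_tauc * z)"
proof -
  define c where "c = rn_zc"
  have c: "c > 0" "c\<^sup>2 = 1 / 6" using rn_zc_sq by (simp_all add: c_def)
  have q: "rn_qc = c\<^sup>2" by (simp add: c rn_qc_def)
  have "rn_tauc * pi = 2 * c"
    by (simp add: rn_tauc_def c_def rn_zc_def field_simps)
  then have t: "2 * pi * rn_tauc = 4 * c" by simp
  have bracket: "z + z ^ 3 + (c\<^sup>2)\<^sup>2 / z - 4 * c * z\<^sup>2 - (c + c ^ 3 + (c\<^sup>2)\<^sup>2 / c - 4 * c * c\<^sup>2) = (z - c) ^ 4 / z"
  proof -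
    have 1: "1 = 6 * c\<^sup>2" using c(2) by simp
    \<comment> \<open>A polynomial identity in free z and c; the relation 6 c^2 = 1 is isolated in
      one cofactor.\<close>
    have "z * (z + z ^ 3 - 4 * c * z\<^sup>2 - (c + c ^ 3 + c ^ 3 - 4 * c * c\<^sup>2)) + c ^ 4
        = (z - c) ^ 4 + (1 - 6 * c\<^sup>2) * (z\<^sup>2 - c * z)" by algebra
    also have "\<dots> = (z - c) ^ 4" using 1 by simp
    finally have "(z - c) ^ 4 / z = (z * (z + z ^ 3 - 4 * c * z\<^sup>2 - (c + c ^ 3 + c ^ 3 - 4 * c * c\<^sup>2)) + c ^ 4) / z"
      by simp
    also have "\<dots> = (z + z ^ 3 - 4 * c * z\<^sup>2 - (c + c ^ 3 + c ^ 3 - 4 * c * c\<^sup>2)) + c ^ 4 / z"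
      using assms by (simp only: add_divide_distrib) simp
    finally have sum: "(z - c) ^ 4 / z = (z + z ^ 3 - 4 * c * z\<^sup>2 - (c + c ^ 3 + c ^ 3 - 4 * c * c\<^sup>2)) + c ^ 4 / z" .
    have e: "(c\<^sup>2)\<^sup>2 / c = c ^ 3" "(c\<^sup>2)\<^sup>2 = c ^ 4"
      using c(1) by (simp_all add: power2_eq_square power3_eq_cube power4_eq_xxxx)
    show ?thesis unfolding sum e(1) unfolding e(2) by simp
  qed
  have "rn_action z rn_tauc rn_qc - rn_action c rn_tauc rn_qc
      = 1 / (2 * rn_tauc) * (z + z ^ 3 + (c\<^sup>2)\<^sup>2 / z - 4 * c * z\<^sup>2 - (c + c ^ 3 + (c\<^sup>2)\<^sup>2 / c - 4 * c * c\<^sup>2))"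
    unfolding rn_action_def q t by (simp only: right_diff_distrib[symmetric])
  also have "\<dots> = 1 / (2 * rn_tauc) * ((z - c) ^ 4 / z)" by (simp only: bracket)
  finally show ?thesis by (simp add: c_def)
qed

lemma rn_controls_eventually:
  assumes "isCont f (rn_tauc, rn_qc)" "f (rn_tauc, rn_qc) > (c::real)"
  shows "\<forall>\<^sub>F p in nhds (rn_tauc, rn_qc). f p > c"
  using order_tendstoD(1)[of f _ "nhds (rn_tauc, rn_qc)" c] assms
  by (simp add: isCont_def tendsto_at_iff_tendsto_nhds)

text \<open>The term pi z^2 of the action is independent of the controls. The other terms are
  positive and near the critical controls lose at most a fraction \<epsilon>; for |z - rn_zc| \<ge>
  r this loss and the desired gap together stay below the exact quartic excess at the critical
  controls.\<close>

lemma cusp_global_rn: "cusp_global rn_model"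
  unfolding cusp_global_def
proof (intro conjI allI impI)
  show "taucrit rn_model > 0" by (simp add: rn_model_def rn_tauc_pos)
  show "\<forall>\<^sub>F (\<tau>, q) in nhds (crit rn_model).
      open (branch rn_model \<tau> q) \<and> continuous_on (branch rn_model \<tau> q) (\<lambda>z. action rn_model z \<tau> q)"
    by (intro always_eventually) (auto simp: rn_model_def rn_branch_open rn_action_continuous)
  fix r :: real assume r: "r > 0"
  \<comment> \<open>For d = |z - rn_zc| \<ge> r one has z \<le> rn_zc + d \<le> A d. Each summand of
    \<open>K\<close> turns one of z^2, z^4, z and rn_qc^2 into a multiple of d^4, using d \<ge> r to
    raise the power.\<close>
  define A where "A = rn_zc / r + 1"
  define K where "K = A\<^sup>2 / r\<^sup>2 + A ^ 4 + A / r ^ 3 + rn_qc\<^sup>2 / r ^ 4"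
  have A: "A > 0" using r rn_zc_sq(2) by (simp add: A_def add_pos_pos)
  have K: "K > 0" using A r by (simp add: K_def add_pos_nonneg add_nonneg_pos)
  have Kb: "z\<^sup>2 + z ^ 4 + rn_qc\<^sup>2 + z \<le> K * (z - rn_zc) ^ 4" if z: "z > 0" and far: "\<bar>z - rn_zc\<bar> \<ge> r" for z
  proof -
    define d where "d = \<bar>z - rn_zc\<bar>"
    have d: "d \<ge> r" "d > 0" using far r by (auto simp: d_def)
    have "rn_zc = rn_zc / r * r" using r by simp
    also have "\<dots> \<le> rn_zc / r * d" using d(1) r rn_zc_sq(2) by (intro mult_left_mono) auto
    finally have zA: "z \<le> A * d" by (simp add: A_def d_def algebra_simps)
    have frac: "d ^ (4 - j) \<le> d ^ 4 / r ^ j" if "j \<le> 4" for j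
    proof -
      have "d ^ (4 - j) * r ^ j \<le> d ^ (4 - j) * d ^ j" using d r by (intro mult_left_mono power_mono) auto
      also have "\<dots> = d ^ 4" using that by (simp flip: power_add)
      finally show ?thesis using r by (simp add: pos_le_divide_eq)
    qed
    have "z\<^sup>2 \<le> (A * d)\<^sup>2" using zA z by (intro power_mono) auto
    also have "\<dots> = A\<^sup>2 * d\<^sup>2" by (rule power_mult_distrib)
    also have "\<dots> \<le> A\<^sup>2 * (d ^ 4 / r\<^sup>2)" using frac[of 2] by (intro mult_left_mono) auto
    finally have 1: "z\<^sup>2 \<le> A\<^sup>2 / r\<^sup>2 * d ^ 4" by simp
    have "z ^ 4 \<le> (A * d) ^ 4" using zA z by (intro power_mono) auto
    then have 2: "z ^ 4 \<le> A ^ 4 * d ^ 4" by (simp add: power_mult_distrib)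
    have "A * d \<le> A * (d ^ 4 / r ^ 3)" using frac[of 3] A by (intro mult_left_mono) auto
    then have 3: "z \<le> A / r ^ 3 * d ^ 4" using zA by simp
    have "rn_qc\<^sup>2 * 1 \<le> rn_qc\<^sup>2 * (d ^ 4 / r ^ 4)" using frac[of 4] by (intro mult_left_mono) auto
    then have 4: "rn_qc\<^sup>2 \<le> rn_qc\<^sup>2 / r ^ 4 * d ^ 4" by simp
    have "(z - rn_zc) ^ 4 = d ^ 4" by (simp add: d_def)
    then show ?thesis using 1 2 3 4 unfolding K_def by (simp add: distrib_right)
  qed
  define \<epsilon> where "\<epsilon> = min (1 / K) (1 / 2)"
  have \<epsilon>: "\<epsilon> > 0" "\<epsilon> * K \<le> 1" "\<epsilon> < 1"
  proof -
    have "\<epsilon> * K \<le> 1 / K * K" unfolding \<epsilon>_def using K by (intro mult_right_mono) auto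
    then show "\<epsilon> * K \<le> 1" using K by simp
  qed (use K in \<open>auto simp: \<epsilon>_def\<close>)
  have tc: "rn_tauc > 0" by (rule rn_tauc_pos)
  have ev1: "\<forall>\<^sub>F p in nhds (rn_tauc, rn_qc). fst p > 0"
    by (rule rn_controls_eventually) (use tc in \<open>auto intro!: continuous_intros\<close>)
  have ev2: "\<forall>\<^sub>F p in nhds (rn_tauc, rn_qc). rn_tauc / fst p > 1 - \<epsilon>"
    by (rule rn_controls_eventually) (use tc \<epsilon> in \<open>auto intro!: continuous_intros\<close>)
  have ev3: "\<forall>\<^sub>F p in nhds (rn_tauc, rn_qc). rn_tauc / fst p * (snd p)\<^sup>2 > (1 - \<epsilon>) * rn_qc\<^sup>2"
    by (rule rn_controls_eventually) (use tc \<epsilon> in \<open>auto intro!: continuous_intros simp: rn_qc_def\<close>)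
  show "\<exists>\<delta>>0. \<forall>\<^sub>F (\<tau>, q) in nhds (crit rn_model). \<forall>z\<in>branch rn_model \<tau> q. r \<le> \<bar>z - zcrit rn_model\<bar> \<longrightarrow>
      action rn_model (zcrit rn_model) (taucrit rn_model) (qcrit rn_model) + \<delta> \<le> action rn_model z \<tau> q"
  proof (intro exI[of _ "\<epsilon> / (2 * rn_tauc)"] conjI)
    have "\<forall>\<^sub>F (t, q) in nhds (rn_tauc, rn_qc). \<forall>z\<in>rn_branch t q. r \<le> \<bar>z - rn_zc\<bar> \<longrightarrow>
      rn_action rn_zc rn_tauc rn_qc + \<epsilon> / (2 * rn_tauc) \<le> rn_action z t q"
      using ev1 ev2 ev3
    proof eventually_elim
      case (elim p)
      obtain t q where p: "p = (t, q)" by fastforce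
      have t: "t > 0" "rn_tauc / t \<ge> 1 - \<epsilon>" "rn_tauc / t * q\<^sup>2 \<ge> (1 - \<epsilon>) * rn_qc\<^sup>2" using elim by (auto simp: p)
      have "rn_action rn_zc rn_tauc rn_qc + \<epsilon> / (2 * rn_tauc) \<le> rn_action z t q"
        if z: "z > 0" and far: "r \<le> \<bar>z - rn_zc\<bar>" for z
      proof -
        have "(1 - \<epsilon>) * (z + z ^ 3) \<le> rn_tauc / t * (z + z ^ 3)" using t(2) z by (intro mult_right_mono) auto
        moreover have "(1 - \<epsilon>) * (rn_qc\<^sup>2 / z) \<le> rn_tauc / t * (q\<^sup>2 / z)"
          using divide_right_mono[OF t(3), of z] z by simp
        ultimately have "(1 - \<epsilon>) * (z + z ^ 3 + rn_qc\<^sup>2 / z) \<le> rn_tauc / t * (z + z ^ 3 + q\<^sup>2 / z)"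
          by (simp add: distrib_left)
        then have "1 / (2 * rn_tauc) * ((1 - \<epsilon>) * (z + z ^ 3 + rn_qc\<^sup>2 / z))
            \<le> 1 / (2 * rn_tauc) * (rn_tauc / t * (z + z ^ 3 + q\<^sup>2 / z))"
          using tc by (intro mult_left_mono) auto
        also have "\<dots> = 1 / (2 * t) * (z + z ^ 3 + q\<^sup>2 / z)" using tc by simp
        also have "\<dots> = rn_action z t q + pi * z\<^sup>2" using t(1) by (simp add: rn_action_def right_diff_distrib)
        finally have 1: "1 / (2 * rn_tauc) * ((1 - \<epsilon>) * (z + z ^ 3 + rn_qc\<^sup>2 / z)) - pi * z\<^sup>2 \<le> rn_action z t q" by simp
        have "rn_action z rn_tauc rn_qc = 1 / (2 * rn_tauc) * (z + z ^ 3 + rn_qc\<^sup>2 / z) - pi * z\<^sup>2"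
          using tc by (simp add: rn_action_def right_diff_distrib)
        with 1 have 2: "rn_action z rn_tauc rn_qc - \<epsilon> / (2 * rn_tauc) * (z + z ^ 3 + rn_qc\<^sup>2 / z) \<le> rn_action z t q"
        proof -
          have "1 / (2 * rn_tauc) * ((1 - \<epsilon>) * E) = 1 / (2 * rn_tauc) * E - \<epsilon> / (2 * rn_tauc) * E" for E
            by (simp add: left_diff_distrib diff_divide_distrib)
          with 1 show ?thesis unfolding \<open>rn_action z rn_tauc rn_qc = _\<close> by simp
        qed
        \<comment> \<open>After multiplication by 2 rn_tauc z, the loss contributes z^2 + z^4 +
          rn_qc^2 and the gap contributes z, each with the factor \<epsilon>.\<close>
        have "\<epsilon> * (z\<^sup>2 + z ^ 4 + rn_qc\<^sup>2 + z) \<le> \<epsilon> * (K * (z - rn_zc) ^ 4)"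
          using Kb[OF z far] \<epsilon>(1) by (intro mult_left_mono) auto
        also have "\<dots> = \<epsilon> * K * (z - rn_zc) ^ 4" by simp
        also have "\<dots> \<le> 1 * (z - rn_zc) ^ 4" using \<epsilon>(2) by (intro mult_right_mono) auto
        finally have "\<epsilon> * (z\<^sup>2 + z ^ 4 + rn_qc\<^sup>2 + z) / (2 * rn_tauc * z) \<le> (z - rn_zc) ^ 4 / (2 * rn_tauc * z)"
          using tc z by (intro divide_right_mono) auto
        moreover have "\<epsilon> * (z\<^sup>2 + z ^ 4 + rn_qc\<^sup>2 + z) / (2 * rn_tauc * z)
            = \<epsilon> / (2 * rn_tauc) * (z + z ^ 3 + rn_qc\<^sup>2 / z) + \<epsilon> / (2 * rn_tauc)"
          using tc z by (simp add: field_simps power2_eq_square power3_eq_cube power4_eq_xxxx)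
        ultimately show ?thesis using 2 rn_action_crit[OF z] by linarith
      qed
      then show ?case by (auto simp: p dest: rn_branch_pos)
    qed
    then show "\<forall>\<^sub>F (\<tau>, q) in nhds (crit rn_model). \<forall>z\<in>branch rn_model \<tau> q. r \<le> \<bar>z - zcrit rn_model\<bar> \<longrightarrow>
      action rn_model (zcrit rn_model) (taucrit rn_model) (qcrit rn_model) + \<epsilon> / (2 * rn_tauc) \<le> action rn_model z \<tau> q"
      by (simp add: rn_model_def)
  qed (use \<epsilon> tc in simp)
qed

section \<open>The energy measure\<close>

lemma rn_rho_E_nonneg:
  assumes "z \<in> rn_branch t q" shows "rn_rho_E z t q g \<ge> 0"
proof -
  have z: "z > 0" "q\<^sup>2 < z\<^sup>2 + 3 * z ^ 4" using assms by (auto simp: rn_branch_iff)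
  then have "q\<^sup>2 / z\<^sup>2 \<le> (z\<^sup>2 + 3 * z ^ 4) / z\<^sup>2" by (intro divide_right_mono) auto
  also have "\<dots> = 1 + 3 * z\<^sup>2" using z(1) by (simp add: field_simps flip: power_add)
  finally show ?thesis by (simp add: rn_rho_E_def)
qed

lemma rn_rho_E_crit: "rn_rho_E rn_zc t rn_qc g = 2 / 3"
  by (simp add: rn_rho_E_def rn_zc_sq) (simp add: rn_qc_def power_divide)

lemma density_near_saddle_rn: "density_near_saddle rn_model rn_rho_E"
  unfolding density_near_saddle_def
proof (intro conjI allI impI)
  fix z t q g assume "z \<in> branch rn_model t q \<and> 0 < (g::real)"
  then show "0 \<le> rn_rho_E z t q g" by (intro rn_rho_E_nonneg) (simp add: rn_model_def)
next
  let ?\<rho> = "\<lambda>(z, t, q, g). rn_rho_E z t q g"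
  show "\<exists>\<rho>'. smooth_near \<rho>' (zcrit rn_model, taucrit rn_model, qcrit rn_model, 0) \<and>
     \<rho>' (zcrit rn_model, taucrit rn_model, qcrit rn_model, 0) \<noteq> 0 \<and>
     (\<forall>\<^sub>F (z, \<tau>, q, g) in nhds (zcrit rn_model, taucrit rn_model, qcrit rn_model, 0).
        g > 0 \<longrightarrow> rn_rho_E z \<tau> q g = \<rho>' (z, \<tau>, q, g))"
  proof (intro exI[of _ ?\<rho>] conjI)
    have "bounded_linear (\<lambda>p::real \<times> real \<times> real \<times> real. fst (snd (snd p)))"
      by (intro bounded_linear_fst_comp bounded_linear_snd_comp bounded_linear_snd)
    then show "smooth_near ?\<rho> (zcrit rn_model, taucrit rn_model, qcrit rn_model, 0)"
      unfolding rn_rho_E_def case_prod_unfold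
      by (intro smooth_near_mult smooth_near_add smooth_near_diff smooth_near_power smooth_near_divide
          smooth_near_const smooth_near_fst smooth_near_linear) (use rn_zc_sq(2) in \<open>auto simp: rn_model_def\<close>)
    show "?\<rho> (zcrit rn_model, taucrit rn_model, qcrit rn_model, 0) \<noteq> 0"
      by (simp add: rn_model_def rn_rho_E_crit)
  qed (auto intro: always_eventually)
qed

lemma mu0_rn: "mu0 rn_model rn_rho_E rn_tauc rn_qc = 2 / 3"
proof -
  have "((\<lambda>y. sqrt rn_qc + y) has_real_derivative 1) (at 0)" by (auto intro!: derivative_eq_intros)
  then have "(\<lambda>g. rho_y rn_model rn_rho_E 0 rn_tauc rn_qc g) = (\<lambda>g. 2 / 3)"
    by (simp add: rho_y_def rn_model_def rn_chart_eq DERIV_imp_deriv sqrt_qc rn_rho_E_crit)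
  then show ?thesis unfolding mu0_def by (intro tendsto_Lim) simp_all
qed

text \<open>The cubic term of the action, with coefficient at least 1 / (4 rn_tauc) for t < 2
  rn_tauc, beats pi z^2 + 2 z beyond \<open>Z0\<close>. One linear term pays for the growth of the
  density, bounded by \<open>3 * exp z\<close>; the other leaves exp(- |z|).\<close>

lemma rn_weight_bound:
  assumes "z \<in> rn_branch t q" "0 < t" "t < 2 * rn_tauc"
  defines "Z0 \<equiv> (pi + 2) * (4 * rn_tauc) + 1"
  shows "rn_rho_E z t q g * exp (- rn_action z t q) \<le> 3 * exp (2 * Z0 + pi * Z0\<^sup>2) * exp (- \<bar>z\<bar>)"
proof -
  have z: "z > 0" using rn_branch_pos[OF assms(1)] .
  define b where "b = 1 / (4 * rn_tauc)"
  have b: "b > 0" using rn_tauc_pos by (simp add: b_def)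
  have Z0: "Z0 \<ge> 1" "b * Z0 \<ge> pi + 2" using rn_tauc_pos by (auto simp: Z0_def b_def field_simps)
  have "b \<le> 1 / (2 * t)" unfolding b_def using assms(2,3) rn_tauc_pos by (intro divide_left_mono) auto
  then have "b * z ^ 3 \<le> 1 / (2 * t) * (z + z ^ 3 + q\<^sup>2 / z)" using z b assms(2) by (intro mult_mono) auto
  also have "\<dots> = rn_action z t q + pi * z\<^sup>2" using assms(2) by (simp add: rn_action_def right_diff_distrib)
  finally have act: "b * z ^ 3 - pi * z\<^sup>2 \<le> rn_action z t q" by simp
  have "2 * z + pi * z\<^sup>2 - b * z ^ 3 \<le> 2 * Z0 + pi * Z0\<^sup>2"
  proof (cases "z \<le> Z0")
    case True
    have "2 * z + pi * z\<^sup>2 \<le> 2 * Z0 + pi * Z0\<^sup>2" using True z by (intro add_mono mult_left_mono power_mono) auto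
    moreover have "b * z ^ 3 \<ge> 0" using b z by simp
    ultimately show ?thesis by linarith
  next
    case False
    then have "(pi + 2) * z\<^sup>2 \<le> (b * z) * z\<^sup>2" using Z0(2) b by (intro mult_right_mono) (auto intro: order_trans mult_left_mono)
    also have "\<dots> = b * z ^ 3" by (simp add: power2_eq_square power3_eq_cube)
    finally have 1: "pi * z\<^sup>2 + 2 * z\<^sup>2 \<le> b * z ^ 3" by (simp add: distrib_right)
    have "1 * z \<le> z * z" using False Z0 z by (intro mult_right_mono) auto
    then have "2 * z \<le> 2 * z\<^sup>2" by (simp add: power2_eq_square)
    moreover have "2 * Z0 + pi * Z0\<^sup>2 \<ge> 0" using Z0 by simp
    ultimately show ?thesis using 1 by linarith
  qed
  then have e: "z + - rn_action z t q \<le> (2 * Z0 + pi * Z0\<^sup>2) + - \<bar>z\<bar>" using act z by linarith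
  have "1 + z + z\<^sup>2 / 2 \<le> exp z" using exp_lower_Taylor_quadratic[of z] z by simp
  then have "1 / 2 * (1 + 3 * z\<^sup>2) \<le> 3 * exp z" using z by simp
  moreover have "rn_rho_E z t q g \<le> 1 / 2 * (1 + 3 * z\<^sup>2)" by (simp add: rn_rho_E_def)
  ultimately have "rn_rho_E z t q g \<le> 3 * exp z" by linarith
  then have "rn_rho_E z t q g * exp (- rn_action z t q) \<le> 3 * exp z * exp (- rn_action z t q)" by (intro mult_right_mono) auto
  also have "\<dots> = 3 * exp (z + - rn_action z t q)" by (simp only: exp_add mult.assoc)
  also have "\<dots> \<le> 3 * exp ((2 * Z0 + pi * Z0\<^sup>2) + - \<bar>z\<bar>)" using e by simp
  also have "\<dots> = 3 * exp (2 * Z0 + pi * Z0\<^sup>2) * exp (- \<bar>z\<bar>)" by (simp only: exp_add mult.assoc)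
  finally show ?thesis .
qed

lemma density_tail_rn: "density_tail rn_model rn_rho_E"
  unfolding density_tail_def
proof (intro exI conjI)
  let ?c = "3 * exp (2 * ((pi + 2) * (4 * rn_tauc) + 1) + pi * ((pi + 2) * (4 * rn_tauc) + 1)\<^sup>2)"
  have "\<forall>\<^sub>F p in nhds (rn_tauc, rn_qc). fst p > 0"
    by (rule rn_controls_eventually) (use rn_tauc_pos in \<open>auto intro!: continuous_intros\<close>)
  moreover have "\<forall>\<^sub>F p in nhds (rn_tauc, rn_qc). - fst p > - (2 * rn_tauc)"
    by (rule rn_controls_eventually) (use rn_tauc_pos in \<open>auto intro!: continuous_intros\<close>)
  ultimately have ev: "\<forall>\<^sub>F p in nhds (rn_tauc, rn_qc). 0 < fst p \<and> fst p < 2 * rn_tauc"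
    by eventually_elim auto
  have bound: "set_integrable lborel (rn_branch t q) (\<lambda>z. rn_rho_E z t q g * exp (- rn_action z t q / 1)) \<and>
      (LINT z:rn_branch t q|lborel. rn_rho_E z t q g * exp (- rn_action z t q / 1))
        \<le> ?c * (LINT z|lborel. exp (- \<bar>z\<bar>))" if t: "0 < t" "t < 2 * rn_tauc" for t q g
  proof -
    let ?f = "\<lambda>z. rn_rho_E z t q g * exp (- rn_action z t q)"
    define F where "F z = indicat_real (rn_branch t q) z * ?f z" for z
    have iE: "integrable lborel (\<lambda>z. ?c * exp (- \<bar>z\<bar>))" using integrable_exp_minus_abs by simp
    have pt: "0 \<le> F z \<and> F z \<le> ?c * exp (- \<bar>z\<bar>)" for z
      using rn_weight_bound[of z t q g] rn_rho_E_nonneg[of z t q g] t by (auto simp: F_def indicator_def)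
    have "continuous_on (rn_branch t q) ?f"
      unfolding rn_rho_E_def by (intro continuous_intros rn_action_continuous) (auto dest: rn_branch_pos)
    from borel_measurable_continuous_on_indicator[OF _ this] rn_branch_open[of t q]
    have meas: "F \<in> borel_measurable borel" by (simp add: F_def[abs_def])
    have iF: "integrable lborel F"
      by (rule Bochner_Integration.integrable_bound[OF iE]) (use meas pt in auto)
    have "(LINT z|lborel. F z) \<le> (LINT z|lborel. ?c * exp (- \<bar>z\<bar>))"
      by (rule integral_mono[OF iF iE]) (use pt in auto)
    then show ?thesis using iF by (simp add: set_integrable_def set_lebesgue_integral_def F_def[abs_def])
  qed
  \<comment> \<open>This fixes the reference coupling as 1; the same bound serves all g because the
    density does not depend on g.\<close>
  show "(1::real) > 0" by simp
  have "\<forall>\<^sub>F (p, g) in nhds (rn_tauc, rn_qc) \<times>\<^sub>F at_right (0::real). 0 < fst p \<and> fst p < 2 * rn_tauc"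
    using ev by (simp add: eventually_prod1)
  then show "\<forall>\<^sub>F ((\<tau>, q), g) in nhds (crit rn_model) \<times>\<^sub>F at_right 0.
        set_integrable lborel (branch rn_model \<tau> q) (\<lambda>z. rn_rho_E z \<tau> q g * exp (- action rn_model z \<tau> q / 1)) \<and>
        (LINT z:branch rn_model \<tau> q|lborel. rn_rho_E z \<tau> q g * exp (- action rn_model z \<tau> q / 1))
          \<le> ?c * (LINT z|lborel. exp (- \<bar>z\<bar>))"
    unfolding rn_model_def cusp_model.simps
  proof eventually_elim
    case (elim x)
    obtain t q g where x: "x = ((t, q), g)" by (metis prod.exhaust)
    show ?case using bound[of t q g] elim by (simp only: x prod.case fst_conv)
  qed
qed

theorem mainTheorem5:
  shows
    "((\<lambda>(\<tau>, q). rn_shift \<tau> q) \<in> O[nhds (rn_tauc, rn_qc)](\<lambda>(\<tau>, q). control_size rn_tauc rn_qc \<tau> q) \<and>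
      (\<forall>\<^sub>F (\<tau>, q) in nhds (rn_tauc, rn_qc). (deriv ^^ 3) (\<lambda>y. rn_action (rn_chart y \<tau> q) \<tau> q) 0 = 0) \<and>
      (\<lambda>(y, \<tau>, q). rn_action (rn_chart y \<tau> q) \<tau> q
          - (rn_action (rn_chart 0 \<tau> q) \<tau> q - rn_w \<tau> q * y + rn_u \<tau> q * y\<^sup>2 + 3 * pi / 2 * y ^ 4))
        \<in> O[nhds (0, rn_tauc, rn_qc)](cusp_order rn_tauc rn_qc) \<and>
      (\<forall>\<tau> q. jacobian2 rn_u rn_w \<tau> q = - (9 * pi ^ 3 / 2) \<and> jacobian2 rn_u rn_w \<tau> q \<noteq> 0) \<and>
      bij (\<lambda>(\<tau>, q). (rn_u \<tau> q, rn_w \<tau> q)) \<and>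
      (\<forall>\<tau> q. rn_w \<tau> q = 0 \<longleftrightarrow> \<tau> - rn_tauc = - (sqrt 6 / (2 * pi)) * (q - rn_qc)) \<and>
      (\<forall>\<tau> q. rn_w \<tau> q = 0 \<longrightarrow> rn_u \<tau> q = 9 * pi / 2 * (q - rn_qc)) \<and>
      (\<forall>\<tau> q. rn_w \<tau> q = 0 \<and> q - rn_qc \<ge> 0 \<longrightarrow>
         rn_u \<tau> q \<ge> 0 \<and>
         (\<exists>!y. local_min (\<lambda>y. - rn_w \<tau> q * y + rn_u \<tau> q * y\<^sup>2 + 3 * pi / 2 * y ^ 4) y) \<and>
         (\<tau> > 0 \<longrightarrow> (\<exists>!z. z \<in> rn_branch \<tau> q \<and> local_min (\<lambda>z. rn_action z \<tau> q) z)))) \<and>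
     (\<forall>M \<rho> N. cusp_local M \<and> density_near_saddle M \<rho> \<and> (\<forall>g>0. N g > 0) \<longrightarrow>
        partition_crossover M \<rho> N \<and>
        (cusp_global M \<and> density_tail M \<rho> \<longrightarrow> free_energy_crossover M \<rho>)) \<and>
     (cusp_local rn_model \<and> cusp_global rn_model \<and>
      (\<forall>\<rho> N. density_near_saddle rn_model \<rho> \<and> (\<forall>g>0. N g > 0) \<longrightarrow>
        partition_crossover rn_model \<rho> N \<and>
        (density_tail rn_model \<rho> \<longrightarrow> free_energy_crossover rn_model \<rho>)) \<and>
      density_near_saddle rn_model rn_rho_E \<and> density_tail rn_model rn_rho_E \<and>
      mu0 rn_model rn_rho_E rn_tauc rn_qc = 2 / 3)"
proof (intro conjI allI impI)
  let ?near = "nhds (rn_tauc, rn_qc)"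
  show "(\<lambda>(\<tau>, q). rn_shift \<tau> q) \<in> O[?near](\<lambda>(\<tau>, q). control_size rn_tauc rn_qc \<tau> q)"
    by (rule rn_shift_bigo)
  have "\<forall>\<^sub>F p in ?near. snd p > 0"
    by (rule rn_controls_eventually) (auto intro!: continuous_intros simp: rn_qc_def)
  then show "\<forall>\<^sub>F (\<tau>, q) in ?near. (deriv ^^ 3) (\<lambda>y. rn_action (rn_chart y \<tau> q) \<tau> q) 0 = 0"
    by eventually_elim (auto intro: rn_third_derivative)
  show "(\<lambda>(y, \<tau>, q). rn_action (rn_chart y \<tau> q) \<tau> q
        - (rn_action (rn_chart 0 \<tau> q) \<tau> q - rn_w \<tau> q * y + rn_u \<tau> q * y\<^sup>2 + 3 * pi / 2 * y ^ 4))
      \<in> O[nhds (0, rn_tauc, rn_qc)](cusp_order rn_tauc rn_qc)"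
    by (rule rn_normal_form)
  show "bij (\<lambda>(\<tau>, q). (rn_u \<tau> q, rn_w \<tau> q))"
    by (rule bij_rn_fields)
  fix \<tau> q
  show "jacobian2 rn_u rn_w \<tau> q = - (9 * pi ^ 3 / 2)" "jacobian2 rn_u rn_w \<tau> q \<noteq> 0"
    by (simp_all add: jacobian2_rn)
  show "rn_w \<tau> q = 0 \<longleftrightarrow> \<tau> - rn_tauc = - (sqrt 6 / (2 * pi)) * (q - rn_qc)"
    by (rule rn_w_zero_iff)
  show u: "rn_u \<tau> q = 9 * pi / 2 * (q - rn_qc)" if "rn_w \<tau> q = 0"
    using that by (rule rn_u_on_zero_field)
  assume zero: "rn_w \<tau> q = 0 \<and> 0 \<le> q - rn_qc"
  then show u0: "0 \<le> rn_u \<tau> q" by (simp add: u)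
  show "\<exists>!y. local_min (\<lambda>y. - rn_w \<tau> q * y + rn_u \<tau> q * y\<^sup>2 + 3 * pi / 2 * y ^ 4) y"
    using quartic_unique_local_min[OF u0, of "3 * pi / 2"] zero by simp
  show "\<exists>!z. z \<in> rn_branch \<tau> q \<and> local_min (\<lambda>z. rn_action z \<tau> q) z" if "\<tau> > 0"
    by (rule rn_unique_local_min[OF _ that]) (use zero in \<open>simp add: rn_qc_def\<close>)
next
  fix M \<rho> and N :: "real \<Rightarrow> real"
  assume *: "cusp_local M \<and> density_near_saddle M \<rho> \<and> (\<forall>g>0. N g > 0)"
  then interpret cusp_saddle M \<rho> by unfold_locales auto
  show "partition_crossover M \<rho> N" using * partition_crossover_saddle by blast
  show "free_energy_crossover M \<rho>" if "cusp_global M \<and> density_tail M \<rho>"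
    using that free_energy_crossover_saddle by blast
next
  fix \<rho> and N :: "real \<Rightarrow> real"
  assume *: "density_near_saddle rn_model \<rho> \<and> (\<forall>g>0. N g > 0)"
  then interpret cusp_saddle rn_model \<rho> using cusp_local_rn by unfold_locales auto
  show "partition_crossover rn_model \<rho> N" using * partition_crossover_saddle by blast
  show "free_energy_crossover rn_model \<rho>" if "density_tail rn_model \<rho>"
    using that cusp_global_rn free_energy_crossover_saddle by blast
qed (rule cusp_local_rn cusp_global_rn density_near_saddle_rn density_tail_rn mu0_rn)+

end
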